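(* Let $1\le d\le n$ and let $\tau$ be a face of the cone $\sigma$ associated to the Grassmann-Hibi toric variety $X_{d,n}=X(I_{d,n})$. Then $X_{d,n}$ is smooth along the orbit $O_\tau$ if and only if the face $\tau$ does not contain any $\sigma_{ij}$ ($1\le i\le n-d-1$, $1\le j\le d-1$).
   Context: $K$ is an algebraically closed field of arbitrary characteristic. $I_{d,n}=\{(i_1,\dots,i_d)\in\mathbb{Z}^d: 1\le i_1<\dots<i_d\le n\}$ with the componentwise order; it is a finite distributive lattice (join and meet are componentwise max and min). For a finite distributive lattice $\mathcal{L}$, the Hibi toric variety $X(\mathcal{L})\subset\mathbb{A}^{\#\mathcal{L}}$ is the affine variety whose vanishing ideal in $K[X_\alpha,\alpha\in\mathcal{L}]$ is generated by the binomials $X_\alpha X_\beta-X_{\alpha\vee\beta}X_{\alpha\wedge\beta}$. Let $J=J(\mathcal{L})$ be the poset of join-irreducible elements ($z$ such that $z=x\vee y$ implies $z=x$ or $z=y$; the minimal element $\hat 0$ of $\mathcal{L}$ is included), and for $\alpha\in\mathcal{L}$ put $I_\alpha=\{z\in J: z\le\alpha\}$. Let $M$ be the free abelian group with basis $\{f_z\}_{z\in J}$, $N$ its dual with dual basis $\{e_z\}_{z\in J}$, and $f_{I_\alpha}=\sum_{z\in I_\alpha}f_z$. Let $\sigma\subset N_{\mathbb{R}}$ be the cone generated by the $e_z$ with $z$ maximal in $J$ and the $e_{y'}-e_y$ with $y$ covering $y'$ in $J$. The semigroup $\sigma^\vee\cap M$ is generated by the $f_{I_\alpha}$, and $X(\mathcal{L})=X_\sigma=\mathrm{Spec}\,K[\sigma^\vee\cap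 M]$, the coordinate $X_\alpha$ corresponding to $f_{I_\alpha}$. Let $T$ be the torus with character group $M$. For a face $\tau$ of $\sigma$, $P_\tau\in X(\mathcal{L})$ is the point whose $\alpha$-th coordinate is $1$ if $f_{I_\alpha}\in\tau^\perp$ and $0$ otherwise; $O_\tau=T\cdot P_\tau$; and $D_\tau=\{\alpha\in\mathcal{L}: P_\tau(\alpha)\ne0\}$. A sublattice $\mathcal{L}'\subset\mathcal{L}$ is embedded if $\alpha\vee\beta,\alpha\wedge\beta\in\mathcal{L}'$ implies $\alpha,\beta\in\mathcal{L}'$; the map $\tau\mapsto D_\tau$ is a bijection between faces of $\sigma$ and embedded sublattices of $\mathcal{L}$. For $1\le i\le n-d-1$, $1\le j\le d-1$ let $\mu_{ij}=(1,\dots,j,i+j+1,\dots,i+d)$, $\lambda_{ij}=(i+1,\dots,i+j,n+1+j-d,\dots,n)$ and $\mathcal{L}_{ij}=I_{d,n}\setminus[\mu_{ij},\lambda_{ij}]$, which is an embedded sublattice; $\sigma_{ij}$ denotes the face of $\sigma$ with $D_{\sigma_{ij}}=\mathcal{L}_{ij}$. *)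

theory Defs
  imports
    "HOL-Computational_Algebra.Computational_Algebra"
    "HOL-Library.Poly_Mapping"
    "HOL-Library.Function_Algebras"
    "HOL-Library.Extended_Nat"
begin

section \<open>Affine algebraic sets\<close>

text \<open>A monomial is a finitely supported exponent vector, a polynomial a finitely supported
  family of coefficients; multiplication on \<^typ>\<open>('a \<Rightarrow>\<^sub>0 nat) \<Rightarrow>\<^sub>0 'k\<close> is the convolution product
  of \<^theory>\<open>HOL-Library.Poly_Mapping\<close>.\<close>

type_synonym ('a, 'k) mpoly = "('a \<Rightarrow>\<^sub>0 nat) \<Rightarrow>\<^sub>0 'k"

definition mvar :: "'a \<Rightarrow> ('a, 'k::field) mpoly" where
  "mvar a = Poly_Mapping.single (Poly_Mapping.single a 1) 1"

definition meval :: "('a, 'k::field) mpoly \<Rightarrow> ('a \<Rightarrow> 'k) \<Rightarrow> 'k" where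
  "meval p x = (\<Sum>m\<in>Poly_Mapping.keys p. Poly_Mapping.lookup p m *
      (\<Prod>a\<in>Poly_Mapping.keys m. x a ^ Poly_Mapping.lookup m a))"

text \<open>If the exponent of \<open>a\<close> in \<open>m\<close> is zero, the truncated difference below is irrelevant because
  the coefficient vanishes.\<close>

definition mpderiv :: "'a \<Rightarrow> ('a, 'k::field) mpoly \<Rightarrow> ('a, 'k) mpoly" where
  "mpderiv a p = (\<Sum>m\<in>Poly_Mapping.keys p.
      Poly_Mapping.single (m - Poly_Mapping.single a 1)
        (of_nat (Poly_Mapping.lookup m a) * Poly_Mapping.lookup p m))"

definition mpolys :: "'a set \<Rightarrow> ('a, 'k::field) mpoly set" where
  "mpolys V = {p. \<forall>m\<in>Poly_Mapping.keys p. Poly_Mapping.keys m \<subseteq> V}"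

text \<open>The affine space with coordinates indexed by the set \<open>V\<close>; points are normalised to be \<open>0\<close>
  outside \<open>V\<close>, so that they are determined by their coordinates.\<close>

definition affine_space :: "'a set \<Rightarrow> ('a \<Rightarrow> 'k::field) set" where
  "affine_space V = {x. \<forall>a. a \<notin> V \<longrightarrow> x a = 0}"

definition zero_locus :: "'a set \<Rightarrow> ('a, 'k::field) mpoly set \<Rightarrow> ('a \<Rightarrow> 'k) set" where
  "zero_locus V F = {x \<in> affine_space V. \<forall>p\<in>F. meval p x = 0}"

definition vanishing_ideal :: "'a set \<Rightarrow> ('a \<Rightarrow> 'k::field) set \<Rightarrow> ('a, 'k) mpoly set" where
  "vanishing_ideal V X = {p \<in> mpolys V. \<forall>x\<in>X. meval p x = 0}"

definition zariski_closed :: "'a set \<Rightarrow> ('a \<Rightarrow> 'k::field) set \<Rightarrow> bool" where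
  "zariski_closed V X \<longleftrightarrow> (\<exists>F \<subseteq> mpolys V. X = zero_locus V F)"

definition irreducible_closed :: "'a set \<Rightarrow> ('a \<Rightarrow> 'k::field) set \<Rightarrow> bool" where
  "irreducible_closed V X \<longleftrightarrow> zariski_closed V X \<and> X \<noteq> {} \<and>
     (\<forall>A B. zariski_closed V A \<and> zariski_closed V B \<and> X \<subseteq> A \<union> B \<longrightarrow> X \<subseteq> A \<or> X \<subseteq> B)"

text \<open>The dimension of \<open>X\<close> at \<open>P\<close>, i.e. the Krull dimension of the local ring of \<open>X\<close> at \<open>P\<close>: its
  prime ideals correspond to the irreducible closed subsets of \<open>X\<close> through \<open>P\<close>.\<close>

definition local_dim :: "'a set \<Rightarrow> ('a \<Rightarrow> 'k::field) set \<Rightarrow> ('a \<Rightarrow> 'k) \<Rightarrow> enat" where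
  "local_dim V X P = Sup {enat k | k. \<exists>Z :: nat \<Rightarrow> ('a \<Rightarrow> 'k) set.
     (\<forall>i\<le>k. irreducible_closed V (Z i) \<and> P \<in> Z i \<and> Z i \<subseteq> X) \<and> (\<forall>i<k. Z i \<subset> Z (Suc i))}"

definition tangent_space :: "'a set \<Rightarrow> ('a \<Rightarrow> 'k::field) set \<Rightarrow> ('a \<Rightarrow> 'k) \<Rightarrow> ('a \<Rightarrow> 'k) set" where
  "tangent_space V X P = {v \<in> affine_space V.
     \<forall>p \<in> vanishing_ideal V X. (\<Sum>a\<in>V. meval (mpderiv a p) P * v a) = 0}"

interpretation fun_space: vector_space "\<lambda>(c::'k::field) (v::'a \<Rightarrow> 'k) a. c * v a"
  by unfold_locales (auto simp: fun_eq_iff algebra_simps)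

definition smooth_at :: "'a set \<Rightarrow> ('a \<Rightarrow> 'k::field) set \<Rightarrow> ('a \<Rightarrow> 'k) \<Rightarrow> bool" where
  "smooth_at V X P \<longleftrightarrow> P \<in> X \<and> enat (fun_space.dim (tangent_space V X P)) = local_dim V X P"

definition smooth_along :: "'a set \<Rightarrow> ('a \<Rightarrow> 'k::field) set \<Rightarrow> ('a \<Rightarrow> 'k) set \<Rightarrow> bool" where
  "smooth_along V X Y \<longleftrightarrow> (\<forall>P\<in>Y. smooth_at V X P)"


section \<open>Hibi toric varieties\<close>

text \<open>Throughout, \<open>L\<close> stands for a finite nonempty sublattice of the ambient distributive lattice
  \<^typ>\<open>'a\<close>, with the induced join and meet.\<close>

definition hibi_binomials :: "'a::distrib_lattice set \<Rightarrow> ('a, 'k::field) mpoly set" where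
  "hibi_binomials L =
     {mvar a * mvar b - mvar (sup a b) * mvar (inf a b) | a b. a \<in> L \<and> b \<in> L}"

text \<open>The ideal generated by the binomials is prime, hence it is the vanishing ideal of this set
  when the field is algebraically closed.\<close>

definition hibi_variety :: "'a::distrib_lattice set \<Rightarrow> ('a \<Rightarrow> 'k::field) set" where
  "hibi_variety L = zero_locus L (hibi_binomials L)"

definition join_irreducibles :: "'a::distrib_lattice set \<Rightarrow> 'a set" where
  "join_irreducibles L = {z \<in> L. \<forall>x\<in>L. \<forall>y\<in>L. z = sup x y \<longrightarrow> z = x \<or> z = y}"

text \<open>With \<open>J = join_irreducibles L\<close>, elements of \<open>M\<close> are integer vectors indexed by \<open>J\<close>, and elements
  of the real vector spaces of \<open>M\<close> and \<open>N\<close> are real vectors indexed by \<open>J\<close>, all extended by \<open>0\<close>.\<close>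

definition ideal_vec :: "'a::distrib_lattice set \<Rightarrow> 'a \<Rightarrow> 'a \<Rightarrow> int" where
  "ideal_vec L \<alpha> z = (if z \<in> join_irreducibles L \<and> z \<le> \<alpha> then 1 else 0)"

definition pairing :: "'a::distrib_lattice set \<Rightarrow> ('a \<Rightarrow> real) \<Rightarrow> ('a \<Rightarrow> real) \<Rightarrow> real" where
  "pairing L u v = (\<Sum>z\<in>join_irreducibles L. u z * v z)"

definition unit_vec :: "'a \<Rightarrow> 'a \<Rightarrow> real" where
  "unit_vec z w = (if w = z then 1 else 0)"

definition covers_in :: "'a::order set \<Rightarrow> 'a \<Rightarrow> 'a \<Rightarrow> bool" where
  "covers_in S y y' \<longleftrightarrow> y \<in> S \<and> y' \<in> S \<and> y' < y \<and> \<not> (\<exists>z\<in>S. y' < z \<and> z < y)"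

definition cone_generators :: "'a::distrib_lattice set \<Rightarrow> ('a \<Rightarrow> real) set" where
  "cone_generators L = (let J = join_irreducibles L in
     {unit_vec z | z. z \<in> J \<and> \<not> (\<exists>w\<in>J. z < w)} \<union>
     {unit_vec y' - unit_vec y | y y'. covers_in J y y'})"

definition hibi_cone :: "'a::distrib_lattice set \<Rightarrow> ('a \<Rightarrow> real) set" where
  "hibi_cone L = {v. \<exists>c :: ('a \<Rightarrow> real) \<Rightarrow> real. (\<forall>g\<in>cone_generators L. 0 \<le> c g) \<and>
     v = (\<lambda>z. \<Sum>g\<in>cone_generators L. c g * g z)}"

definition dual_cone :: "'a::distrib_lattice set \<Rightarrow> ('a \<Rightarrow> real) set" where
  "dual_cone L = {u. (\<forall>z. z \<notin> join_irreducibles L \<longrightarrow> u z = 0) \<and>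
     (\<forall>v\<in>hibi_cone L. 0 \<le> pairing L u v)}"

definition cone_face :: "'a::distrib_lattice set \<Rightarrow> ('a \<Rightarrow> real) set \<Rightarrow> bool" where
  "cone_face L \<tau> \<longleftrightarrow> (\<exists>u\<in>dual_cone L. \<tau> = {v \<in> hibi_cone L. pairing L u v = 0})"

text \<open>The annihilator of \<open>\<tau>\<close> in the lattice \<open>M\<close>.\<close>

definition perp :: "'a::distrib_lattice set \<Rightarrow> ('a \<Rightarrow> real) set \<Rightarrow> ('a \<Rightarrow> int) set" where
  "perp L \<tau> = {m. (\<forall>z. z \<notin> join_irreducibles L \<longrightarrow> m z = 0) \<and>
     (\<forall>v\<in>\<tau>. pairing L (\<lambda>z. of_int (m z)) v = 0)}"

definition face_point :: "'a::distrib_lattice set \<Rightarrow> ('a \<Rightarrow> real) set \<Rightarrow> 'a \<Rightarrow> 'k::field" where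
  "face_point L \<tau> \<alpha> = (if \<alpha> \<in> L \<and> ideal_vec L \<alpha> \<in> perp L \<tau> then 1 else 0)"

text \<open>A point of the torus \<open>T\<close> is a homomorphism from \<open>M\<close> to the multiplicative group of the field,
  given by its values on the basis \<open>f\<^sub>z\<close>, \<open>z \<in> J\<close> (and normalised to \<open>1\<close> outside \<open>J\<close>).\<close>

definition torus :: "'a::distrib_lattice set \<Rightarrow> ('a \<Rightarrow> 'k::field) set" where
  "torus L = {t. (\<forall>z\<in>join_irreducibles L. t z \<noteq> 0) \<and> (\<forall>z. z \<notin> join_irreducibles L \<longrightarrow> t z = 1)}"

definition torus_char :: "'a::distrib_lattice set \<Rightarrow> ('a \<Rightarrow> int) \<Rightarrow> ('a \<Rightarrow> 'k::field) \<Rightarrow> 'k" where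
  "torus_char L m t = (\<Prod>z\<in>join_irreducibles L. t z powi m z)"

definition torus_act ::
    "'a::distrib_lattice set \<Rightarrow> ('a \<Rightarrow> 'k::field) \<Rightarrow> ('a \<Rightarrow> 'k) \<Rightarrow> 'a \<Rightarrow> 'k" where
  "torus_act L t x = (\<lambda>\<alpha>. torus_char L (ideal_vec L \<alpha>) t * x \<alpha>)"

definition face_orbit :: "'a::distrib_lattice set \<Rightarrow> ('a \<Rightarrow> real) set \<Rightarrow> ('a \<Rightarrow> 'k::field) set" where
  "face_orbit L \<tau> = (\<lambda>t. torus_act L t (face_point L \<tau>)) ` torus L"

text \<open>The type argument only records the field over which the coordinates of the point are
  taken.\<close>

definition face_sublattice ::
    "'k::field itself \<Rightarrow> 'a::distrib_lattice set \<Rightarrow> ('a \<Rightarrow> real) set \<Rightarrow> 'a set" where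
  "face_sublattice _ L \<tau> = {\<alpha> \<in> L. (face_point L \<tau> \<alpha> :: 'k) \<noteq> 0}"


section \<open>The Grassmann-Hibi toric variety\<close>

text \<open>A tuple \<open>(i\<^sub>1, \<dots>, i\<^sub>d)\<close> is the function \<open>k \<mapsto> i\<^sub>k\<close> extended by \<open>0\<close> outside \<open>{1..d}\<close>. The pointwise
  order and lattice operations on \<^typ>\<open>nat \<Rightarrow> nat\<close> are then the componentwise ones.\<close>

definition grassmann_lattice :: "nat \<Rightarrow> nat \<Rightarrow> (nat \<Rightarrow> nat) set" where
  "grassmann_lattice d n =
     {i. strict_mono_on {1..d} i \<and> i ` {1..d} \<subseteq> {1..n} \<and> (\<forall>k. k \<notin> {1..d} \<longrightarrow> i k = 0)}"

definition mu :: "nat \<Rightarrow> nat \<Rightarrow> nat \<Rightarrow> nat \<Rightarrow> nat" where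
  "mu d i j = (\<lambda>k. if k \<in> {1..j} then k else if k \<in> {j+1..d} then i + k else 0)"

definition lam :: "nat \<Rightarrow> nat \<Rightarrow> nat \<Rightarrow> nat \<Rightarrow> nat \<Rightarrow> nat" where
  "lam d n i j = (\<lambda>k. if k \<in> {1..j} then i + k else if k \<in> {j+1..d} then n + k - d else 0)"

definition sublattice_ij :: "nat \<Rightarrow> nat \<Rightarrow> nat \<Rightarrow> nat \<Rightarrow> (nat \<Rightarrow> nat) set" where
  "sublattice_ij d n i j = grassmann_lattice d n - {mu d i j..lam d n i j}"

text \<open>Well defined for \<open>1 \<le> i \<le> n - d - 1\<close> and \<open>1 \<le> j \<le> d - 1\<close>: the sublattice is then embedded, so
  it belongs to exactly one face.\<close>

definition sigma_ij ::
    "'k::field itself \<Rightarrow> nat \<Rightarrow> nat \<Rightarrow> nat \<Rightarrow> nat \<Rightarrow> ((nat \<Rightarrow> nat) \<Rightarrow> real) set" where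
  "sigma_ij K d n i j = (THE \<tau>. cone_face (grassmann_lattice d n) \<tau> \<and>
     face_sublattice K (grassmann_lattice d n) \<tau> = sublattice_ij d n i j)"

end

theory Submission
  imports Defs
begin

text \<open>The tangent space of the Hibi variety at a point \<open>P\<close> is cut out by the linearised binomials: a pair
  \<open>(P, v)\<close> is a point over the dual numbers, monomials at such a point depend only on their character
  by straightening them to chains, and a polynomial in the vanishing ideal has vanishing coefficient
  sum for each character.

  The generators of the cone are the edges of the Hasse diagram of \<open>J\<close> with a greatest element
  added. Let \<open>E\<close> be the set of edges in the face \<open>\<tau>\<close> and \<open>D = D\<^sub>\<tau>\<close>; an element \<open>\<alpha>\<close> of the lattice cuts
  an edge if \<open>f\<^bsub>I\<^sub>\<alpha>\<^esub>\<close> is \<open>1\<close> on it, and \<open>D\<close> consists of those that cut no edge of \<open>E\<close>. The tangent space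
  along \<open>O\<^sub>\<tau>\<close> has dimension the number of join irreducibles of \<open>D\<close> plus the number of indecomposable
  sets of cut edges. The corresponding \<open>f\<^bsub>I\<^sub>\<alpha>\<^esub>\<close> span the space with basis \<open>J\<close>, so this number is at least
  \<open>card J\<close>, which is the local dimension everywhere on the orbit. Equality holds if every
  edge of \<open>E\<close> can be cut alone, and fails if \<open>E\<close> contains a square. In the Grassmann lattice \<open>J\<close> is a
  grid with a least element added, the faces \<open>\<sigma>\<^sub>i\<^sub>j\<close> are the squares of this grid, and in the
  absence of squares at most one edge of each component of \<open>E\<close> joins two given adjacent rows or
  columns, so that the edge can be cut alone.\<close>

section \<open>Polynomial functions\<close>

text \<open>\<open>smooth_at\<close> refers to the point set alone: to its full vanishing ideal and
  to chains of irreducible closed sets through the given point. Both have to be found in every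
  characteristic and at points as degenerate as the origin, which is the orbit of the whole cone.
  Primality of the binomial ideal is not invoked. Instead, a polynomial that vanishes on the variety
  is restricted to a monomial curve whose exponents separate the finitely many characters of its
  monomials; this works over every infinite field. The dimension is bounded above by counting
  monomial functions of bounded degree and below by an explicit chain. The chain has to start at the
  point itself, so the point is written as a member, possibly at \<open>s = 0\<close>, of a
  one-parameter family of torus translates. The comparison of \<open>card B\<close> with
  \<open>card J\<close> is linear algebra over the rationals, so the criterion cannot depend on the
  field.\<close>

abbreviation keys where "keys \<equiv> Poly_Mapping.keys"
abbreviation lookup where "lookup \<equiv> Poly_Mapping.lookup"

text \<open>The target is any commutative monoid, because the same monomials are evaluated at points
  over the field and at points over the dual numbers.\<close>

definition monom_eval :: "('a \<Rightarrow>\<^sub>0 nat) \<Rightarrow> ('a \<Rightarrow> 'm::comm_monoid_mult) \<Rightarrow> 'm" where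
  "monom_eval m x = (\<Prod>a\<in>keys m. x a ^ lookup m a)"

lemma monom_eval_superset:
  assumes "finite A" "keys m \<subseteq> A"
  shows "monom_eval m x = (\<Prod>a\<in>A. x a ^ lookup m a)"
  unfolding monom_eval_def
  by (rule prod.mono_neutral_left) (use assms in \<open>auto simp: in_keys_iff\<close>)

lemma monom_eval_zero [simp]: "monom_eval 0 x = 1"
  by (simp add: monom_eval_def)

lemma monom_eval_single [simp]: "monom_eval (Poly_Mapping.single a k) x = x a ^ k"
  by (subst monom_eval_superset[of "{a}"]) auto

lemma monom_eval_add: "monom_eval (m + m') x = monom_eval m x * monom_eval m' x"
proof -
  let ?A = "keys m \<union> keys m'"
  have "keys (m + m') \<subseteq> ?A" by (rule Poly_Mapping.keys_add)
  then show ?thesis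
    by (subst (1 2 3) monom_eval_superset[of ?A])
       (auto simp: lookup_add power_add prod.distrib)
qed

lemma meval_monom: "meval p x = (\<Sum>m\<in>keys p. lookup p m * monom_eval m x)"
  by (simp add: meval_def monom_eval_def)

lemma meval_superset:
  assumes "finite A" "keys p \<subseteq> A"
  shows "meval p x = (\<Sum>m\<in>A. lookup p m * monom_eval m x)"
  unfolding meval_monom
  by (rule sum.mono_neutral_left) (use assms in \<open>auto simp: in_keys_iff\<close>)

lemma meval_zero [simp]: "meval 0 x = 0"
  by (simp add: meval_monom)

lemma meval_add: "meval (p + q) x = meval p x + meval q x"
proof -
  let ?A = "keys p \<union> keys q"
  have "keys (p + q) \<subseteq> ?A" by (rule Poly_Mapping.keys_add)
  then show ?thesis
    by (subst (1 2 3) meval_superset[of ?A])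
       (auto simp: lookup_add algebra_simps sum.distrib)
qed

lemma meval_uminus: "meval (- p) x = - meval p x"
  using meval_add[of p "- p" x] by (simp add: add_eq_0_iff)

lemma meval_diff: "meval (p - q) x = meval p x - meval q x"
  using meval_add[of p "- q" x] by (simp add: meval_uminus)

lemma meval_sum: "meval (sum p A) x = (\<Sum>i\<in>A. meval (p i) x)"
  by (induction A rule: infinite_finite_induct) (auto simp: meval_add)

lemma meval_single: "meval (Poly_Mapping.single m c) x = c * monom_eval m x"
  by (subst meval_superset[of "{m}"]) auto

lemma meval_one [simp]: "meval 1 x = 1"
  using meval_single[of 0 1 x] by simp

lemma meval_mvar [simp]: "meval (mvar a) x = x a"
  by (simp add: mvar_def meval_single)

lemma mpoly_sum_singles: "p = (\<Sum>m\<in>keys p. Poly_Mapping.single m (lookup p m))"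
proof (rule poly_mapping_eqI)
  fix m
  show "lookup p m = lookup (\<Sum>m\<in>keys p. Poly_Mapping.single m (lookup p m)) m"
    by (cases "m \<in> keys p")
       (auto simp: lookup_sum lookup_single when_def in_keys_iff sum.delta')
qed

lemma meval_mult: "meval (p * q) x = meval p x * meval q x"
proof -
  have "meval (p * q) x = meval ((\<Sum>m\<in>keys p. Poly_Mapping.single m (lookup p m)) *
      (\<Sum>m\<in>keys q. Poly_Mapping.single m (lookup q m))) x"
    using mpoly_sum_singles[of p] mpoly_sum_singles[of q] by presburger
  also have "\<dots> = (\<Sum>m\<in>keys p. \<Sum>m'\<in>keys q. lookup p m * lookup q m' * (monom_eval m x * monom_eval m' x))"
    by (simp add: sum_product meval_sum mult_single meval_single monom_eval_add)
  also have "\<dots> = meval p x * meval q x"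
    by (simp add: meval_monom sum_product mult_ac)
  finally show ?thesis .
qed

lemma meval_power: "meval (p ^ k) x = meval p x ^ k"
  by (induction k) (auto simp: meval_mult)

lemma mpolys_add: "p \<in> mpolys V \<Longrightarrow> q \<in> mpolys V \<Longrightarrow> p + q \<in> mpolys V"
  using Poly_Mapping.keys_add[of p q] unfolding mpolys_def by blast

lemma mpolys_diff: "p \<in> mpolys V \<Longrightarrow> q \<in> mpolys V \<Longrightarrow> p - q \<in> mpolys V"
  using keys_diff[of p q] unfolding mpolys_def by blast

lemma mpolys_mult: "p \<in> mpolys V \<Longrightarrow> q \<in> mpolys V \<Longrightarrow> p * q \<in> mpolys V"
proof -
  assume *: "p \<in> mpolys V" "q \<in> mpolys V"
  have "keys m \<subseteq> V" if m: "m \<in> keys (p * q)" for m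
  proof -
    obtain a b where "a \<in> keys p" "b \<in> keys q" "m = a + b"
      using m keys_mult[of p q] by blast
    then show ?thesis using * Poly_Mapping.keys_add[of a b] unfolding mpolys_def by blast
  qed
  then show ?thesis by (simp add: mpolys_def)
qed

lemma mpolys_const [simp]: "Poly_Mapping.single 0 c \<in> mpolys V"
  by (auto simp: mpolys_def)

lemma mpolys_one [simp]: "1 \<in> mpolys V"
  by (auto simp: mpolys_def)

lemma mpolys_mvar [simp]: "a \<in> V \<Longrightarrow> mvar a \<in> mpolys V"
  by (auto simp: mpolys_def mvar_def)

lemma mpolys_power: "p \<in> mpolys V \<Longrightarrow> p ^ k \<in> mpolys V"
  by (induction k) (auto intro: mpolys_mult)

text \<open>Along such a curve a polynomial becomes a polynomial in one variable, which over an
  infinite field is determined by its values. Irreducibility is derived from this.\<close>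

definition poly_curve :: "('k::field \<Rightarrow> 'a \<Rightarrow> 'k) \<Rightarrow> bool" where
  "poly_curve \<gamma> \<longleftrightarrow> (\<forall>a. \<exists>q. \<forall>s. \<gamma> s a = poly q s)"

lemma poly_curve_meval:
  assumes "poly_curve \<gamma>"
  shows "\<exists>q. \<forall>s. meval p (\<gamma> s) = poly q s"
proof -
  obtain q where q: "\<And>a s. \<gamma> s a = poly (q a) s"
    using assms unfolding poly_curve_def by metis
  have "meval p (\<gamma> s) = poly (\<Sum>m\<in>keys p. smult (lookup p m) (\<Prod>a\<in>keys m. q a ^ lookup m a)) s" for s
    by (simp add: meval_def q poly_sum poly_prod)
  then show ?thesis by blast
qed

lemma poly_eq_0_infinite:
  fixes p :: "'k::idom poly"
  assumes "infinite (UNIV :: 'k set)" "\<And>s. poly p s = 0"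
  shows "p = 0"
proof (rule ccontr)
  assume "p \<noteq> 0"
  then have "finite {s. poly p s = 0}" by (rule poly_roots_finite)
  then show False using assms by simp
qed

lemma infinite_alg_closed_field: "infinite (UNIV :: 'k::alg_closed_field set)"
proof
  assume fin: "finite (UNIV :: 'k set)"
  let ?p = "1 + (\<Prod>a\<in>UNIV. [:- a, 1:]) :: 'k poly"
  have "degree (\<Prod>a\<in>UNIV. [:- a, 1:] :: 'k poly) = card (UNIV :: 'k set)"
    by (subst degree_prod_eq_sum_degree) auto
  moreover have "0 < card (UNIV :: 'k set)" using fin by (simp add: card_gt_0_iff)
  ultimately have "degree ?p > 0" by (simp add: degree_add_eq_right)
  then obtain z where "poly ?p z = 0" using alg_closed_imp_poly_has_root by blast
  moreover have "poly (\<Prod>a\<in>UNIV. [:- a, 1:] :: 'k poly) z = 0"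
    using fin by (simp add: poly_prod)
  ultimately show False by simp
qed

section \<open>Linear algebra in spaces of functions\<close>

lemma fun_space_span_sum:
  assumes "\<And>i. i \<in> I \<Longrightarrow> u i \<in> fun_space.span S"
  shows "(\<lambda>x. \<Sum>i\<in>I. c i * u i x) \<in> fun_space.span S"
proof -
  have "(\<Sum>i\<in>I. (\<lambda>x. c i * u i x)) \<in> fun_space.span S"
    by (intro fun_space.span_sum fun_space.span_scale assms)
  moreover have "(\<Sum>i\<in>I. (\<lambda>x. c i * u i x)) = (\<lambda>x. \<Sum>i\<in>I. c i * u i x)"
    by (induction I rule: infinite_finite_induct) (auto simp: fun_eq_iff)
  ultimately show ?thesis by simp
qed

lemma sum_fun_apply: "(\<Sum>i\<in>I. f i) x = (\<Sum>i\<in>I. f i x)"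
  by (induction I rule: infinite_finite_induct) auto

text \<open>Independence of an indexed family includes injectivity, so that dimensions can be
  compared through the cardinality of index sets.\<close>

definition indep_family :: "'i set \<Rightarrow> ('i \<Rightarrow> 'a \<Rightarrow> 'k::field) \<Rightarrow> bool" where
  "indep_family I u \<longleftrightarrow> (\<forall>c. (\<forall>x. (\<Sum>i\<in>I. c i * u i x) = 0) \<longrightarrow> (\<forall>i\<in>I. c i = 0))"

lemma indep_family_inj_on:
  assumes "finite I" "indep_family I u"
  shows "inj_on u I"
proof (rule inj_onI, rule ccontr)
  fix i j assume ij: "i \<in> I" "j \<in> I" "u i = u j" "i \<noteq> j"
  define c where "c k = (if k = i then 1 else if k = j then -1 else 0 :: 'c)" for k
  have "(\<Sum>k\<in>I. c k * u k x) = 0" for x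
  proof -
    have "(\<Sum>k\<in>I. c k * u k x) = (\<Sum>k\<in>{i,j}. c k * u k x)"
      by (rule sum.mono_neutral_right) (use assms ij in \<open>auto simp: c_def\<close>)
    also have "\<dots> = 0" using ij by (simp add: c_def)
    finally show ?thesis .
  qed
  with assms(2) have "c i = 0" using ij(1) unfolding indep_family_def by blast
  then show False by (simp add: c_def)
qed

lemma indep_family_independent:
  assumes "finite I" "indep_family I u"
  shows "fun_space.independent (u ` I)"
proof -
  have inj: "inj_on u I" using indep_family_inj_on assms .
  show ?thesis
  proof (rule fun_space.independent_if_scalars_zero)
    show "finite (u ` I)" using assms by simp
    fix f x assume eq: "(\<Sum>v\<in>u ` I. (\<lambda>a. f v * v a)) = 0" and "x \<in> u ` I"
    then obtain i where i: "i \<in> I" "x = u i" by blast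
    have "(\<Sum>i\<in>I. f (u i) * u i a) = 0" for a
      using fun_cong[OF eq, of a] by (simp add: sum.reindex[OF inj] sum_fun_apply)
    then have "f (u i) = 0"
      using assms(2)[unfolded indep_family_def, THEN spec[of _ "\<lambda>i. f (u i)"]] i(1) by blast
    then show "f x = 0" using i by simp
  qed
qed

lemma indep_family_card_le:
  assumes "finite I" "indep_family I u" "u ` I \<subseteq> fun_space.span S" "finite S"
  shows "card I \<le> card S"
  using fun_space.independent_span_bound[OF assms(4) indep_family_independent[OF assms(1,2)] assms(3)]
    card_image[OF indep_family_inj_on[OF assms(1,2)]] by simp

text \<open>The hypothesis is applied to the support of a supposed relation: at the coordinate
  \<open>x\<close> exactly one of its terms survives.\<close>

lemma indep_family_triangular:
  assumes "finite I"
    and "\<And>I'. I' \<subseteq> I \<Longrightarrow> I' \<noteq> {} \<Longrightarrow> \<exists>i\<in>I'. \<exists>x. u i x \<noteq> 0 \<and> (\<forall>j\<in>I'. j \<noteq> i \<longrightarrow> u j x = 0)"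
  shows "indep_family I u"
  unfolding indep_family_def
proof (intro allI impI, rule ccontr)
  fix c assume zero: "\<forall>x. (\<Sum>i\<in>I. c i * u i x) = 0" and "\<not> (\<forall>i\<in>I. c i = 0)"
  define I' where "I' = {i\<in>I. c i \<noteq> 0}"
  have I': "I' \<subseteq> I" "I' \<noteq> {}" using \<open>\<not> (\<forall>i\<in>I. c i = 0)\<close> by (auto simp: I'_def)
  then obtain i x where i: "i \<in> I'" "u i x \<noteq> 0" "\<forall>j\<in>I'. j \<noteq> i \<longrightarrow> u j x = 0"
    using assms(2) by meson
  have "(\<Sum>j\<in>I. c j * u j x) = (\<Sum>j\<in>{i}. c j * u j x)"
    by (rule sum.mono_neutral_right) (use i I' assms(1) in \<open>auto simp: I'_def\<close>)
  then show False using zero i by (auto simp: I'_def)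
qed

definition unit_fun :: "'a \<Rightarrow> 'a \<Rightarrow> 'k::field" where
  "unit_fun z w = (if w = z then 1 else 0)"

lemma indep_family_unit_fun: "finite I \<Longrightarrow> indep_family I unit_fun"
  by (rule indep_family_triangular) (auto simp: unit_fun_def)

lemma unit_fun_expansion:
  assumes "finite V" "\<And>a. a \<notin> V \<Longrightarrow> v a = 0"
  shows "v = (\<lambda>x. \<Sum>a\<in>V. v a * unit_fun a x)"
proof
  fix x
  have "(\<Sum>a\<in>V. v a * unit_fun a x) = (\<Sum>a\<in>V. if x = a then v a else 0)"
    by (intro sum.cong) (auto simp: unit_fun_def)
  then show "v x = (\<Sum>a\<in>V. v a * unit_fun a x)" using assms by simp
qed

lemma finite_support_span_unit_fun:
  assumes "finite V" "\<And>a. a \<notin> V \<Longrightarrow> v a = 0"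
  shows "v \<in> fun_space.span (unit_fun ` V)"
proof -
  have "(\<lambda>x. \<Sum>a\<in>V. v a * unit_fun a x) \<in> fun_space.span (unit_fun ` V)"
    by (intro fun_space_span_sum fun_space.span_base) auto
  moreover have "(\<lambda>x. \<Sum>a\<in>V. v a * unit_fun a x) = v"
    using unit_fun_expansion[OF assms] by (rule sym)
  ultimately show ?thesis by argo
qed

text \<open>\<open>fun_space.dim\<close> is \<open>0\<close> on spaces of infinite dimension; the
  finite common support \<open>V\<close> excludes this case.\<close>

lemma fun_space_dim_ge:
  assumes "finite V" "\<And>v a. v \<in> T \<Longrightarrow> a \<notin> V \<Longrightarrow> v a = 0"
    and "finite I" "indep_family I u" "u ` I \<subseteq> T"
  shows "card I \<le> fun_space.dim T"
proof -
  obtain B where B: "B \<subseteq> T" "fun_space.independent B" "T \<subseteq> fun_space.span B" "card B = fun_space.dim T"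
    using fun_space.basis_exists by blast
  have "B \<subseteq> fun_space.span (unit_fun ` V)"
    using B(1) assms(1,2) by (auto intro!: finite_support_span_unit_fun)
  then have "finite B" using fun_space.independent_span_bound[of "unit_fun ` V" B] B(2) assms(1) by simp
  then show ?thesis using indep_family_card_le[OF assms(3,4), of B] assms(5) B by auto
qed

text \<open>Restriction to \<open>A\<close> is injective on \<open>T\<close>, so it carries a basis
  of \<open>T\<close> to an independent family supported on \<open>A\<close>.\<close>

lemma fun_space_dim_le:
  fixes T :: "('a \<Rightarrow> 'k::field) set"
  assumes "fun_space.subspace T" "finite A"
    and "\<And>v. v \<in> T \<Longrightarrow> (\<And>a. a \<in> A \<Longrightarrow> v a = 0) \<Longrightarrow> v = 0"
  shows "fun_space.dim T \<le> card A"
proof -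
  obtain B where B: "B \<subseteq> T" "fun_space.independent B" "T \<subseteq> fun_space.span B" "card B = fun_space.dim T"
    using fun_space.basis_exists by blast
  define \<rho> where "\<rho> v a = (if a \<in> A then v a else 0)" for v :: "'a \<Rightarrow> 'k" and a
  show ?thesis
  proof (cases "finite B")
    case True
    have "indep_family B \<rho>"
      unfolding indep_family_def
    proof (intro allI impI ballI)
      fix c v assume zero: "\<forall>x. (\<Sum>v\<in>B. c v * \<rho> v x) = 0" and v: "v \<in> B"
      let ?s = "\<Sum>v\<in>B. (\<lambda>a. c v * v a)"
      have "?s \<in> T"
        by (intro fun_space.subspace_sum fun_space.subspace_scale assms(1)) (use B in auto)
      moreover have "?s a = 0" if "a \<in> A" for a
        using spec[OF zero, of a] that by (simp add: \<rho>_def sum_fun_apply)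
      ultimately have "?s = 0" using assms(3) by blast
      then show "c v = 0" using fun_space.independentD[OF B(2) True subset_refl _ v] by blast
    qed
    moreover have "\<rho> ` B \<subseteq> fun_space.span (unit_fun ` A)"
      using assms(2) by (auto simp: \<rho>_def intro!: finite_support_span_unit_fun)
    ultimately have "card B \<le> card (unit_fun ` A :: ('a \<Rightarrow> 'k) set)"
      using indep_family_card_le[OF True] assms(2) by blast
    then show ?thesis using B(4) card_image_le[OF assms(2)] by (metis order_trans)
  qed (use B in auto)
qed

section \<open>Finite sublattices of a distributive lattice\<close>

locale finite_sublattice =
  fixes L :: "'a::distrib_lattice set"
  assumes fin: "finite L"
    and supL: "\<And>a b. a \<in> L \<Longrightarrow> b \<in> L \<Longrightarrow> sup a b \<in> L"
    and infL: "\<And>a b. a \<in> L \<Longrightarrow> b \<in> L \<Longrightarrow> inf a b \<in> L"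
begin

abbreviation J where "J \<equiv> join_irreducibles L"

definition below :: "'a \<Rightarrow> 'a set" where
  "below \<alpha> = {z\<in>J. z \<le> \<alpha>}"

lemma J_subset: "J \<subseteq> L"
  by (auto simp: join_irreducibles_def)

lemma J_in_L: "z \<in> J \<Longrightarrow> z \<in> L"
  using J_subset by blast

lemma finite_J [simp]: "finite J"
  using J_subset fin finite_subset by blast

lemma finite_below [simp]: "finite (below \<alpha>)"
  by (simp add: below_def)

text \<open>Distributivity makes join irreducible elements join prime. The behaviour of
  \<open>below\<close>, of characters and of cuts under joins rests on this.\<close>

lemma J_prime:
  assumes "z \<in> J" "x \<in> L" "y \<in> L"
  shows "z \<le> sup x y \<longleftrightarrow> z \<le> x \<or> z \<le> y"
proof
  assume "z \<le> sup x y"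
  then have "z = sup (inf z x) (inf z y)" by (metis inf.orderE inf_sup_distrib1)
  moreover have "inf z x \<in> L" "inf z y \<in> L" using assms infL J_in_L by auto
  ultimately have "z = inf z x \<or> z = inf z y"
    using assms(1) unfolding join_irreducibles_def by blast
  then show "z \<le> x \<or> z \<le> y" by (metis inf.cobounded2)
next
  assume "z \<le> x \<or> z \<le> y" then show "z \<le> sup x y" using le_supI1 le_supI2 by blast
qed

lemma below_sup: "a \<in> L \<Longrightarrow> b \<in> L \<Longrightarrow> below (sup a b) = below a \<union> below b"
  using J_prime by (auto simp: below_def)

lemma below_inf: "below (inf a b) = below a \<inter> below b"
  by (auto simp: below_def)

text \<open>The induction hypothesis covers everything below \<open>sup a b\<close>, in particular
  \<open>inf a b\<close>, which appears beside \<open>a\<close> and \<open>b\<close> in the modular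
  relations.\<close>

lemma join_induct [consumes 1, case_names irreducible join]:
  assumes "x \<in> L"
    and "\<And>z. z \<in> J \<Longrightarrow> P z"
    and "\<And>a b. a \<in> L \<Longrightarrow> b \<in> L \<Longrightarrow> a \<noteq> sup a b \<Longrightarrow> b \<noteq> sup a b \<Longrightarrow>
      (\<And>w. w \<in> L \<Longrightarrow> w < sup a b \<Longrightarrow> P w) \<Longrightarrow> P (sup a b)"
  shows "P x"
  using assms(1)
proof (induction x rule: measure_induct_rule[of "\<lambda>x. card {w\<in>L. w < x}"])
  case (less x)
  have IH: "P w" if "w \<in> L" "w < x" for w
  proof (rule less.IH)
    show "card {v\<in>L. v < w} < card {w\<in>L. w < x}"
      by (rule psubset_card_mono) (use that fin in auto)
  qed (use that in auto)
  show ?case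
  proof (cases "x \<in> J")
    case False
    then obtain a b where "a \<in> L" "b \<in> L" "x = sup a b" "x \<noteq> a" "x \<noteq> b"
      using less.prems by (auto simp: join_irreducibles_def)
    then show ?thesis using assms(3)[of a b] IH by auto
  qed (use assms(2) in auto)
qed

lemma le_iff_below:
  assumes "x \<in> L" "y \<in> L"
  shows "x \<le> y \<longleftrightarrow> below x \<subseteq> below y"
proof
  assume "below x \<subseteq> below y"
  with assms(1) show "x \<le> y"
  proof (induction x rule: join_induct)
    case (irreducible z)
    then show ?case by (auto simp: below_def)
  next
    case (join a b)
    have "a < sup a b" "b < sup a b" using join(3,4) by (simp_all add: less_le)
    then have "a \<le> y" "b \<le> y" using join by (auto simp: below_sup)
    then show ?case by simp
  qed
qed (auto simp: below_def)

lemma eq_iff_below: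
  assumes "x \<in> L" "y \<in> L"
  shows "x = y \<longleftrightarrow> below x = below y"
  using le_iff_below assms by (auto intro: antisym)

lemma principal_ideal_union:
  assumes "finite S" "S \<noteq> {}" "S \<subseteq> J"
  shows "\<exists>\<alpha>\<in>L. below \<alpha> = (\<Union>s\<in>S. below s)"
  using assms
proof (induction S rule: finite_ne_induct)
  case (insert s S)
  then obtain \<alpha> where "\<alpha> \<in> L" "below \<alpha> = (\<Union>s\<in>S. below s)" by auto
  then show ?case using insert supL[of s \<alpha>] J_in_L[of s]
    by (auto simp: below_sup intro!: bexI[of _ "sup s \<alpha>"])
qed (use J_in_L in auto)

text \<open>Birkhoff's correspondence. The empty ideal has to be excluded because the least element
  counts as join irreducible.\<close>

lemma ideal_realized:
  assumes "S \<subseteq> J" "S \<noteq> {}" "\<And>y z. z \<in> S \<Longrightarrow> y \<in> J \<Longrightarrow> y \<le> z \<Longrightarrow> y \<in> S"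
  shows "\<exists>\<alpha>\<in>L. below \<alpha> = S"
proof -
  have "finite S" using assms(1) finite_J finite_subset by blast
  then obtain \<alpha> where "\<alpha> \<in> L" "below \<alpha> = (\<Union>s\<in>S. below s)"
    using principal_ideal_union[of S] assms by blast
  moreover have "(\<Union>s\<in>S. below s) = S" using assms by (auto simp: below_def)
  ultimately show ?thesis by auto
qed

end

section \<open>Straightening of monomials to chains\<close>

fun ins_sorted :: "'a::lattice \<Rightarrow> 'a list \<Rightarrow> 'a list" where
  "ins_sorted a [] = [a]"
| "ins_sorted a (b # bs) = sup a b # ins_sorted (inf a b) bs"

lemma ins_sorted_bounded:
  "\<forall>b\<in>set bs. b \<le> c \<Longrightarrow> a \<le> c \<Longrightarrow> \<forall>b\<in>set (ins_sorted a bs). b \<le> c"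
  by (induction bs arbitrary: a) (auto intro: le_infI1)

lemma sorted_ins_sorted:
  "sorted_wrt (\<lambda>x y. y \<le> x) bs \<Longrightarrow> sorted_wrt (\<lambda>x y. y \<le> x) (ins_sorted a bs)"
proof (induction bs arbitrary: a)
  case (Cons b bs)
  have "\<forall>x\<in>set (ins_sorted (inf a b) bs). x \<le> sup a b"
    by (rule ins_sorted_bounded) (use Cons in \<open>auto intro: le_supI2 le_infI1 le_supI1\<close>)
  then show ?case using Cons by auto
qed auto

text \<open>Each step of \<open>ins_sorted\<close> replaces a pair by its join and its meet, which
  is one application of a Hibi relation; the result is a decreasing chain.\<close>

definition straighten :: "'a::lattice list \<Rightarrow> 'a list" where
  "straighten xs = foldr ins_sorted xs []"

lemma sorted_straighten: "sorted_wrt (\<lambda>x y. y \<le> x) (straighten xs)"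
  unfolding straighten_def by (induction xs) (auto intro: sorted_ins_sorted)

lemma (in finite_sublattice) ins_sorted_closed:
  "a \<in> L \<Longrightarrow> set bs \<subseteq> L \<Longrightarrow> set (ins_sorted a bs) \<subseteq> L"
  by (induction bs arbitrary: a) (auto simp: supL infL)

lemma (in finite_sublattice) straighten_closed: "set xs \<subseteq> L \<Longrightarrow> set (straighten xs) \<subseteq> L"
  unfolding straighten_def by (induction xs) (use ins_sorted_closed in auto)

text \<open>The binomial equations in a form that makes sense in a monoid, hence also for points
  over the dual numbers.\<close>

definition modular_mult :: "'a::lattice set \<Rightarrow> ('a \<Rightarrow> 'm::comm_monoid_mult) \<Rightarrow> bool" where
  "modular_mult L g \<longleftrightarrow> (\<forall>a\<in>L. \<forall>b\<in>L. g a * g b = g (sup a b) * g (inf a b))"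

lemma (in finite_sublattice) prod_ins_sorted:
  assumes "modular_mult L g"
  shows "a \<in> L \<Longrightarrow> set bs \<subseteq> L \<Longrightarrow> prod_list (map g (ins_sorted a bs)) = g a * prod_list (map g bs)"
proof (induction bs arbitrary: a)
  case (Cons b bs)
  then have "prod_list (map g (ins_sorted a (b # bs))) = (g (sup a b) * g (inf a b)) * prod_list (map g bs)"
    by (simp add: infL mult_ac)
  also have "g (sup a b) * g (inf a b) = g a * g b"
    using assms Cons by (simp add: modular_mult_def)
  finally show ?case by (simp add: mult_ac)
qed simp

lemma (in finite_sublattice) prod_straighten:
  assumes "modular_mult L g" "set xs \<subseteq> L"
  shows "prod_list (map g (straighten xs)) = prod_list (map g xs)"
  using assms(2) unfolding straighten_def
proof (induction xs)
  case (Cons x xs)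
  then show ?case
    using prod_ins_sorted[OF assms(1), of x] straighten_closed[of xs] by (simp add: straighten_def)
qed simp

text \<open>A list stands for a monomial; this is the coefficient at \<open>f_z\<close> of its
  character, the sum of the \<open>f\<close> of the ideals of its entries.\<close>

definition list_char :: "'a::order list \<Rightarrow> 'a \<Rightarrow> nat" where
  "list_char xs z = length (filter (\<lambda>a. z \<le> a) xs)"

lemma list_char_simps [simp]:
  "list_char [] z = 0"
  "list_char (x # xs) z = (if z \<le> x then 1 else 0) + list_char xs z"
  "list_char (xs @ ys) z = list_char xs z + list_char ys z"
  by (auto simp: list_char_def)

lemma (in finite_sublattice) list_char_ins_sorted:
  "z \<in> J \<Longrightarrow> a \<in> L \<Longrightarrow> set bs \<subseteq> L \<Longrightarrow> list_char (ins_sorted a bs) z = list_char (a # bs) z"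
  by (induction bs arbitrary: a) (auto simp: infL J_prime)

lemma (in finite_sublattice) list_char_straighten:
  "z \<in> J \<Longrightarrow> set xs \<subseteq> L \<Longrightarrow> list_char (straighten xs) z = list_char xs z"
  unfolding straighten_def
proof (induction xs)
  case (Cons x xs)
  then show ?case
    using list_char_ins_sorted[of z x] straighten_closed[of xs] by (simp add: straighten_def)
qed simp

locale hibi = finite_sublattice +
  assumes nonempty: "L \<noteq> {}"
begin

lemma ex_least: "\<exists>b\<in>L. \<forall>x\<in>L. b \<le> x"
proof -
  obtain m where m: "m \<in> L" "\<And>b. b \<in> L \<Longrightarrow> b \<le> m \<Longrightarrow> m = b"
    using finite_has_minimal[OF fin nonempty] by blast
  have "m \<le> x" if "x \<in> L" for x
    using m(2)[of "inf m x"] infL[OF m(1) that] by (metis inf.cobounded1 inf.cobounded2)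
  then show ?thesis using m(1) by blast
qed

definition bt :: 'a where "bt = (SOME b. b \<in> L \<and> (\<forall>x\<in>L. b \<le> x))"

lemma bt: "bt \<in> L" "x \<in> L \<Longrightarrow> bt \<le> x"
proof -
  have "bt \<in> L \<and> (\<forall>x\<in>L. bt \<le> x)" unfolding bt_def by (rule someI_ex) (use ex_least in blast)
  then show "bt \<in> L" "x \<in> L \<Longrightarrow> bt \<le> x" by auto
qed

lemma bt_J [simp]: "bt \<in> J"
proof -
  have "bt = x" if "x \<in> L" "bt = sup x y" for x y
    using that bt(2)[of x] by (metis order_antisym sup.cobounded1)
  then show ?thesis using bt(1) unfolding join_irreducibles_def by blast
qed

lemma bt_below: "x \<in> L \<Longrightarrow> bt \<in> below x"
  using bt bt_J by (simp add: below_def)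

lemma lower_element:
  assumes "z \<in> J" "z \<noteq> bt"
  shows "\<exists>\<alpha>\<in>L. below \<alpha> = {y\<in>J. y < z}"
proof (rule ideal_realized)
  show "{y\<in>J. y < z} \<noteq> {}" using assms bt(2)[of z] J_in_L bt_J by (force simp: less_le)
qed auto

text \<open>The character of a decreasing list is positive exactly on the ideal of its head, and at
  \<open>bt\<close> it is the length. The list is therefore recovered entry by entry.\<close>

lemma sorted_char_unique:
  assumes "sorted_wrt (\<lambda>x y. y \<le> x) xs" "sorted_wrt (\<lambda>x y. y \<le> x) ys"
    and "set xs \<subseteq> L" "set ys \<subseteq> L" "\<And>z. z \<in> J \<Longrightarrow> list_char xs z = list_char ys z"
  shows "xs = ys"
  using assms
proof (induction xs arbitrary: ys)
  case Nil
  show ?case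
  proof (cases ys)
    case (Cons y ys')
    then show ?thesis using Nil(4) Nil(5)[of bt] bt(2)[of y] by simp
  qed simp
next
  case (Cons x xs)
  show ?case
  proof (cases ys)
    case Nil
    then show ?thesis using Cons.prems(3) Cons.prems(5)[of bt] bt by auto
  next
    case (Cons y ys')
    have pos: "list_char (w # ws) z > 0 \<longleftrightarrow> z \<le> w"
      if "sorted_wrt (\<lambda>x y. y \<le> x) (w # ws)" for w ws and z :: 'a
      using that by (auto simp: list_char_def filter_empty_conv)
    have "z \<le> x \<longleftrightarrow> z \<le> y" if "z \<in> J" for z
      using pos[OF Cons.prems(1), of z] pos[of y ys' z] Cons.prems(2) Cons.prems(5)[OF that]
      unfolding Cons by metis
    then have "below x = below y" by (auto simp: below_def)
    then have "x = y" using eq_iff_below Cons.prems Cons by auto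
    then show ?thesis using Cons.IH[of ys'] Cons.prems Cons by auto
  qed
qed

text \<open>Monomials with the same character straighten to the same chain, so they agree at every
  solution of the binomial equations.\<close>

lemma straightening:
  assumes "modular_mult L g" "set xs \<subseteq> L" "set ys \<subseteq> L"
    and "\<And>z. z \<in> J \<Longrightarrow> list_char xs z = list_char ys z"
  shows "prod_list (map g xs) = prod_list (map g ys)"
proof -
  have "straighten xs = straighten ys"
    by (rule sorted_char_unique)
       (use assms straighten_closed sorted_straighten list_char_straighten in auto)
  then show ?thesis using prod_straighten[OF assms(1)] assms(2,3) by metis
qed

end

lemma prod_list_count_list:
  assumes "finite A" "set xs \<subseteq> A"
  shows "prod_list (map g xs) = (\<Prod>a\<in>A. g a ^ count_list xs a)"
  using assms(2)
proof (induction xs)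
  case (Cons x xs)
  have "(\<Prod>a\<in>A. g a ^ count_list (x # xs) a)
      = (\<Prod>a\<in>A. (if a = x then g a else 1) * g a ^ count_list xs a)"
    by (intro prod.cong) auto
  also have "\<dots> = g x * (\<Prod>a\<in>A. g a ^ count_list xs a)"
    using assms(1) Cons.prems by (simp add: prod.distrib prod.delta)
  finally show ?case using Cons by simp
qed simp

lemma list_char_count_list:
  assumes "finite A" "set xs \<subseteq> A"
  shows "list_char xs z = (\<Sum>a | a \<in> A \<and> z \<le> a. count_list xs a)"
  using assms(2)
proof (induction xs)
  case (Cons x xs)
  have "(\<Sum>a | a \<in> A \<and> z \<le> a. count_list (x # xs) a)
      = (\<Sum>a | a \<in> A \<and> z \<le> a. (if a = x then 1 else 0) + count_list xs a)"
    by (intro sum.cong) auto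
  then show ?case using Cons assms(1) by (simp add: sum.distrib)
qed simp

lemma count_list_replicate_if: "count_list (replicate n x) a = (if a = x then n else 0)"
  by (induction n) auto

lemma ex_list_of_exponents: "\<exists>xs. \<forall>a. count_list xs a = lookup m a"
proof -
  have "\<exists>xs. \<forall>a. count_list xs a = (if a \<in> A then f a else 0)" if "finite A" for A :: "'a set" and f
    using that
  proof (induction A)
    case (insert x A)
    then obtain xs where "\<forall>a. count_list xs a = (if a \<in> A then f a else 0)" by blast
    then show ?case
      using insert by (intro exI[of _ "replicate (f x) x @ xs"]) (auto simp: count_list_replicate_if)
  qed (auto intro: exI[of _ "[]"])
  from this[of "keys m" "lookup m"] show ?thesis by (simp add: in_keys_iff) (metis neq0_conv)
qed

definition mchar :: "'a::order set \<Rightarrow> ('a \<Rightarrow>\<^sub>0 nat) \<Rightarrow> 'a \<Rightarrow> nat" where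
  "mchar L m z = (\<Sum>a | a \<in> L \<and> z \<le> a. lookup m a)"

lemma (in hibi) monom_eval_char:
  assumes "modular_mult L g" "keys m \<subseteq> L" "keys m' \<subseteq> L"
    and "\<And>z. z \<in> J \<Longrightarrow> mchar L m z = mchar L m' z"
  shows "monom_eval m g = monom_eval m' g"
proof -
  obtain xs ys where xs: "\<And>a. count_list xs a = lookup m a" and ys: "\<And>a. count_list ys a = lookup m' a"
    using ex_list_of_exponents[of m] ex_list_of_exponents[of m'] by auto
  have set: "set xs = keys m" "set ys = keys m'"
    using xs ys count_list_0_iff[of xs] count_list_0_iff[of ys] by (auto simp: in_keys_iff)
  have "prod_list (map g xs) = prod_list (map g ys)"
    by (rule straightening[OF assms(1)])
       (use set assms xs ys fin in \<open>auto simp: list_char_count_list[of L] mchar_def\<close>)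
  then show ?thesis
    using set assms(2,3) fin by (simp add: prod_list_count_list[of L] monom_eval_superset[of L] xs ys)
qed

section \<open>Tangent spaces of Hibi varieties\<close>

text \<open>Only products are formed in the dual numbers; linear combinations are taken in the field
  after passing to \<open>ep\<close>.\<close>

datatype 'k dual = Dual (re: 'k) (ep: 'k)

instantiation dual :: (comm_ring_1) comm_monoid_mult
begin

definition "1 = Dual 1 0"
definition "x * y = Dual (re x * re y) (re x * ep y + ep x * re y)"

instance
  by standard (auto simp: one_dual_def times_dual_def algebra_simps)

end

lemma Dual_mult [simp]: "Dual a b * Dual c d = Dual (a * c) (a * d + b * c)"
  by (simp add: times_dual_def)

lemma Dual_power: "Dual a b ^ n = Dual (a ^ n) (of_nat n * a ^ (n - 1) * b)"
proof (induction n)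
  case (Suc n)
  then show ?case by (cases n) (auto simp: algebra_simps)
qed (simp add: one_dual_def)

lemma prod_Dual:
  assumes "finite A"
  shows "(\<Prod>a\<in>A. Dual (f a) (h a)) = Dual (\<Prod>a\<in>A. f a) (\<Sum>a\<in>A. (\<Prod>b\<in>A - {a}. f b) * h a)"
  using assms
proof (induction A)
  case (insert x A)
  have "(\<Prod>b\<in>insert x A - {a}. f b) = f x * (\<Prod>b\<in>A - {a}. f b)" if "a \<in> A" for a
  proof -
    have "insert x A - {a} = insert x (A - {a})" using that insert by auto
    then show ?thesis using insert by simp
  qed
  then have "(\<Sum>a\<in>A. (\<Prod>b\<in>insert x A - {a}. f b) * h a) = f x * (\<Sum>a\<in>A. (\<Prod>b\<in>A - {a}. f b) * h a)"
    by (simp add: sum_distrib_left mult_ac)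
  then show ?case using insert by (simp add: mult_ac add_ac)
qed (simp add: one_dual_def)

definition dual_pt :: "('a \<Rightarrow> 'k::field) \<Rightarrow> ('a \<Rightarrow> 'k) \<Rightarrow> 'a \<Rightarrow> 'k dual" where
  "dual_pt P v a = Dual (P a) (v a)"

text \<open>The derivative of \<open>p\<close> at \<open>P\<close> in the direction
  \<open>v\<close>, read off as the epsilon part of the value at \<open>dual_pt P v\<close>.\<close>

definition dual_deriv :: "('a, 'k::field) mpoly \<Rightarrow> ('a \<Rightarrow> 'k) \<Rightarrow> ('a \<Rightarrow> 'k) \<Rightarrow> 'k" where
  "dual_deriv p P v = (\<Sum>m\<in>keys p. lookup p m * ep (monom_eval m (dual_pt P v)))"

lemma ep_monom_eval:
  "ep (monom_eval m (dual_pt P v)) =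
    (\<Sum>a\<in>keys m. of_nat (lookup m a) * monom_eval (m - Poly_Mapping.single a 1) P * v a)"
proof -
  have *: "monom_eval (m - Poly_Mapping.single a 1) P =
      (\<Prod>b\<in>keys m - {a}. P b ^ lookup m b) * P a ^ (lookup m a - 1)" if "a \<in> keys m" for a
  proof -
    have "keys (m - Poly_Mapping.single a 1) \<subseteq> keys m"
      by (auto simp: in_keys_iff lookup_minus)
    then have "monom_eval (m - Poly_Mapping.single a 1) P
        = (\<Prod>b\<in>keys m. P b ^ lookup (m - Poly_Mapping.single a 1) b)"
      by (simp add: monom_eval_superset)
    also have "\<dots> = P a ^ (lookup m a - 1) * (\<Prod>b\<in>keys m - {a}. P b ^ lookup (m - Poly_Mapping.single a 1) b)"
      using that by (simp add: prod.remove[of _ a] lookup_minus)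
    also have "(\<Prod>b\<in>keys m - {a}. P b ^ lookup (m - Poly_Mapping.single a 1) b)
        = (\<Prod>b\<in>keys m - {a}. P b ^ lookup m b)"
      by (intro prod.cong) (auto simp: lookup_minus lookup_single when_def)
    finally show ?thesis by (simp add: mult_ac)
  qed
  have "monom_eval m (dual_pt P v) = (\<Prod>a\<in>keys m. Dual (P a ^ lookup m a)
      (of_nat (lookup m a) * P a ^ (lookup m a - 1) * v a))"
    by (simp add: monom_eval_def dual_pt_def Dual_power)
  also have "\<dots> = Dual (\<Prod>a\<in>keys m. P a ^ lookup m a)
      (\<Sum>a\<in>keys m. (\<Prod>b\<in>keys m - {a}. P b ^ lookup m b) * (of_nat (lookup m a) * P a ^ (lookup m a - 1) * v a))"
    by (rule prod_Dual) simp
  finally have "ep (monom_eval m (dual_pt P v)) = (\<Sum>a\<in>keys m.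
      (\<Prod>b\<in>keys m - {a}. P b ^ lookup m b) * (of_nat (lookup m a) * P a ^ (lookup m a - 1) * v a))"
    by simp
  also have "\<dots> = (\<Sum>a\<in>keys m. of_nat (lookup m a) * monom_eval (m - Poly_Mapping.single a 1) P * v a)"
    by (intro sum.cong refl) (simp only: * mult_ac)
  finally show ?thesis .
qed

lemma meval_mpderiv:
  "meval (mpderiv a p) P =
    (\<Sum>m\<in>keys p. of_nat (lookup m a) * lookup p m * monom_eval (m - Poly_Mapping.single a 1) P)"
  by (simp add: mpderiv_def meval_sum meval_single)

lemma tangent_functional:
  assumes "finite V" "p \<in> mpolys V"
  shows "(\<Sum>a\<in>V. meval (mpderiv a p) P * v a) = dual_deriv p P v"
proof -
  have "(\<Sum>a\<in>V. meval (mpderiv a p) P * v a) = (\<Sum>m\<in>keys p. \<Sum>a\<in>V.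
      of_nat (lookup m a) * lookup p m * monom_eval (m - Poly_Mapping.single a 1) P * v a)"
    by (simp add: meval_mpderiv sum_distrib_right) (rule sum.swap)
  also have "\<dots> = dual_deriv p P v"
    unfolding dual_deriv_def
  proof (rule sum.cong)
    fix m assume "m \<in> keys p"
    then have sub: "keys m \<subseteq> V" using assms(2) by (auto simp: mpolys_def)
    have "(\<Sum>a\<in>V. of_nat (lookup m a) * lookup p m * monom_eval (m - Poly_Mapping.single a 1) P * v a)
      = (\<Sum>a\<in>keys m. of_nat (lookup m a) * lookup p m * monom_eval (m - Poly_Mapping.single a 1) P * v a)"
      by (rule sum.mono_neutral_right) (use sub assms in \<open>auto simp: in_keys_iff\<close>)
    then show "(\<Sum>a\<in>V. of_nat (lookup m a) * lookup p m * monom_eval (m - Poly_Mapping.single a 1) P * v a)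
      = lookup p m * ep (monom_eval m (dual_pt P v))"
      by (simp add: ep_monom_eval sum_distrib_left mult_ac)
  qed simp
  finally show ?thesis .
qed

lemma dual_deriv_superset:
  assumes "finite A" "keys p \<subseteq> A"
  shows "dual_deriv p P v = (\<Sum>m\<in>A. lookup p m * ep (monom_eval m (dual_pt P v)))"
  unfolding dual_deriv_def
  by (rule sum.mono_neutral_left) (use assms in \<open>auto simp: in_keys_iff\<close>)

lemma dual_deriv_diff: "dual_deriv (p - q) P v = dual_deriv p P v - dual_deriv q P v"
proof -
  have "keys (p - q) \<subseteq> keys p \<union> keys q" by (rule keys_diff)
  then show ?thesis
    by (subst (1 2 3) dual_deriv_superset[of "keys p \<union> keys q"])
       (auto simp: lookup_minus algebra_simps sum_subtractf)
qed

lemma dual_deriv_mvar_mult: "dual_deriv (mvar a * mvar b) P v = P a * v b + v a * P b"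
  by (simp add: mvar_def mult_single dual_deriv_def monom_eval_add dual_pt_def)

text \<open>Reduces finitely many vectors of exponents to single exponents without collisions, so
  that one curve can tell all characters of a polynomial apart.\<close>

lemma separating_weight:
  assumes "finite J"
  shows "\<exists>k :: 'a \<Rightarrow> nat. \<forall>f g. (\<forall>z\<in>J. f z \<le> N \<and> g z \<le> N) \<longrightarrow>
    (\<Sum>z\<in>J. k z * f z) = (\<Sum>z\<in>J. k z * g z) \<longrightarrow> (\<forall>z\<in>J. f z = g z)"
  using assms
proof (induction J)
  case (insert x J)
  then obtain k where k: "\<And>f g. (\<forall>z\<in>J. f z \<le> N \<and> g z \<le> N) \<Longrightarrow>
    (\<Sum>z\<in>J. k z * f z) = (\<Sum>z\<in>J. k z * g z) \<Longrightarrow> (\<forall>z\<in>J. f z = g z)" by blast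
  \<comment> \<open>\<open>W\<close> exceeds every weighted sum over \<open>J\<close> of values
    bounded by \<open>N\<close>, so the value at \<open>x\<close> becomes the leading digit in base
    \<open>W\<close>.\<close>
  define W where "W = Suc (\<Sum>z\<in>J. k z * N)"
  define k' where "k' = k(x := W)"
  have sum: "(\<Sum>z\<in>insert x J. k' z * f z) = W * f x + (\<Sum>z\<in>J. k z * f z)" for f
    using insert by (auto simp: k'_def intro!: sum.cong)
  have bound: "(\<Sum>z\<in>J. k z * f z) < W" if "\<forall>z\<in>J. f z \<le> N" for f
    unfolding W_def less_Suc_eq_le using that by (intro sum_mono) auto
  have "\<forall>z\<in>insert x J. f z = g z"
    if fg: "\<forall>z\<in>insert x J. f z \<le> N \<and> g z \<le> N"
      and eq: "(\<Sum>z\<in>insert x J. k' z * f z) = (\<Sum>z\<in>insert x J. k' z * g z)" for f g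
  proof -
    have lt: "(\<Sum>z\<in>J. k z * f z) < W" "(\<Sum>z\<in>J. k z * g z) < W" using fg bound by auto
    have eq': "W * f x + (\<Sum>z\<in>J. k z * f z) = W * g x + (\<Sum>z\<in>J. k z * g z)"
      using eq sum by simp
    have "f x = (W * f x + (\<Sum>z\<in>J. k z * f z)) div W" using lt by simp
    also have "\<dots> = g x" using lt by (simp add: eq')
    finally have "f x = g x" .
    moreover have "(\<Sum>z\<in>J. k z * f z) = (\<Sum>z\<in>J. k z * g z)" using eq' \<open>f x = g x\<close> by simp
    then have "\<forall>z\<in>J. f z = g z" using k[of f g] fg by blast
    ultimately show ?thesis by blast
  qed
  then show ?case by blast
qed auto

section \<open>The tangent space from the linearised binomials\<close>

context hibi
begin

lemma hibi_variety_iff: "x \<in> hibi_variety L \<longleftrightarrow> x \<in> affine_space L \<and> modular_mult L x"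
proof -
  have "(\<forall>p\<in>hibi_binomials L. meval p x = 0) \<longleftrightarrow> modular_mult L x"
    unfolding hibi_binomials_def modular_mult_def
    by (auto simp: meval_diff meval_mult) (metis (no_types, lifting) eq_iff_diff_eq_0 meval_diff meval_mult meval_mvar)
  then show ?thesis by (simp add: hibi_variety_def zero_locus_def)
qed

lemma modular_mult_prod_below: "modular_mult L (\<lambda>\<alpha>. \<Prod>z\<in>below \<alpha>. u z)"
  unfolding modular_mult_def
  by (auto simp: below_sup below_inf prod.union_inter)

lemma modular_mult_mult:
  "modular_mult L g \<Longrightarrow> modular_mult L h \<Longrightarrow> modular_mult L (\<lambda>\<alpha>. g \<alpha> * h \<alpha>)"
  unfolding modular_mult_def by (auto simp: mult_ac) (metis mult.assoc)

lemma modular_mult_cong: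
  assumes "\<And>a. a \<in> L \<Longrightarrow> f a = g a"
  shows "modular_mult L f \<longleftrightarrow> modular_mult L g"
  unfolding modular_mult_def using assms by (intro ball_cong) (simp_all add: supL infL)

lemma modular_mult_dual_pt:
  assumes "modular_mult L P"
    and "\<And>a b. a \<in> L \<Longrightarrow> b \<in> L \<Longrightarrow>
      P a * v b + v a * P b = P (sup a b) * v (inf a b) + v (sup a b) * P (inf a b)"
  shows "modular_mult L (dual_pt P v)"
  unfolding modular_mult_def
proof (intro ballI)
  fix a b assume ab: "a \<in> L" "b \<in> L"
  have "P a * P b = P (sup a b) * P (inf a b)"
    using assms(1) ab unfolding modular_mult_def by blast
  then show "dual_pt P v a * dual_pt P v b = dual_pt P v (sup a b) * dual_pt P v (inf a b)"
    using assms(2)[OF ab] by (simp add: dual_pt_def)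
qed

lemma hibi_binomials_mpolys: "hibi_binomials L \<subseteq> mpolys L"
  unfolding hibi_binomials_def
  by (auto simp: supL infL intro!: mpolys_diff mpolys_mult)

lemma sum_below_mchar:
  "keys m \<subseteq> L \<Longrightarrow> (\<Sum>a\<in>L. (\<Sum>z\<in>below a. k z) * lookup m a) = (\<Sum>z\<in>J. k z * mchar L m z)"
proof -
  have "(\<Sum>a\<in>L. (\<Sum>z\<in>below a. k z) * lookup m a) = (\<Sum>a\<in>L. \<Sum>z\<in>J. if z \<le> a then k z * lookup m a else 0)"
    by (auto simp: below_def sum_distrib_right sum.inter_filter intro!: sum.cong)
  also have "\<dots> = (\<Sum>z\<in>J. \<Sum>a\<in>L. if z \<le> a then k z * lookup m a else 0)" by (rule sum.swap)
  also have "\<dots> = (\<Sum>z\<in>J. k z * mchar L m z)"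
    using fin by (auto simp: mchar_def sum_distrib_left sum.inter_filter intro!: sum.cong)
  finally show ?thesis .
qed

lemma tangent_space_hibi_variety:
  fixes P :: "'a \<Rightarrow> 'k::field"
  assumes inf: "infinite (UNIV :: 'k set)" and P: "P \<in> hibi_variety L"
  shows "tangent_space L (hibi_variety L) P =
    {v \<in> affine_space L. \<forall>a\<in>L. \<forall>b\<in>L. P a * v b + v a * P b
       = P (sup a b) * v (inf a b) + v (sup a b) * P (inf a b)}" (is "_ = ?T")
proof (intro equalityI subsetI)
  fix v assume v: "v \<in> tangent_space L (hibi_variety L) P"
  have "P a * v b + v a * P b = P (sup a b) * v (inf a b) + v (sup a b) * P (inf a b)"
    if "a \<in> L" "b \<in> L" for a b
  proof -
    let ?p = "mvar a * mvar b - mvar (sup a b) * mvar (inf a b) :: ('a, 'k) mpoly"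
    have p: "?p \<in> hibi_binomials L" using that by (auto simp: hibi_binomials_def)
    then have "?p \<in> vanishing_ideal L (hibi_variety L)"
      using hibi_binomials_mpolys by (auto simp: vanishing_ideal_def hibi_variety_def zero_locus_def)
    then have "dual_deriv ?p P v = 0"
      using v tangent_functional[OF fin, of ?p P v] p hibi_binomials_mpolys
      by (auto simp: tangent_space_def)
    then show ?thesis by (simp add: dual_deriv_diff dual_deriv_mvar_mult)
  qed
  then show "v \<in> ?T" using v by (auto simp: tangent_space_def)
next
  fix v assume v: "v \<in> ?T"
  show "v \<in> tangent_space L (hibi_variety L) P"
    unfolding tangent_space_def
  proof (intro CollectI conjI ballI)
    show "v \<in> affine_space L" using v by simp
    fix p :: "('a, 'k) mpoly" assume p: "p \<in> vanishing_ideal L (hibi_variety L)"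
    then have pL: "p \<in> mpolys L" by (simp add: vanishing_ideal_def)
    then have keysL: "keys m \<subseteq> L" if "m \<in> keys p" for m using that by (auto simp: mpolys_def)
    define N where "N = Max ((\<lambda>(m, z). mchar L m z) ` (keys p \<times> J))"
    have N: "mchar L m z \<le> N" if "m \<in> keys p" "z \<in> J" for m z
      unfolding N_def by (rule Max_ge) (use that in auto)
    obtain k where k: "\<And>f g. (\<forall>z\<in>J. f z \<le> N \<and> g z \<le> N) \<Longrightarrow>
        (\<Sum>z\<in>J. k z * f z) = (\<Sum>z\<in>J. k z * g z) \<Longrightarrow> (\<forall>z\<in>J. f z = g z)"
      using separating_weight[OF finite_J, of N] by blast
    define \<kappa> where "\<kappa> m = (\<Sum>z\<in>J. k z * mchar L m z)" for m
    \<comment> \<open>A curve inside the variety on which each monomial \<open>m\<close> of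
      \<open>p\<close> becomes the power \<open>s ^ \<kappa> m\<close>. The coefficients of
      \<open>p\<close> along it are the coefficient sums for the separate characters.\<close>
    define x where "x s = (\<lambda>\<alpha>. if \<alpha> \<in> L then \<Prod>z\<in>below \<alpha>. s ^ k z else 0)" for s :: 'k
    have xX: "x s \<in> hibi_variety L" for s
    proof -
      have "modular_mult L (x s) \<longleftrightarrow> modular_mult L (\<lambda>\<alpha>. \<Prod>z\<in>below \<alpha>. s ^ k z)"
        by (rule modular_mult_cong) (simp add: x_def)
      then show ?thesis
        using modular_mult_prod_below by (simp add: hibi_variety_iff affine_space_def x_def)
    qed
    have xm: "monom_eval m (x s) = s ^ \<kappa> m" if "m \<in> keys p" for m s
    proof -
      have "monom_eval m (x s) = (\<Prod>a\<in>L. s ^ ((\<Sum>z\<in>below a. k z) * lookup m a))"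
        using fin keysL[OF that] by (simp add: monom_eval_superset[of L] x_def power_sum power_mult)
      also have "\<dots> = s ^ \<kappa> m"
        using sum_below_mchar[OF keysL[OF that], of k] by (simp add: \<kappa>_def flip: power_sum)
      finally show ?thesis .
    qed
    define q where "q = (\<Sum>m\<in>keys p. monom (lookup p m) (\<kappa> m))"
    have "q = 0"
    proof (rule poly_eq_0_infinite[OF inf])
      fix s
      have "poly q s = meval p (x s)"
        by (simp add: q_def poly_sum poly_monom meval_monom xm)
      then show "poly q s = 0" using p xX by (auto simp: vanishing_ideal_def)
    qed
    then have coeff0: "(\<Sum>m | m \<in> keys p \<and> \<kappa> m = j. lookup p m) = 0" for j
    proof -
      have "coeff q j = (\<Sum>m\<in>keys p. if \<kappa> m = j then lookup p m else 0)"
        by (simp add: q_def coeff_sum)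
      then show ?thesis using \<open>q = 0\<close> by (simp add: sum.inter_filter)
    qed
    have modular: "modular_mult L (dual_pt P v)"
      by (rule modular_mult_dual_pt) (use P v in \<open>auto simp: hibi_variety_iff\<close>)
    define E where "E m = ep (monom_eval m (dual_pt P v))" for m
    have E: "E m = E m'" if "m \<in> keys p" "m' \<in> keys p" "\<kappa> m = \<kappa> m'" for m m'
    proof -
      have "\<forall>z\<in>J. mchar L m z = mchar L m' z"
        using k[of "mchar L m" "mchar L m'"] that N by (simp add: \<kappa>_def)
      then show ?thesis
        unfolding E_def using monom_eval_char[OF modular keysL keysL] that by metis
    qed
    have "dual_deriv p P v = (\<Sum>j\<in>\<kappa> ` keys p. \<Sum>m | m \<in> keys p \<and> \<kappa> m = j. lookup p m * E m)"
      unfolding dual_deriv_def E_def by (rule sum.image_gen) simp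
    also have "\<dots> = 0"
    proof (rule sum.neutral, rule ballI)
      fix j assume "j \<in> \<kappa> ` keys p"
      then obtain m0 where m0: "m0 \<in> keys p" "\<kappa> m0 = j" by blast
      have "(\<Sum>m | m \<in> keys p \<and> \<kappa> m = j. lookup p m * E m)
          = (\<Sum>m | m \<in> keys p \<and> \<kappa> m = j. lookup p m * E m0)"
        by (intro sum.cong refl arg_cong2[of _ _ _ _ "(*)"] E) (use m0 in auto)
      also have "\<dots> = (\<Sum>m | m \<in> keys p \<and> \<kappa> m = j. lookup p m) * E m0"
        by (rule sum_distrib_right[symmetric])
      also have "\<dots> = 0" by (simp only: coeff0 mult_zero_left)
      finally show "(\<Sum>m | m \<in> keys p \<and> \<kappa> m = j. lookup p m * E m) = 0" .
    qed
    finally show "(\<Sum>a\<in>L. meval (mpderiv a p) P * v a) = 0"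
      using tangent_functional[OF fin pL] by simp
  qed
qed

end

section \<open>The dimension of Hibi varieties\<close>

lemma irreducible_closed_no_zero_divisors:
  assumes "irreducible_closed V Z" "f \<in> mpolys V" "g \<in> mpolys V"
    and "\<And>x. x \<in> Z \<Longrightarrow> meval f x * meval g x = 0"
  shows "(\<forall>x\<in>Z. meval f x = 0) \<or> (\<forall>x\<in>Z. meval g x = 0)"
proof -
  have "Z \<subseteq> affine_space V"
    using assms(1) unfolding irreducible_closed_def zariski_closed_def zero_locus_def by blast
  then have "Z \<subseteq> zero_locus V {f} \<union> zero_locus V {g}"
    using assms(4) by (auto simp: zero_locus_def)
  moreover have "zariski_closed V (zero_locus V {f})" "zariski_closed V (zero_locus V {g})"
    using assms(2,3) unfolding zariski_closed_def by blast+
  ultimately have "Z \<subseteq> zero_locus V {f} \<or> Z \<subseteq> zero_locus V {g}"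
    using assms(1) unfolding irreducible_closed_def by blast
  then show ?thesis by (auto simp: zero_locus_def)
qed

lemma psubset_closed_separated:
  assumes "zariski_closed V Z" "zariski_closed V Z'" "Z \<subset> Z'"
  shows "\<exists>f\<in>mpolys V. (\<forall>x\<in>Z. meval f x = 0) \<and> (\<exists>x\<in>Z'. meval f x \<noteq> 0)"
proof -
  obtain F F' where "F \<subseteq> mpolys V" "Z = zero_locus V F" "Z' = zero_locus V F'"
    using assms(1,2) unfolding zariski_closed_def by blast
  moreover obtain x where "x \<in> Z'" "x \<notin> Z" using assms(3) by blast
  ultimately show ?thesis unfolding zero_locus_def by blast
qed

fun power_prod :: "('a, 'k::field) mpoly list \<Rightarrow> nat list \<Rightarrow> ('a, 'k) mpoly" where
  "power_prod (f # fs) (e # es) = f ^ e * power_prod fs es"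
| "power_prod _ _ = 1"

definition exponent_box :: "nat \<Rightarrow> nat \<Rightarrow> nat list set" where
  "exponent_box N k = {es. set es \<subseteq> {..N} \<and> length es = k}"

lemma finite_exponent_box [simp]: "finite (exponent_box N k)"
  unfolding exponent_box_def by (rule finite_lists_length_eq) simp

lemma exponent_box_0 [simp]: "exponent_box N 0 = {[]}"
  by (auto simp: exponent_box_def)

lemma card_exponent_box: "card (exponent_box N k) = Suc N ^ k"
  unfolding exponent_box_def by (subst card_lists_length_eq) auto

lemma sum_exponent_box_Suc:
  "(\<Sum>es\<in>exponent_box N (Suc k). g es) = (\<Sum>e\<le>N. \<Sum>es\<in>exponent_box N k. g (e # es))"
proof -
  have "exponent_box N (Suc k) = (\<lambda>(e, es). e # es) ` ({..N} \<times> exponent_box N k)"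
    by (auto simp: exponent_box_def length_Suc_conv image_iff)
  moreover have "inj_on (\<lambda>(e, es). e # es) ({..N} \<times> exponent_box N k)" by (auto simp: inj_on_def)
  ultimately show ?thesis by (simp add: sum.reindex sum.cartesian_product case_prod_unfold)
qed

text \<open>Relations are coefficient families on boxes of exponents. For a fixed \<open>N\<close>
  this is linear independence of finitely many functions, which a count of dimensions can
  refute.\<close>

definition alg_indep :: "('a \<Rightarrow> 'k::field) set \<Rightarrow> ('a, 'k) mpoly list \<Rightarrow> bool" where
  "alg_indep Z fs \<longleftrightarrow> (\<forall>N c. (\<forall>x\<in>Z. (\<Sum>es\<in>exponent_box N (length fs). c es * meval (power_prod fs es) x) = 0)
     \<longrightarrow> (\<forall>es\<in>exponent_box N (length fs). c es = 0))"

lemma mpolys_sum: "(\<And>i. i \<in> I \<Longrightarrow> p i \<in> mpolys V) \<Longrightarrow> sum p I \<in> mpolys V"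
  by (induction I rule: infinite_finite_induct) (auto simp: mpolys_add, auto simp: mpolys_def)

lemma mpolys_power_prod: "set fs \<subseteq> mpolys V \<Longrightarrow> power_prod fs es \<in> mpolys V"
  by (induction fs es rule: power_prod.induct) (auto intro: mpolys_mult mpolys_power)

text \<open>In a polynomial relation between \<open>f\<close> and \<open>fs\<close> on \<open>Z'\<close>, a power of \<open>f\<close> can be cancelled, so that
  the constant term in \<open>f\<close> does not vanish; restricted to \<open>Z\<close> this is a relation between \<open>fs\<close>.\<close>

lemma alg_indep_extend:
  assumes Z': "irreducible_closed V Z'" and "Z \<subseteq> Z'" "set fs \<subseteq> mpolys V" and indep: "alg_indep Z fs"
    and f: "f \<in> mpolys V" "\<And>x. x \<in> Z \<Longrightarrow> meval f x = 0" "\<exists>x\<in>Z'. meval f x \<noteq> 0"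
  shows "alg_indep Z' (f # fs)"
  unfolding alg_indep_def
proof (intro allI impI)
  fix N c
  assume rel: "\<forall>x\<in>Z'. (\<Sum>es\<in>exponent_box N (length (f # fs)). c es * meval (power_prod (f # fs) es) x) = 0"
  define B where "B = exponent_box N (length fs)"
  define A where "A e = (\<Sum>es\<in>B. Poly_Mapping.single 0 (c (e # es)) * power_prod fs es)" for e
  have A: "meval (A e) x = (\<Sum>es\<in>B. c (e # es) * meval (power_prod fs es) x)" for e x
    by (simp add: A_def meval_sum meval_mult meval_single)
  have A_in: "A e \<in> mpolys V" for e
    unfolding A_def by (intro mpolys_sum mpolys_mult mpolys_power_prod mpolys_const assms)
  have rel': "(\<Sum>e\<le>N. meval f x ^ e * meval (A e) x) = 0" if "x \<in> Z'" for x
  proof -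
    have "(\<Sum>e\<le>N. meval f x ^ e * meval (A e) x) =
      (\<Sum>es\<in>exponent_box N (length (f # fs)). c es * meval (power_prod (f # fs) es) x)"
      by (simp add: sum_exponent_box_Suc A meval_mult meval_power sum_distrib_left B_def mult_ac)
    then show ?thesis using rel that by simp
  qed
  have "\<forall>es\<in>B. c (j # es) = 0" if "j \<le> N" for j
    using that
  proof (induction j rule: less_induct)
    case (less j)
    define h where "h = (\<Sum>e=j..N. f ^ (e - j) * A e)"
    have h_in: "h \<in> mpolys V"
      unfolding h_def by (intro mpolys_sum mpolys_mult mpolys_power f A_in)
    have "meval (f ^ j) x * meval h x = 0" if x: "x \<in> Z'" for x
    proof -
      have "meval (f ^ j) x * meval h x = (\<Sum>e=j..N. meval f x ^ e * meval (A e) x)"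
        by (auto simp: h_def meval_sum meval_mult meval_power sum_distrib_left
            simp flip: power_add mult.assoc intro!: sum.cong)
      also have "\<dots> = (\<Sum>e\<le>N. meval f x ^ e * meval (A e) x)"
      proof (rule sum.mono_neutral_left)
        show "\<forall>e\<in>{..N} - {j..N}. meval f x ^ e * meval (A e) x = 0"
          using less.IH by (auto simp: A)
      qed auto
      finally show ?thesis using rel' x by simp
    qed
    then have "(\<forall>x\<in>Z'. meval (f ^ j) x = 0) \<or> (\<forall>x\<in>Z'. meval h x = 0)"
      using irreducible_closed_no_zero_divisors[OF Z'] mpolys_power[OF f(1)] h_in by blast
    then have h0: "\<forall>x\<in>Z'. meval h x = 0" using f(3) by (auto simp: meval_power)
    have "meval (A j) x = 0" if x: "x \<in> Z" for x
    proof -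
      have "meval h x = (\<Sum>e=j..N. 0 ^ (e - j) * meval (A e) x)"
        by (simp add: h_def meval_sum meval_mult meval_power f(2)[OF x])
      also have "\<dots> = (\<Sum>e\<in>{j}. 0 ^ (e - j) * meval (A e) x)"
        by (rule sum.mono_neutral_right) (use less.prems in auto)
      finally show ?thesis using h0 x assms(2) by auto
    qed
    then have "\<forall>x\<in>Z. (\<Sum>es\<in>B. c (j # es) * meval (power_prod fs es) x) = 0" by (simp add: A)
    then show ?case
      using indep[unfolded alg_indep_def, THEN spec[of _ N], THEN spec[of _ "\<lambda>es. c (j # es)"]]
      by (simp add: B_def)
  qed
  then show "\<forall>es\<in>exponent_box N (length (f # fs)). c es = 0"
    by (auto simp: exponent_box_def B_def length_Suc_conv)
qed

text \<open>Every strict inclusion supplies a function that vanishes on the smaller set but not on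
  all of the larger one, and \<open>alg_indep_extend\<close> adds it to the list.\<close>

lemma chain_alg_indep:
  assumes "\<And>i. i \<le> k \<Longrightarrow> irreducible_closed V (Z i)" "\<And>i. i < k \<Longrightarrow> Z i \<subset> Z (Suc i)"
  shows "\<exists>fs. length fs = k \<and> set fs \<subseteq> mpolys V \<and> alg_indep (Z k) fs"
  using assms
proof (induction k)
  case 0
  then have "Z 0 \<noteq> {}" by (auto simp: irreducible_closed_def)
  then have "alg_indep (Z 0) []" by (auto simp: alg_indep_def)
  then show ?case by auto
next
  case (Suc k)
  then obtain fs where fs: "length fs = k" "set fs \<subseteq> mpolys V" "alg_indep (Z k) fs"
    by (metis le_Suc_eq less_Suc_eq)
  have Z: "Z k \<subset> Z (Suc k)" "irreducible_closed V (Z k)" "irreducible_closed V (Z (Suc k))"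
    using Suc.prems by auto
  then have "zariski_closed V (Z k)" "zariski_closed V (Z (Suc k))"
    by (simp_all add: irreducible_closed_def)
  from psubset_closed_separated[OF this Z(1)]
  obtain f where f: "f \<in> mpolys V" "\<forall>x\<in>Z k. meval f x = 0" "\<exists>x\<in>Z (Suc k). meval f x \<noteq> 0"
    by blast
  have "alg_indep (Z (Suc k)) (f # fs)"
    by (rule alg_indep_extend[OF Z(3) _ fs(2,3)]) (use f Z(1) in auto)
  then show ?case using fs f(1) by (intro exI[of _ "f # fs"]) simp
qed

lemma alg_indep_mono: "alg_indep Z fs \<Longrightarrow> Z \<subseteq> X \<Longrightarrow> alg_indep X fs"
  unfolding alg_indep_def by (meson subsetD)

lemma card_image_le_card_image:
  assumes "finite (\<chi> ` M)" "\<And>a b. a \<in> M \<Longrightarrow> b \<in> M \<Longrightarrow> \<chi> a = \<chi> b \<Longrightarrow> F a = F b"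
  shows "finite (F ` M)" "card (F ` M) \<le> card (\<chi> ` M)"
proof -
  define G where "G c = F (SOME m. m \<in> M \<and> \<chi> m = c)" for c
  have "F m = G (\<chi> m)" if "m \<in> M" for m
  proof -
    have "(SOME m'. m' \<in> M \<and> \<chi> m' = \<chi> m) \<in> M \<and> \<chi> (SOME m'. m' \<in> M \<and> \<chi> m' = \<chi> m) = \<chi> m"
      by (rule someI[of _ m]) (use that in simp)
    then show ?thesis unfolding G_def using assms(2) that by metis
  qed
  then have eq: "F ` M = G ` \<chi> ` M" by (auto simp: image_iff)
  show "finite (F ` M)" "card (F ` M) \<le> card (\<chi> ` M)"
    unfolding eq using assms(1) card_image_le by auto
qed

lemma mchar_add: "mchar L (m + m') z = mchar L m z + mchar L m' z"
  by (simp add: mchar_def lookup_add sum.distrib)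

context hibi
begin

text \<open>All of \<open>L\<close> lies above \<open>bt\<close>, so \<open>mchar L m bt\<close> is
  the total degree of \<open>m\<close>.\<close>

definition degree_le :: "nat \<Rightarrow> ('a, 'k::field) mpoly \<Rightarrow> bool" where
  "degree_le E p \<longleftrightarrow> p \<in> mpolys L \<and> (\<forall>m\<in>keys p. mchar L m bt \<le> E)"

lemma degree_le_mult:
  assumes "degree_le E p" "degree_le E' q"
  shows "degree_le (E + E') (p * q)"
  unfolding degree_le_def
proof
  show "\<forall>m\<in>keys (p * q). mchar L m bt \<le> E + E'"
  proof
    fix m assume "m \<in> keys (p * q)"
    then obtain a b where "a \<in> keys p" "b \<in> keys q" "m = a + b" using keys_mult[of p q] by blast
    then show "mchar L m bt \<le> E + E'"
      using assms by (auto simp: mchar_add degree_le_def intro!: add_mono)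
  qed
qed (use assms mpolys_mult in \<open>auto simp: degree_le_def\<close>)

lemma degree_le_one: "degree_le E 1"
  by (auto simp: degree_le_def mchar_def)

lemma degree_le_power: "degree_le E p \<Longrightarrow> degree_le (n * E) (p ^ n)"
  by (induction n) (auto intro: degree_le_mult degree_le_one)

lemma degree_le_mono: "degree_le E p \<Longrightarrow> E \<le> E' \<Longrightarrow> degree_le E' p"
  by (auto simp: degree_le_def)

lemma degree_le_power_prod:
  assumes "\<And>f. f \<in> set fs \<Longrightarrow> degree_le D f" "set es \<subseteq> {..N}"
  shows "degree_le (length fs * (N * D)) (power_prod fs es)"
  using assms
proof (induction fs es rule: power_prod.induct)
  case (1 f fs e es)
  have "degree_le (N * D) (f ^ e)"
    by (rule degree_le_mono[OF degree_le_power[of D]]) (use 1 in auto)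
  then show ?case using degree_le_mult 1 by simp
qed (auto intro: degree_le_one)

lemma ex_degree_le:
  assumes "set fs \<subseteq> mpolys L"
  shows "\<exists>D. \<forall>f\<in>set fs. degree_le D f"
proof -
  define D where "D = Max ((\<lambda>m. mchar L m bt) ` (\<Union>f\<in>set fs. keys f))"
  have "mchar L m bt \<le> D" if "f \<in> set fs" "m \<in> keys f" for f m
    unfolding D_def by (rule Max_ge) (use that in auto)
  then show ?thesis using assms by (auto simp: degree_le_def)
qed

lemma mchar_le_bt: "z \<in> J \<Longrightarrow> mchar L m z \<le> mchar L m bt"
  unfolding mchar_def by (rule sum_mono2) (use fin bt in auto)

text \<open>Monomial functions of degree at most \<open>E\<close> on the Hibi variety are determined by a lattice
  point in a box of dimension \<open>card J\<close>, so more than \<open>card J\<close> functions have too many monomials to be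
  algebraically independent.\<close>

lemma alg_indep_hibi_variety_le:
  fixes fs :: "('a, 'k::field) mpoly list"
  assumes "alg_indep (hibi_variety L) fs" "set fs \<subseteq> mpolys L"
  shows "length fs \<le> card J"
proof (rule ccontr)
  assume len: "\<not> length fs \<le> card J"
  define k where "k = length fs"
  define r where "r = card J"
  obtain D where D: "\<And>f. f \<in> set fs \<Longrightarrow> degree_le D f" using ex_degree_le[OF assms(2)] by blast
  \<comment> \<open>With \<open>E = k * N * D\<close>, \<open>Suc E\<close> is at most
    \<open>Suc (k * D) * Suc N\<close>. This choice of \<open>N\<close> turns the
    \<open>r\<close>-th power of that bound into \<open>N * Suc N ^ r\<close>, which is less than
    \<open>Suc N ^ Suc r\<close>.\<close>
  define N where "N = Suc (k * D) ^ r"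
  define E where "E = k * (N * D)"
  \<comment> \<open>Extension by zero off the variety turns identities on the variety into
    identities of functions, as \<open>indep_family\<close> requires.\<close>
  define R where "R p x = (if x \<in> hibi_variety L then meval p x else 0)" for p :: "('a, 'k) mpoly" and x
  define M where "M = {m :: 'a \<Rightarrow>\<^sub>0 nat. keys m \<subseteq> L \<and> mchar L m bt \<le> E}"
  define mono_fun where "mono_fun m = R (Poly_Mapping.single m 1)" for m
  define \<chi> where "\<chi> m = restrict (mchar L m) J" for m
  have chi_sub: "\<chi> ` M \<subseteq> PiE J (\<lambda>_. {..E})"
    by (auto simp: \<chi>_def M_def intro: order_trans[OF mchar_le_bt])
  have fin_box: "finite (PiE J (\<lambda>_. {..E}))" by (intro finite_PiE) auto
  have fin_chi: "finite (\<chi> ` M)" using chi_sub fin_box by (rule finite_subset)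
  have mono_eq: "mono_fun a = mono_fun b" if "a \<in> M" "b \<in> M" "\<chi> a = \<chi> b" for a b
  proof -
    have "mchar L a z = mchar L b z" if "z \<in> J" for z
      using fun_cong[OF \<open>\<chi> a = \<chi> b\<close>, of z] that by (simp add: \<chi>_def)
    then have "monom_eval a x = monom_eval b x" if "x \<in> hibi_variety L" for x :: "'a \<Rightarrow> 'k"
      using monom_eval_char[of x a b] that \<open>a \<in> M\<close> \<open>b \<in> M\<close> by (auto simp: hibi_variety_iff M_def)
    then show ?thesis by (auto simp: mono_fun_def R_def meval_single fun_eq_iff)
  qed
  note finG = card_image_le_card_image(1)[of \<chi> M mono_fun, OF fin_chi mono_eq]
  note cardG = card_image_le_card_image(2)[of \<chi> M mono_fun, OF fin_chi mono_eq]
  have "card (\<chi> ` M) \<le> card (PiE J (\<lambda>_. {..E}))" by (rule card_mono[OF fin_box chi_sub])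
  also have "\<dots> = Suc E ^ r" by (simp add: card_PiE r_def)
  finally have "card (\<chi> ` M) \<le> Suc E ^ r" .
  with cardG have cardG': "card (mono_fun ` M) \<le> Suc E ^ r" by (rule order_trans)
  have R_span: "R p \<in> fun_space.span (mono_fun ` M)" if "degree_le E p" for p
  proof -
    have "R p = (\<lambda>x. \<Sum>m\<in>keys p. lookup p m * mono_fun m x)"
      by (auto simp: R_def mono_fun_def meval_monom meval_single fun_eq_iff)
    moreover have "(\<lambda>x. \<Sum>m\<in>keys p. lookup p m * mono_fun m x) \<in> fun_space.span (mono_fun ` M)"
      by (intro fun_space_span_sum fun_space.span_base imageI)
         (use that in \<open>auto simp: degree_le_def mpolys_def M_def\<close>)
    ultimately show ?thesis by simp
  qed
  have "indep_family (exponent_box N k) (\<lambda>es. R (power_prod fs es))"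
    unfolding indep_family_def
  proof (intro allI impI)
    fix c assume zero: "\<forall>x. (\<Sum>es\<in>exponent_box N k. c es * R (power_prod fs es) x) = 0"
    have "\<forall>x\<in>hibi_variety L. (\<Sum>es\<in>exponent_box N k. c es * meval (power_prod fs es) x) = 0"
    proof
      fix x :: "'a \<Rightarrow> 'k" assume "x \<in> hibi_variety L"
      then show "(\<Sum>es\<in>exponent_box N k. c es * meval (power_prod fs es) x) = 0"
        using zero[THEN spec[of _ x]] by (simp add: R_def)
    qed
    then show "\<forall>es\<in>exponent_box N k. c es = 0"
      using assms(1) unfolding alg_indep_def k_def by blast
  qed
  moreover have "(\<lambda>es. R (power_prod fs es)) ` exponent_box N k \<subseteq> fun_space.span (mono_fun ` M)"
  proof clarify
    fix es assume es: "es \<in> exponent_box N k"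
    have "degree_le E (power_prod fs es)"
      unfolding E_def k_def
      by (rule degree_le_power_prod[OF D]) (use es in \<open>auto simp: exponent_box_def\<close>)
    then show "R (power_prod fs es) \<in> fun_space.span (mono_fun ` M)" by (rule R_span)
  qed
  ultimately have "card (exponent_box N k) \<le> card (mono_fun ` M)"
    using indep_family_card_le finG by (metis finite_exponent_box)
  then have "Suc N ^ k \<le> Suc E ^ r" using cardG' by (simp add: card_exponent_box)
  also have "Suc E \<le> Suc (k * D) * Suc N" by (simp add: E_def algebra_simps)
  then have "Suc E ^ r \<le> (Suc (k * D) * Suc N) ^ r" by (rule power_mono) simp
  also have "\<dots> = N * Suc N ^ r" by (simp only: N_def power_mult_distrib)
  also have "\<dots> < Suc N * Suc N ^ r" by simp
  also have "\<dots> \<le> Suc N ^ k"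
    using len power_increasing[of "Suc r" k "Suc N"] by (simp add: k_def r_def)
  finally show False by simp
qed

lemma local_dim_hibi_variety_le: "local_dim L (hibi_variety L) P \<le> enat (card J)"
  unfolding local_dim_def
proof (rule Sup_least)
  fix e assume "e \<in> {enat k |k. \<exists>Z. (\<forall>i\<le>k. irreducible_closed L (Z i) \<and> P \<in> Z i \<and> Z i \<subseteq> hibi_variety L) \<and>
                  (\<forall>i<k. Z i \<subset> Z (Suc i))}"
  then obtain k Z where e: "e = enat k"
    and Z': "\<forall>i\<le>k. irreducible_closed L (Z i) \<and> P \<in> Z i \<and> Z i \<subseteq> hibi_variety L"
      "\<forall>i<k. Z i \<subset> Z (Suc i)"
    unfolding mem_Collect_eq by - (elim exE conjE, rule that)
  then have Z: "\<And>i. i \<le> k \<Longrightarrow> irreducible_closed L (Z i)" "Z k \<subseteq> hibi_variety L"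
      "\<And>i. i < k \<Longrightarrow> Z i \<subset> Z (Suc i)" by simp_all
  obtain fs where fs: "length fs = k" "set fs \<subseteq> mpolys L" "alg_indep (Z k) fs"
    using chain_alg_indep[of k L Z, OF Z(1,3)] by blast
  have "k \<le> card J"
    using alg_indep_hibi_variety_le[OF alg_indep_mono[OF fs(3) Z(2)] fs(2)] fs(1) by simp
  then show "e \<le> enat (card J)" by (simp add: e)
qed

end

section \<open>Lower bound: chains of closures of torus translates\<close>

definition zariski_closure :: "'a set \<Rightarrow> ('a \<Rightarrow> 'k::field) set \<Rightarrow> ('a \<Rightarrow> 'k) set" where
  "zariski_closure V Y = zero_locus V (vanishing_ideal V Y)"

lemma zariski_closed_closure: "zariski_closed V (zariski_closure V Y)"
  unfolding zariski_closed_def zariski_closure_def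
  by (rule exI[of _ "vanishing_ideal V Y"]) (auto simp: vanishing_ideal_def)

lemma zariski_closure_superset: "Y \<subseteq> affine_space V \<Longrightarrow> Y \<subseteq> zariski_closure V Y"
  by (auto simp: zariski_closure_def zero_locus_def vanishing_ideal_def)

lemma zariski_closure_vanishing:
  "p \<in> mpolys V \<Longrightarrow> (\<And>y. y \<in> Y \<Longrightarrow> meval p y = 0) \<Longrightarrow> x \<in> zariski_closure V Y \<Longrightarrow> meval p x = 0"
  by (auto simp: zariski_closure_def zero_locus_def vanishing_ideal_def)

lemma zariski_closure_least:
  assumes "zariski_closed V C" "Y \<subseteq> C"
  shows "zariski_closure V Y \<subseteq> C"
proof -
  obtain F where "F \<subseteq> mpolys V" "C = zero_locus V F" using assms(1) by (auto simp: zariski_closed_def)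
  then show ?thesis
    using assms(2) by (force simp: zariski_closure_def zero_locus_def vanishing_ideal_def)
qed

lemma zariski_closure_mono:
  assumes "Y \<subseteq> Y'" "Y' \<subseteq> affine_space V"
  shows "zariski_closure V Y \<subseteq> zariski_closure V Y'"
  using assms zariski_closure_superset zariski_closed_closure
  by (metis zariski_closure_least order_trans)

lemma irreducible_closed_singleton:
  assumes "P \<in> affine_space V"
  shows "irreducible_closed V {P}"
proof -
  define F where "F = (\<lambda>a. mvar a - Poly_Mapping.single 0 (P a)) ` V"
  have "x = P" if "x \<in> zero_locus V F" for x
  proof
    fix a
    have "meval (mvar a - Poly_Mapping.single 0 (P a)) x = 0" if "a \<in> V"
      using \<open>x \<in> zero_locus V F\<close> that by (simp add: F_def zero_locus_def)
    then show "x a = P a"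
      using that assms
      by (cases "a \<in> V") (simp_all add: zero_locus_def affine_space_def meval_diff meval_single)
  qed
  moreover have "P \<in> zero_locus V F"
    using assms by (auto simp: F_def zero_locus_def meval_diff meval_single)
  ultimately have "{P} = zero_locus V F" by blast
  moreover have "F \<subseteq> mpolys V" by (auto simp: F_def intro!: mpolys_diff)
  ultimately show ?thesis by (auto simp: irreducible_closed_def zariski_closed_def)
qed

text \<open>A point of \<open>Y\<close> outside \<open>A\<close> and one outside \<open>B\<close>
  are joined by a curve in \<open>Y\<close>. On this curve an equation of \<open>A\<close> and one
  of \<open>B\<close> would be nonzero polynomials with product zero.\<close>

lemma irreducible_closed_curve_connected:
  fixes Y :: "('a \<Rightarrow> 'k::field) set"
  assumes inf: "infinite (UNIV :: 'k set)" and "Y \<noteq> {}" "Y \<subseteq> affine_space V"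
    and curves: "\<And>x y. x \<in> Y \<Longrightarrow> y \<in> Y \<Longrightarrow> \<exists>\<gamma>. poly_curve \<gamma> \<and> \<gamma> 0 = x \<and> \<gamma> 1 = y \<and> (\<forall>s. \<gamma> s \<in> Y)"
  shows "irreducible_closed V (zariski_closure V Y)"
  unfolding irreducible_closed_def
proof (intro conjI allI impI)
  show "zariski_closure V Y \<noteq> {}" using zariski_closure_superset assms(2,3) by blast
  fix A B assume AB: "zariski_closed V A \<and> zariski_closed V B \<and> zariski_closure V Y \<subseteq> A \<union> B"
  show "zariski_closure V Y \<subseteq> A \<or> zariski_closure V Y \<subseteq> B"
  proof (rule ccontr)
    assume "\<not> (zariski_closure V Y \<subseteq> A \<or> zariski_closure V Y \<subseteq> B)"
    then obtain x y where xy: "x \<in> Y" "x \<notin> A" "y \<in> Y" "y \<notin> B"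
      using zariski_closure_least AB by (metis subsetI)
    obtain F G where FG: "A = zero_locus V F" "B = zero_locus V G"
      using AB by (auto simp: zariski_closed_def)
    obtain f g where fg: "f \<in> F" "meval f x \<noteq> 0" "g \<in> G" "meval g y \<noteq> 0"
      using xy FG assms(3) by (auto simp: zero_locus_def)
    obtain \<gamma> where \<gamma>: "poly_curve \<gamma>" "\<gamma> 0 = x" "\<gamma> 1 = y" "\<And>s. \<gamma> s \<in> Y"
      using curves[OF xy(1,3)] by blast
    obtain p q where p: "\<And>s. meval f (\<gamma> s) = poly p s" and q: "\<And>s. meval g (\<gamma> s) = poly q s"
      using poly_curve_meval[OF \<gamma>(1)] by metis
    have "poly (p * q) s = 0" for s
    proof -
      have "\<gamma> s \<in> A \<union> B" using \<gamma>(4) AB zariski_closure_superset[OF assms(3)] by blast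
      then show ?thesis using FG fg(1,3) by (auto simp: zero_locus_def simp flip: p q)
    qed
    then have "p * q = 0" by (rule poly_eq_0_infinite[OF inf])
    moreover have "p \<noteq> 0" using p[of 0] \<gamma>(2) fg(2) by auto
    moreover have "q \<noteq> 0" using q[of 1] \<gamma>(3) fg(4) by auto
    ultimately show False by simp
  qed
qed (rule zariski_closed_closure)

lemma ex_power_neq:
  fixes d :: "'k::field"
  assumes "infinite (UNIV :: 'k set)" "n > 0"
  shows "\<exists>c. c \<noteq> 0 \<and> c ^ n \<noteq> d"
proof (rule ccontr)
  assume *: "\<not> (\<exists>c. c \<noteq> 0 \<and> c ^ n \<noteq> d)"
  \<comment> \<open>The factor \<open>[:0, 1:]\<close> takes care of \<open>c = 0\<close>, about
    which the assumption says nothing.\<close>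
  let ?p = "[:0, 1:] * (monom 1 n - [:d:]) :: 'k poly"
  have "poly ?p c = 0" for c using * by (auto simp: poly_monom)
  then have "?p = 0" by (rule poly_eq_0_infinite[OF assms(1)])
  then have "monom 1 n - [:d:] = 0" by simp
  then have "coeff (monom 1 n - [:d:]) n = 0" by simp
  then show False using assms(2) by (simp add: coeff_pCons split: nat.splits)
qed

context hibi
begin

text \<open>The torus point \<open>u\<close> moved by the one-parameter subgroup with weights
  \<open>w\<close>. At \<open>s = 0\<close> the convention \<open>0 ^ 0 = 1\<close> keeps exactly
  the coordinates of weight zero, so limits in smaller orbits are included.\<close>

definition weighted_pt :: "('a \<Rightarrow> nat) \<Rightarrow> 'k::field \<Rightarrow> ('a \<Rightarrow> 'k) \<Rightarrow> 'a \<Rightarrow> 'k" where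
  "weighted_pt w s u \<alpha> = (if \<alpha> \<in> L then s ^ w \<alpha> * (\<Prod>z\<in>below \<alpha>. u z) else 0)"

definition modular_weight :: "('a \<Rightarrow> nat) \<Rightarrow> bool" where
  "modular_weight w \<longleftrightarrow> (\<forall>a\<in>L. \<forall>b\<in>L. w a + w b = w (sup a b) + w (inf a b))"

lemma weighted_pt_in_hibi_variety:
  assumes "modular_weight w"
  shows "weighted_pt w s u \<in> hibi_variety L"
proof -
  have "modular_mult L (\<lambda>\<alpha>. s ^ w \<alpha>)"
    using assms unfolding modular_mult_def modular_weight_def by (metis power_add)
  then have "modular_mult L (\<lambda>\<alpha>. s ^ w \<alpha> * (\<Prod>z\<in>below \<alpha>. u z))"
    using modular_mult_mult modular_mult_prod_below by blast
  then have "modular_mult L (weighted_pt w s u)"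
    by (subst modular_mult_cong[where g = "\<lambda>\<alpha>. s ^ w \<alpha> * (\<Prod>z\<in>below \<alpha>. u z)"])
       (auto simp: weighted_pt_def)
  then show ?thesis by (auto simp: hibi_variety_iff affine_space_def weighted_pt_def)
qed

text \<open>A nonzero weight is thus already visible on \<open>J\<close>, and an element has weight
  zero if all irreducibles below it do.\<close>

lemma modular_weight_zero:
  assumes w: "modular_weight w" and "\<alpha> \<in> L" "\<forall>z\<in>below \<alpha>. w z = 0"
  shows "w \<alpha> = 0"
  using assms(2,3)
proof (induction \<alpha> rule: join_induct)
  case (irreducible z)
  then show ?case by (auto simp: below_def)
next
  case (join a b)
  have "a < sup a b" "b < sup a b" using join(3,4) by (simp_all add: less_le)
  then have "w a = 0" "w b = 0" using join by (auto simp: below_sup)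
  then show ?case using w join(1,2) unfolding modular_weight_def by (metis add_is_0)
qed

text \<open>The weight \<open>w\<close> defines a one-parameter subgroup of the torus. The chain consists of \<open>P\<close> and the
  closures of the translates of an increasing chain of subtori which contain this one-parameter
  subgroup. Each \<open>Z i\<close> is separated from the next one by a character that is trivial on the smaller
  torus only; since \<open>z0\<close> is minimal with \<open>w z0 > 0\<close>, it can be written without negative exponents.\<close>

lemma local_dim_hibi_variety_ge:
  fixes t :: "'a \<Rightarrow> 'k::field"
  assumes inf: "infinite (UNIV :: 'k set)" and w: "modular_weight w" and "\<exists>\<alpha>\<in>L. w \<alpha> \<noteq> 0"
    and t: "\<And>z. z \<in> J \<Longrightarrow> t z \<noteq> 0"
  shows "enat (card J) \<le> local_dim L (hibi_variety L) (weighted_pt w s0 t)"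
proof -
  let ?X = "hibi_variety L :: ('a \<Rightarrow> 'k) set"
  define P where "P = weighted_pt w s0 t"
  obtain \<alpha> where \<alpha>: "\<alpha> \<in> L" "w \<alpha> \<noteq> 0" using assms(3) by blast
  have "\<not> (\<forall>z\<in>below \<alpha>. w z = 0)"
  proof
    assume "\<forall>z\<in>below \<alpha>. w z = 0"
    with modular_weight_zero[OF w \<alpha>(1)] have "w \<alpha> = 0" .
    then show False using \<alpha>(2) by simp
  qed
  then have "\<exists>z\<in>J. w z \<noteq> 0" by (auto simp: below_def)
  then have "{z\<in>J. w z \<noteq> 0} \<noteq> {}" by blast
  with finite_has_minimal[of "{z\<in>J. w z \<noteq> 0}"]
  obtain z0 where z0': "z0 \<in> {z\<in>J. w z \<noteq> 0}"
      "\<forall>b\<in>{z\<in>J. w z \<noteq> 0}. b \<le> z0 \<longrightarrow> z0 = b" by auto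
  then have z0min: "w y = 0" if "y \<in> J" "y < z0" for y using that by force
  from z0'(1) have z0: "z0 \<in> J" "w z0 > 0" by auto
  \<comment> \<open>The quotient of the coordinates at \<open>z\<close> and at \<open>low z\<close>
    is the character \<open>f_z\<close>, up to a power of \<open>s\<close>. Below \<open>bt\<close>
    there is no such element, and the constant \<open>1\<close> in \<open>lp\<close> takes its
    place.\<close>
  define low where "low z = (SOME \<alpha>. \<alpha> \<in> L \<and> below \<alpha> = {y\<in>J. y < z})" for z
  have low: "low z \<in> L" "below (low z) = {y\<in>J. y < z}" if "z \<in> J" "z \<noteq> bt" for z
  proof -
    have "low z \<in> L \<and> below (low z) = {y\<in>J. y < z}"
      unfolding low_def by (rule someI_ex) (use lower_element[OF that] in blast)
    then show "low z \<in> L" "below (low z) = {y\<in>J. y < z}" by auto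
  qed
  define lp where "lp z = (if z = bt then 1 else mvar (low z) :: ('a, 'k) mpoly)" for z
  define lw where "lw z = (if z = bt then 0 else w (low z))" for z
  define Q where "Q z u = (\<Prod>y | y \<in> J \<and> y < z. u y)" for z and u :: "'a \<Rightarrow> 'k"
  have lp_in: "lp z \<in> mpolys L" if "z \<in> J" for z using low[OF that] by (auto simp: lp_def)
  have bt_min: "{y \<in> J. y < bt} = {}" using bt(2) J_in_L by (auto dest: leD)
  have meval_lp: "meval (lp z) (weighted_pt w s u) = s ^ lw z * Q z u" if "z \<in> J" for z s u
  proof (cases "z = bt")
    case True
    have "Q bt u = 1" unfolding Q_def bt_min by simp
    then show ?thesis using True by (simp add: lp_def lw_def)
  next
    case False
    then show ?thesis using low[OF that False] by (simp add: lp_def lw_def Q_def weighted_pt_def)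
  qed
  have X: "weighted_pt w s u z = s ^ w z * (u z * Q z u)" if "z \<in> J" for z s u
  proof -
    have "below z = insert z {y\<in>J. y < z}" using that by (auto simp: below_def)
    then show ?thesis using that J_in_L by (simp add: weighted_pt_def Q_def)
  qed
  have lw0: "lw z0 = 0"
  proof (cases "z0 = bt")
    case False
    have "w y = 0" if "y \<in> below (low z0)" for y
      using that z0min low[OF z0(1) False] by auto
    then show ?thesis using modular_weight_zero[OF w low(1)[OF z0(1) False]] False by (simp add: lw_def)
  qed (simp add: lw_def)
  \<comment> \<open>The parameter \<open>s\<close> and the coordinates in \<open>A\<close> run
    through the whole field, zero included, so \<open>Y A\<close> is the image of an affine space
    and straight lines there give the connecting curves.\<close>
  define Y where "Y A = {weighted_pt w s u | s u. \<forall>z\<in>J - A. u z = t z}" for A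
  have Y_mono: "A \<subseteq> B \<Longrightarrow> Y A \<subseteq> Y B" for A B unfolding Y_def by blast
  have Y_X: "Y A \<subseteq> ?X" for A
    unfolding Y_def using weighted_pt_in_hibi_variety[OF w] by blast
  have Y_affine: "Y A \<subseteq> affine_space L" for A using Y_X[of A] hibi_variety_iff by blast
  have P_Y: "P \<in> Y A" for A by (auto simp: P_def Y_def)
  have Y_irreducible: "irreducible_closed L (zariski_closure L (Y A))" for A
  proof (rule irreducible_closed_curve_connected[OF inf])
    show "Y A \<noteq> {}" using P_Y[of A] by blast
    show "Y A \<subseteq> affine_space L" by (rule Y_affine)
    fix x y assume "x \<in> Y A" "y \<in> Y A"
    then obtain s u s' u' where su: "x = weighted_pt w s u" "\<forall>z\<in>J - A. u z = t z"
        "y = weighted_pt w s' u'" "\<forall>z\<in>J - A. u' z = t z" by (auto simp: Y_def)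
    define \<gamma> where "\<gamma> c = weighted_pt w (s + c * (s' - s)) (\<lambda>z. u z + c * (u' z - u z))" for c
    have "\<exists>q. \<forall>c. \<gamma> c \<alpha> = poly q c" for \<alpha>
    proof (cases "\<alpha> \<in> L")
      case True
      then have "\<forall>c. \<gamma> c \<alpha> = poly ([:s, s' - s:] ^ w \<alpha> * (\<Prod>z\<in>below \<alpha>. [:u z, u' z - u z:])) c"
        by (simp add: \<gamma>_def weighted_pt_def poly_prod)
      then show ?thesis by blast
    next
      case False
      then have "\<forall>c. \<gamma> c \<alpha> = poly 0 c" by (simp add: \<gamma>_def weighted_pt_def)
      then show ?thesis by blast
    qed
    moreover have "\<gamma> c \<in> Y A" for c
    proof -
      have "\<forall>z\<in>J - A. u z + c * (u' z - u z) = t z" using su by simp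
      then show ?thesis unfolding \<gamma>_def Y_def by blast
    qed
    ultimately show "\<exists>\<gamma>. poly_curve \<gamma> \<and> \<gamma> 0 = x \<and> \<gamma> 1 = y \<and> (\<forall>s. \<gamma> s \<in> Y A)"
      using su by (intro exI[of _ \<gamma>]) (auto simp: poly_curve_def \<gamma>_def)
  qed
  \<comment> \<open>The parameter \<open>s\<close> already contributes one dimension, so
    \<open>z0\<close> is never released and the chain still has \<open>card J\<close> strict
    inclusions.\<close>
  obtain zs where zs: "set zs = J - {z0}" "distinct zs"
    using finite_distinct_list[of "J - {z0}"] by auto
  have len: "Suc (length zs) = card J"
    using distinct_card[OF zs(2)] zs(1) card_Suc_Diff1[OF finite_J z0(1)] by simp
  define Z where "Z i = (case i of 0 \<Rightarrow> {P} | Suc k \<Rightarrow> zariski_closure L (Y (set (take k zs))))" for i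
  have X_closed: "zariski_closed L ?X"
    using hibi_binomials_mpolys by (auto simp: zariski_closed_def hibi_variety_def)
  have "irreducible_closed L (Z i) \<and> P \<in> Z i \<and> Z i \<subseteq> ?X" for i
  proof (cases i)
    case 0
    then show ?thesis
      using irreducible_closed_singleton[of P L] P_Y[of "{}"] Y_X[of "{}"] Y_affine[of "{}"]
      by (simp add: Z_def subset_iff)
  next
    case (Suc k)
    then show ?thesis
      using Y_irreducible zariski_closure_superset[OF Y_affine, THEN subsetD, OF P_Y]
        zariski_closure_least[OF X_closed Y_X]
      by (simp add: Z_def)
  qed
  moreover have "Z i \<subset> Z (Suc i)" if "i < card J" for i
  proof (cases i)
    case 0
    define s where "s = (if s0 ^ w z0 = 0 then 1 else 0 :: 'k)"
    have "weighted_pt w s t z0 \<noteq> P z0"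
    proof -
      have "t z0 * Q z0 t \<noteq> 0" using t z0 by (auto simp: Q_def)
      moreover have "s ^ w z0 \<noteq> s0 ^ w z0" using z0(2) by (cases "s0 = 0") (simp_all add: s_def zero_power eq_commute[of 0])
      ultimately show ?thesis unfolding P_def X[OF z0(1)] by simp
    qed
    moreover have "weighted_pt w s t \<in> Y {}" by (auto simp: Y_def)
    ultimately have "weighted_pt w s t \<in> Z (Suc i) - Z i" "P \<in> Z (Suc i)"
      using 0 zariski_closure_superset[OF Y_affine, of "{}"] P_Y[of "{}"] by (auto simp: Z_def)
    then show ?thesis using 0 by (auto simp: Z_def)
  next
    case (Suc k)
    define A where "A = set (take k zs)"
    define z where "z = zs ! k"
    have k: "k < length zs" using that Suc len by simp
    have A': "set (take (Suc k) zs) = insert z A"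
      using k by (simp add: take_Suc_conv_app_nth A_def z_def)
    have z: "z \<in> J" "z \<noteq> z0" using k zs(1) nth_mem[of k zs] by (auto simp: z_def)
    have "z \<notin> A"
      using k zs(2) by (auto simp: A_def z_def in_set_conv_nth nth_eq_iff_index_eq)
    have "z0 \<notin> A" using zs(1) set_take_subset[of k zs] by (auto simp: A_def)
    define a where "a = w z0"
    \<comment> \<open>The character \<open>a * f_z - (w z - lw z) * f_z0\<close> has weight zero in
      \<open>s\<close>, because \<open>lw z0 = 0\<close>. The polynomial \<open>p\<close> equates it
      with its value at \<open>t\<close>, with denominators cleared.\<close>
    define p where "p = Poly_Mapping.single 0 (t z0 ^ w z) *
        (mvar z ^ a * mvar z0 ^ lw z * lp z0 ^ w z)
      - Poly_Mapping.single 0 (t z ^ a * t z0 ^ lw z) * (lp z ^ a * mvar z0 ^ w z * lp z0 ^ lw z)"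
    have p_in: "p \<in> mpolys L"
      unfolding p_def using z z0 J_in_L
      by (intro mpolys_diff mpolys_mult mpolys_power lp_in mpolys_const mpolys_mvar) auto
    have p_eval: "meval p (weighted_pt w s u) =
      s ^ (a * w z + a * lw z) * (Q z u ^ a * Q z0 u ^ (lw z + w z)) *
        (t z0 ^ w z * u z ^ a * u z0 ^ lw z - t z ^ a * t z0 ^ lw z * u z0 ^ w z)" for s u
      using z(1) z0(1)
      by (simp add: p_def meval_diff meval_mult meval_power meval_single meval_lp X lw0 a_def
          power_mult_distrib power_add algebra_simps flip: power_mult)
    have "meval p x = 0" if "x \<in> Z i" for x
    proof (rule zariski_closure_vanishing[OF p_in])
      show "x \<in> zariski_closure L (Y A)" using that Suc by (simp add: Z_def A_def)
      fix y assume "y \<in> Y A"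
      then obtain s u where "y = weighted_pt w s u" "\<forall>x\<in>J - A. u x = t x" unfolding Y_def by blast
      moreover from this have "u z = t z" "u z0 = t z0"
        using \<open>z \<notin> A\<close> \<open>z0 \<notin> A\<close> z z0 by auto
      ultimately have "y = weighted_pt w s u" "u z = t z" "u z0 = t z0" by blast+
      then show "meval p y = 0" by (simp add: p_eval)
    qed
    moreover obtain c where c: "c \<noteq> 0" "c ^ a \<noteq> t z ^ a"
      using ex_power_neq[OF inf, of a] z0(2) by (auto simp: a_def)
    define y where "y = weighted_pt w 1 (t(z := c))"
    have "\<forall>x\<in>J - insert z A. (t(z := c)) x = t x" by simp
    then have "y \<in> Y (insert z A)" unfolding y_def Y_def by blast
    then have "y \<in> Z (Suc i)"
      using zariski_closure_superset[OF Y_affine, of "insert z A"] Suc A' by (auto simp: Z_def)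
    moreover have "meval p y \<noteq> 0"
    proof -
      have "Q x (t(z := c)) \<noteq> 0" for x using t c(1) by (auto simp: Q_def)
      moreover have "t z0 ^ w z * c ^ a * t z0 ^ lw z - t z ^ a * t z0 ^ lw z * t z0 ^ w z
          = t z0 ^ (w z + lw z) * (c ^ a - t z ^ a)"
        by (simp add: algebra_simps power_add)
      ultimately show ?thesis using z(2) c(2) t[OF z0(1)] by (simp add: y_def p_eval)
    qed
    moreover have "Z i \<subseteq> Z (Suc i)"
      using zariski_closure_mono[OF Y_mono[OF subset_insertI] Y_affine] Suc A'
      by (simp add: Z_def A_def)
    ultimately show ?thesis by blast
  qed
  ultimately have chain: "(\<forall>i\<le>card J. irreducible_closed L (Z i) \<and> P \<in> Z i \<and> Z i \<subseteq> ?X) \<and>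
      (\<forall>i<card J. Z i \<subset> Z (Suc i))" by simp
  show ?thesis
    unfolding local_dim_def P_def[symmetric]
    by (rule Sup_upper, rule CollectI, rule exI[of _ "card J"], rule conjI[OF refl], rule exI[of _ Z], rule chain)
qed

end

section \<open>Tangent spaces along torus orbits\<close>

text \<open>An edge \<open>(x, Some y)\<close> or \<open>(z, None)\<close> stands for the generator \<open>e\<^sub>x - e\<^sub>y\<close> or \<open>e\<^sub>z\<close> of the cone;
  \<open>ediff m\<close> is the pairing of \<open>m\<close> with it, which is \<open>0\<close> or \<open>1\<close> for \<open>m = f\<^bsub>I\<^sub>\<alpha>\<^esub>\<close>, according to
  \<open>cut \<alpha>\<close>.\<close>

type_synonym 'a edge = "'a \<times> 'a option"

definition ediff :: "('a \<Rightarrow> 'b::group_add) \<Rightarrow> 'a edge \<Rightarrow> 'b" where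
  "ediff m e = m (fst e) - (case snd e of None \<Rightarrow> 0 | Some y \<Rightarrow> m y)"

definition cut :: "'a::order \<Rightarrow> 'a edge \<Rightarrow> bool" where
  "cut \<alpha> e \<longleftrightarrow> fst e \<le> \<alpha> \<and> (case snd e of None \<Rightarrow> True | Some y \<Rightarrow> \<not> y \<le> \<alpha>)"

lemma ediff_simps [simp]:
  "ediff m (x, None) = m x" "ediff m (x, Some y) = m x - m y"
  by (auto simp: ediff_def)

lemma cut_simps [simp]:
  "cut \<alpha> (x, None) \<longleftrightarrow> x \<le> \<alpha>" "cut \<alpha> (x, Some y) \<longleftrightarrow> x \<le> \<alpha> \<and> \<not> y \<le> \<alpha>"
  by (auto simp: cut_def)

definition list_cut :: "'a::order list \<Rightarrow> 'a edge \<Rightarrow> nat" where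
  "list_cut xs e = length (filter (\<lambda>a. cut a e) xs)"

lemma list_cut_simps [simp]:
  "list_cut [] e = 0" "list_cut (x # xs) e = of_bool (cut x e) + list_cut xs e"
  by (auto simp: list_cut_def)

lemma list_cut_le_length: "list_cut xs e \<le> length xs"
  by (simp add: list_cut_def)

lemma list_cut_pos: "x \<in> set xs \<Longrightarrow> cut x e \<Longrightarrow> 0 < list_cut xs e"
  by (induction xs) auto

section \<open>Cuts and the dual cone\<close>

context hibi
begin

definition edges :: "'a edge set" where
  "edges = {(z, None) | z. z \<in> J \<and> \<not> (\<exists>w\<in>J. z < w)} \<union> {(x, Some y) | x y. covers_in J y x}"

lemma edges_cases [consumes 1, case_names top cover]:
  assumes "e \<in> edges"
  obtains z where "e = (z, None)" "z \<in> J" "\<not> (\<exists>w\<in>J. z < w)"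
  | x y where "e = (x, Some y)" "covers_in J y x" "x \<in> J" "y \<in> J" "x < y"
  using assms by (auto simp: edges_def covers_in_def)

lemma finite_edges [simp]: "finite edges"
proof (rule finite_subset)
  show "edges \<subseteq> J \<times> (insert None (Some ` J))" by (auto simp: edges_def covers_in_def)
qed simp

lemma of_bool_cut: "e \<in> edges \<Longrightarrow> (of_bool (cut \<alpha> e) :: int) = ediff (\<lambda>z. of_bool (z \<le> \<alpha>)) e"
  by (cases rule: edges_cases) auto

lemma cut_modular:
  assumes "e \<in> edges" "a \<in> L" "b \<in> L"
  shows "cut (sup a b) e \<or> cut (inf a b) e \<longleftrightarrow> cut a e \<or> cut b e"
    and "cut (sup a b) e \<and> cut (inf a b) e \<longleftrightarrow> cut a e \<and> cut b e"
  using assms(1) by (cases rule: edges_cases; use assms J_prime in auto)+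

text \<open>With \<open>nonneg_on_J\<close> this describes the dual cone by nonnegative antitone
  functions, whose upper level sets are ideals. The value type is left open: integers in
  \<open>balance\<close>, reals for the functionals that define faces.\<close>

lemma antitone_on_J:
  fixes n :: "'a \<Rightarrow> 'b::linordered_ab_group_add"
  assumes "\<And>e. e \<in> edges \<Longrightarrow> 0 \<le> ediff n e"
  shows "x \<in> J \<Longrightarrow> y \<in> J \<Longrightarrow> x \<le> y \<Longrightarrow> n y \<le> n x"
proof (induction y rule: measure_induct_rule[of "\<lambda>y. card {w\<in>J. w < y}"])
  case (less y)
  show ?case
  proof (cases "x = y")
    case False
    define A where "A = {w\<in>J. x \<le> w \<and> w < y}"
    have "finite A" "A \<noteq> {}" using less.prems False by (auto simp: A_def less_le)
    then obtain w where w: "w \<in> A" "\<forall>b\<in>A. w \<le> b \<longrightarrow> w = b"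
      using finite_has_maximal[of A] by blast
    have "covers_in J y w"
      using w less.prems(2) by (fastforce simp: covers_in_def A_def)
    then have "n y \<le> n w" using assms[of "(w, Some y)"] by (simp add: edges_def)
    also have "n w \<le> n x"
    proof (rule less.IH)
      show "card {v\<in>J. v < w} < card {v\<in>J. v < y}"
        by (rule psubset_card_mono) (use w in \<open>auto simp: A_def\<close>)
    qed (use w less.prems in \<open>auto simp: A_def\<close>)
    finally show ?thesis .
  qed simp
qed

lemma nonneg_on_J:
  fixes n :: "'a \<Rightarrow> 'b::linordered_ab_group_add"
  assumes edges: "\<And>e. e \<in> edges \<Longrightarrow> 0 \<le> ediff n e" and "z \<in> J"
  shows "0 \<le> n z"
proof -
  obtain m where m: "m \<in> J" "z \<le> m" "\<forall>b\<in>J. m \<le> b \<longrightarrow> m = b"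
    using finite_has_maximal2[OF finite_J assms(2)] by blast
  then have "(m, None) \<in> edges" by (auto simp: edges_def)
  then have "0 \<le> n m" using edges by force
  also have "n m \<le> n z" using antitone_on_J[OF edges assms(2) m(1,2)] by simp
  finally show ?thesis .
qed

lemma ediff_list_char:
  "e \<in> edges \<Longrightarrow> ediff (\<lambda>z. int (list_char xs z)) e = int (list_cut xs e)"
proof (induction xs)
  case (Cons x xs)
  then show ?case using of_bool_cut[of e x]
    by (cases rule: edges_cases[OF Cons.prems]) (auto split: if_splits)
qed (auto elim: edges_cases)

end

text \<open>A closed pair of the polarity between edges and lattice elements given by not cutting.
  The combinatorics and the tangent spaces see a face only through such a pair.\<close>

locale closed_face = hibi +
  fixes E :: "'a edge set" and D :: "'a set"
  assumes D_def: "D = {\<alpha>\<in>L. \<forall>e\<in>E. \<not> cut \<alpha> e}"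
    and E_def: "E = {e\<in>edges. \<forall>\<delta>\<in>D. \<not> cut \<delta> e}"
begin

lemma E_edges: "E \<subseteq> edges"
  unfolding E_def by blast

lemma finite_E [simp]: "finite E"
  using E_edges finite_edges finite_subset by blast

lemma D_subset: "D \<subseteq> L"
  unfolding D_def by blast

sublocale D: finite_sublattice D
proof
  show "finite D" using D_subset fin finite_subset by blast
  fix a b assume ab: "a \<in> D" "b \<in> D"
  have "\<not> cut (sup a b) e" "\<not> cut (inf a b) e" if "e \<in> E" for e
    using cut_modular[of e a b] E_edges ab that unfolding D_def by blast+
  then show "sup a b \<in> D" "inf a b \<in> D" using ab supL infL by (auto simp: D_def)
qed

definition Cut :: "'a \<Rightarrow> 'a edge set" where
  "Cut \<alpha> = {e\<in>E. cut \<alpha> e}"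

lemma finite_Cut [simp]: "finite (Cut \<alpha>)"
  by (simp add: Cut_def)

lemma in_D_iff: "\<alpha> \<in> L \<Longrightarrow> \<alpha> \<in> D \<longleftrightarrow> Cut \<alpha> = {}"
  by (auto simp: Cut_def D_def)

lemma Cut_modular:
  assumes "a \<in> L" "b \<in> L"
  shows "Cut (sup a b) \<union> Cut (inf a b) = Cut a \<union> Cut b" "Cut (sup a b) \<inter> Cut (inf a b) = Cut a \<inter> Cut b"
  using cut_modular[OF _ assms] E_edges unfolding Cut_def by blast+

text \<open>The hypothesis says that the difference \<open>m\<close> of the two characters annihilates the face. After
  adding a large multiple of the sum of all \<open>f\<^bsub>I\<^sub>\<delta>\<^esub>\<close>, \<open>\<delta> \<in> D\<close>, it lies in the dual cone, where it is
  the sum of its level sets.\<close>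

lemma balance:
  assumes xs: "set xs \<subseteq> L" and ys: "set ys \<subseteq> L"
    and eq: "\<And>e. e \<in> E \<Longrightarrow> list_cut xs e = list_cut ys e"
  shows "\<exists>us vs. set us \<subseteq> D \<and> set vs \<subseteq> D \<and> (\<forall>z\<in>J. list_char (xs @ us) z = list_char (ys @ vs) z)"
proof -
  \<comment> \<open>An entry of \<open>ys\<close> cuts an edge at most once. Hence \<open>N\<close>
    copies of a list of all of \<open>D\<close> make the difference nonnegative on every edge
    outside \<open>E\<close>, and they change nothing on \<open>E\<close>.\<close>
  define N where "N = length ys"
  obtain dl where dl: "set dl = D" using D.fin finite_list by blast
  define us where "us = concat (replicate N dl)"
  have us: "list_char us z = N * list_char dl z" for z
  proof -
    have "list_char (concat (replicate k dl)) z = k * list_char dl z" for k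
      by (induction k) auto
    then show ?thesis by (simp add: us_def)
  qed
  define n where "n z = int (list_char xs z) - int (list_char ys z) + int N * int (list_char dl z)" for z
  have ediff_n: "ediff n e = int (list_cut xs e) - int (list_cut ys e) + int N * int (list_cut dl e)"
    if "e \<in> edges" for e
    using that ediff_list_char[OF that, of xs] ediff_list_char[OF that, of ys] ediff_list_char[OF that, of dl]
    by (cases rule: edges_cases[OF that]) (auto simp: n_def algebra_simps)
  have ediff_E: "ediff n e = 0" if "e \<in> E" for e
  proof -
    have "list_cut dl e = 0" using that dl unfolding list_cut_def E_def by (auto simp: filter_empty_conv)
    then show ?thesis using ediff_n[of e] eq[OF that] that E_edges by auto
  qed
  have nonneg: "0 \<le> ediff n e" if e: "e \<in> edges" for e
  proof (cases "e \<in> E")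
    case False
    then obtain \<delta> where "\<delta> \<in> D" "cut \<delta> e" using e unfolding E_def by blast
    then have "1 \<le> list_cut dl e" using dl list_cut_pos[of \<delta> dl e] by simp
    then have "N * 1 \<le> N * list_cut dl e" by (intro mult_left_mono) auto
    then have "int N \<le> int N * int (list_cut dl e)" by (metis of_nat_le_iff of_nat_mult mult.right_neutral)
    moreover have "int (list_cut ys e) \<le> int N" by (simp add: N_def list_cut_le_length)
    ultimately show ?thesis using ediff_n[OF e] by simp
  qed (use ediff_E in simp)
  define lev where "lev h = (SOME \<alpha>. \<alpha> \<in> L \<and> below \<alpha> = {z\<in>J. int h \<le> n z})" for h
  have lev: "lev h \<in> L" "below (lev h) = {z\<in>J. int h \<le> n z}" if "int h \<le> n bt" for h
  proof -
    have "\<exists>\<alpha>\<in>L. below \<alpha> = {z\<in>J. int h \<le> n z}"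
    proof (rule ideal_realized)
      fix y z assume "z \<in> {z \<in> J. int h \<le> n z}" "y \<in> J" "y \<le> z"
      then show "y \<in> {z \<in> J. int h \<le> n z}" using antitone_on_J[OF nonneg, of y z] by auto
    next
      show "{z\<in>J. int h \<le> n z} \<noteq> {}" using that bt_J by blast
    qed auto
    then have "\<exists>\<alpha>. \<alpha> \<in> L \<and> below \<alpha> = {z\<in>J. int h \<le> n z}" by blast
    then have "lev h \<in> L \<and> below (lev h) = {z\<in>J. int h \<le> n z}"
      unfolding lev_def by (rule someI_ex)
    then show "lev h \<in> L" "below (lev h) = {z\<in>J. int h \<le> n z}" by auto
  qed
  \<comment> \<open>On an edge of \<open>E\<close> the function \<open>n\<close> takes equal values
    at both ends, or the value \<open>0\<close> if the edge ends in \<open>None\<close>. The latter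
    is why the levels start at \<open>1\<close>.\<close>
  have lev_D: "lev h \<in> D" if h: "int h \<le> n bt" "h > 0" for h
    unfolding D_def
  proof (intro CollectI conjI ballI)
    show "lev h \<in> L" by (rule lev[OF h(1)])
    fix e assume e: "e \<in> E"
    have le: "z \<le> lev h \<longleftrightarrow> int h \<le> n z" if "z \<in> J" for z
      using lev(2)[OF h(1)] that unfolding below_def by blast
    from e E_edges have "e \<in> edges" by blast
    then show "\<not> cut (lev h) e"
      using ediff_E[OF e] h(2) by (cases rule: edges_cases) (auto simp: le)
  qed
  define vs where "vs = map lev [1..<Suc (nat (n bt))]"
  have "list_char vs z = nat (n z)" if z: "z \<in> J" for z
  proof -
    have bounds: "0 \<le> n z" "n z \<le> n bt"
      using nonneg_on_J[OF nonneg z] antitone_on_J[OF nonneg bt_J z] bt(2) J_in_L[OF z] by auto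
    have "list_char vs z = card {h\<in>{1..<Suc (nat (n bt))}. z \<le> lev h}"
      by (simp add: list_char_def vs_def filter_map comp_def distinct_length_filter Int_def conj_commute
          del: upt_Suc)
    also have "{h\<in>{1..<Suc (nat (n bt))}. z \<le> lev h} = {1..<Suc (nat (n z))}"
    proof -
      have "z \<le> lev h \<longleftrightarrow> int h \<le> n z" if "int h \<le> n bt" for h
        using lev(2)[OF that] z unfolding below_def by blast
      then show ?thesis using bounds by (auto simp: le_nat_iff)
    qed
    finally show ?thesis by simp
  qed
  moreover have "0 \<le> n z" if "z \<in> J" for z using nonneg_on_J[OF nonneg that] .
  ultimately have "int (list_char vs z) = n z" if "z \<in> J" for z using that by simp
  then have "int (list_char (xs @ us) z) = int (list_char (ys @ vs) z)" if "z \<in> J" for z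
    using that us[of z] by (simp add: n_def)
  moreover have "set us \<subseteq> D" using dl by (auto simp: us_def)
  moreover have "set vs \<subseteq> D" using lev_D by (auto simp: vs_def le_nat_iff)
  ultimately show ?thesis by (metis of_nat_eq_iff)
qed

text \<open>These are the indecomposable elements of the semigroup generated by the cuts, i.e. by the images
  of the \<open>f\<^bsub>I\<^sub>\<alpha>\<^esub>\<close> modulo \<open>\<tau>\<^sup>\<bottom>\<close>.\<close>

definition irreducible_cut :: "'a \<Rightarrow> bool" where
  "irreducible_cut \<beta> \<longleftrightarrow> \<not> (\<exists>xs. set xs \<subseteq> L \<and> (\<forall>x\<in>set xs. Cut x \<subset> Cut \<beta>) \<and>
     (\<forall>e\<in>E. list_cut xs e = of_bool (cut \<beta> e)))"

lemma irreducible_cut_cong: "Cut \<beta> = Cut \<beta>' \<Longrightarrow> irreducible_cut \<beta> \<longleftrightarrow> irreducible_cut \<beta>'"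
proof -
  assume eq: "Cut \<beta> = Cut \<beta>'"
  then have "\<forall>e\<in>E. cut \<beta> e = cut \<beta>' e" unfolding Cut_def by blast
  then show ?thesis unfolding irreducible_cut_def eq by simp
qed

lemma irreducible_cut_nonempty: "irreducible_cut \<beta> \<Longrightarrow> Cut \<beta> \<noteq> {}"
  unfolding irreducible_cut_def Cut_def by (rule notI, erule notE, rule exI[of _ "[]"]) auto

lemma irreducible_cut_split:
  assumes "irreducible_cut \<beta>" "a \<in> L" "b \<in> L" "Cut a \<inter> Cut b = {}" "Cut a \<union> Cut b = Cut \<beta>"
  shows "Cut a = {} \<and> Cut b = Cut \<beta> \<or> Cut a = Cut \<beta> \<and> Cut b = {}"
proof -
  have "\<forall>e\<in>E. list_cut [a, b] e = of_bool (cut \<beta> e)"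
    using assms(4,5) unfolding Cut_def by auto
  then have "\<not> (Cut a \<subset> Cut \<beta> \<and> Cut b \<subset> Cut \<beta>)"
    using assms(1-3) unfolding irreducible_cut_def by (metis empty_set insert_subset list.simps(15) set_ConsD empty_iff empty_subsetI)
  then show ?thesis using assms(4,5) by blast
qed

text \<open>Different lattice elements may cut the same edges of \<open>E\<close>; one
  representative is fixed so that \<open>B\<close> counts each irreducible cut once.\<close>

definition rep :: "'a edge set \<Rightarrow> 'a" where
  "rep S = (SOME \<beta>. \<beta> \<in> L \<and> Cut \<beta> = S)"

lemma rep:
  assumes "\<beta> \<in> L"
  shows "rep (Cut \<beta>) \<in> L" "Cut (rep (Cut \<beta>)) = Cut \<beta>"
proof -
  have "rep (Cut \<beta>) \<in> L \<and> Cut (rep (Cut \<beta>)) = Cut \<beta>"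
    unfolding rep_def by (rule someI[of _ \<beta>]) (use assms in simp)
  then show "rep (Cut \<beta>) \<in> L" "Cut (rep (Cut \<beta>)) = Cut \<beta>" by auto
qed

text \<open>The two parts are disjoint, as irreducible cuts are nonempty. \<open>B\<close> serves
  twice: it indexes independent tangent vectors, and its elements are coordinates that determine a
  tangent vector.\<close>

definition B :: "'a set" where
  "B = join_irreducibles D \<union> {rep (Cut \<beta>) | \<beta>. \<beta> \<in> L \<and> irreducible_cut \<beta>}"

lemma B_subset: "B \<subseteq> L"
  using D.J_subset D_subset rep by (auto simp: B_def)

lemma finite_B [simp]: "finite B"
  using B_subset fin finite_subset by blast

lemma B_D: "b \<in> B \<Longrightarrow> b \<in> D \<Longrightarrow> b \<in> join_irreducibles D"
  using in_D_iff rep irreducible_cut_nonempty by (auto simp: B_def)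

lemma B_not_D: "b \<in> B \<Longrightarrow> b \<notin> D \<Longrightarrow> irreducible_cut b \<and> b = rep (Cut b)"
proof -
  assume "b \<in> B" "b \<notin> D"
  then obtain \<beta> where \<beta>: "b = rep (Cut \<beta>)" "\<beta> \<in> L" "irreducible_cut \<beta>"
    using D.J_subset by (auto simp: B_def)
  then show ?thesis using rep(2)[OF \<beta>(2)] irreducible_cut_cong by metis
qed

lemma B_eq_if_Cut_eq: "b \<in> B \<Longrightarrow> b \<notin> D \<Longrightarrow> b' \<in> B \<Longrightarrow> b' \<notin> D \<Longrightarrow> Cut b = Cut b' \<Longrightarrow> b = b'"
  using B_not_D by metis

section \<open>Tangent vectors at points of the orbit\<close>

definition orbit_tangent :: "('a \<Rightarrow> 'k::field) \<Rightarrow> ('a \<Rightarrow> 'k) set" where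
  "orbit_tangent P = {v \<in> affine_space L. \<forall>a\<in>L. \<forall>b\<in>L. P a * v b + v a * P b
       = P (sup a b) * v (inf a b) + v (sup a b) * P (inf a b)}"

lemma orbit_tangentD:
  "v \<in> orbit_tangent P \<Longrightarrow> a \<in> L \<Longrightarrow> b \<in> L \<Longrightarrow>
    P a * v b + v a * P b = P (sup a b) * v (inf a b) + v (sup a b) * P (inf a b)"
  unfolding orbit_tangent_def by blast

definition orbit_pt :: "('a \<Rightarrow> 'k::field) \<Rightarrow> 'a \<Rightarrow> 'k" where
  "orbit_pt \<chi> \<alpha> = (if \<alpha> \<in> D then \<chi> \<alpha> else 0)"

text \<open>By the modularity of cuts \<open>D\<close> is embedded, so both sides of the equation
  vanish together.\<close>

lemma modular_orbit_pt:
  assumes "modular_mult L \<chi>"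
  shows "modular_mult L (orbit_pt \<chi>)"
  unfolding modular_mult_def
proof (intro ballI)
  fix a b assume ab: "a \<in> L" "b \<in> L"
  have "a \<in> D \<and> b \<in> D \<longleftrightarrow> sup a b \<in> D \<and> inf a b \<in> D"
    unfolding in_D_iff[OF ab(1)] in_D_iff[OF ab(2)] in_D_iff[OF supL[OF ab]] in_D_iff[OF infL[OF ab]]
    using Cut_modular(1)[OF ab] by blast
  moreover have "\<chi> a * \<chi> b = \<chi> (sup a b) * \<chi> (inf a b)"
    using assms ab unfolding modular_mult_def by blast
  ultimately show "orbit_pt \<chi> a * orbit_pt \<chi> b = orbit_pt \<chi> (sup a b) * orbit_pt \<chi> (inf a b)"
    by (cases "a \<in> D \<and> b \<in> D") (auto simp: orbit_pt_def)
qed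

text \<open>For \<open>b\<close> in \<open>D\<close> this is an infinitesimal rescaling of the
  coordinates of \<open>D\<close> above \<open>b\<close>; otherwise it is a direction normal to the
  orbit, supported on the coordinates with the same cut as \<open>b\<close>.\<close>

definition tangent_vec :: "('a \<Rightarrow> 'k::field) \<Rightarrow> 'a \<Rightarrow> 'a \<Rightarrow> 'k" where
  "tangent_vec \<chi> b \<alpha> = (if \<alpha> \<in> L \<and> (if b \<in> D then \<alpha> \<in> D \<and> b \<le> \<alpha> else Cut \<alpha> = Cut b) then \<chi> \<alpha> else 0)"

text \<open>The factor \<open>\<chi>\<close> is common to both sides and leaves an identity of
  indicators. It holds because \<open>b\<close> is join prime in \<open>D\<close> or, off
  \<open>D\<close>, because an irreducible cut is a disjoint union of two cuts only
  trivially.\<close>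

lemma tangent_vec_in_tangent:
  assumes "modular_mult L \<chi>" and b: "b \<in> B"
  shows "tangent_vec \<chi> b \<in> orbit_tangent (orbit_pt \<chi>)"
  unfolding orbit_tangent_def
proof (intro CollectI conjI ballI)
  show "tangent_vec \<chi> b \<in> affine_space L" by (auto simp: affine_space_def tangent_vec_def)
  fix a c assume ac: "a \<in> L" "c \<in> L"
  define h where "h \<alpha> = (of_bool (if b \<in> D then \<alpha> \<in> D \<and> b \<le> \<alpha> else Cut \<alpha> = Cut b) :: 'b)" for \<alpha>
  define p where "p \<alpha> = (of_bool (\<alpha> \<in> D) :: 'b)" for \<alpha>
  have tv: "tangent_vec \<chi> b \<alpha> = \<chi> \<alpha> * h \<alpha>" if "\<alpha> \<in> L" for \<alpha>
    using that by (simp add: tangent_vec_def h_def)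
  have op: "orbit_pt \<chi> \<alpha> = \<chi> \<alpha> * p \<alpha>" for \<alpha> by (simp add: orbit_pt_def p_def)
  have D4: "\<alpha> \<in> D \<longleftrightarrow> Cut \<alpha> = {}" if "\<alpha> \<in> {a, c, sup a c, inf a c}" for \<alpha>
    using that ac in_D_iff supL infL by auto
  note mod = Cut_modular[OF ac]
  have "p a * h c + h a * p c = p (sup a c) * h (inf a c) + h (sup a c) * p (inf a c)"
  proof (cases "b \<in> D")
    case True
    then have bJ: "b \<in> join_irreducibles D" using B_D b by blast
    show ?thesis
    proof (cases "a \<in> D \<and> c \<in> D")
      case ad: True
      then show ?thesis
        using True D.J_prime[OF bJ, of a c] D.supL[of a c] D.infL[of a c]
        by (auto simp: p_def h_def)
    next
      case False
      then have "\<not> (sup a c \<in> D \<and> inf a c \<in> D)" using mod D4 by auto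
      then show ?thesis using False True by (auto simp: p_def h_def)
    qed
  next
    case False
    have irr: "irreducible_cut b" using B_not_D[OF b False] by blast
    have ne: "Cut b \<noteq> {}" by (rule irreducible_cut_nonempty[OF irr])
    define Q where "Q X Y \<longleftrightarrow> X = {} \<and> Y = Cut b \<or> X = Cut b \<and> Y = {}" for X Y
    have "Q (Cut a) (Cut c) \<longleftrightarrow> Q (Cut (sup a c)) (Cut (inf a c))"
      unfolding Q_def
      using irreducible_cut_split[OF irr ac] irreducible_cut_split[OF irr supL[OF ac] infL[OF ac]] mod
      by (metis Int_empty_left Int_empty_right Un_empty_left Un_empty_right)
    moreover have "p x * h y + h x * p y = of_bool (Q (Cut x) (Cut y))"
      if "x \<in> {a, c, sup a c, inf a c}" "y \<in> {a, c, sup a c, inf a c}" for x y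
      using that D4 False ne by (auto simp: p_def h_def Q_def)
    ultimately show ?thesis by simp
  qed
  moreover have "\<chi> a * \<chi> c = \<chi> (sup a c) * \<chi> (inf a c)"
    using assms(1) ac unfolding modular_mult_def by blast
  ultimately have "(\<chi> a * \<chi> c) * (p a * h c + h a * p c)
      = (\<chi> (sup a c) * \<chi> (inf a c)) * (p (sup a c) * h (inf a c) + h (sup a c) * p (inf a c))"
    by simp
  then show "orbit_pt \<chi> a * tangent_vec \<chi> b c + tangent_vec \<chi> b a * orbit_pt \<chi> c =
    orbit_pt \<chi> (sup a c) * tangent_vec \<chi> b (inf a c) + tangent_vec \<chi> b (sup a c) * orbit_pt \<chi> (inf a c)"
    using ac supL infL by (simp add: tv op algebra_simps)
qed

lemma indep_tangent_vec:
  assumes "\<And>\<alpha>. \<alpha> \<in> L \<Longrightarrow> \<chi> \<alpha> \<noteq> 0"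
  shows "indep_family B (tangent_vec \<chi>)"
proof (rule indep_family_triangular[OF finite_B])
  fix I' assume I': "I' \<subseteq> B" "I' \<noteq> {}"
  show "\<exists>i\<in>I'. \<exists>x. tangent_vec \<chi> i x \<noteq> 0 \<and> (\<forall>j\<in>I'. j \<noteq> i \<longrightarrow> tangent_vec \<chi> j x = 0)"
  proof (cases "I' \<subseteq> D")
    case True
    obtain b where b: "b \<in> I'" "\<forall>j\<in>I'. j \<le> b \<longrightarrow> b = j"
      using finite_has_minimal[OF finite_subset[OF I'(1) finite_B] I'(2)] by blast
    then have "tangent_vec \<chi> b b \<noteq> 0" "\<forall>j\<in>I'. j \<noteq> b \<longrightarrow> tangent_vec \<chi> j b = 0"
      using True D_subset assms[of b] by (auto simp: tangent_vec_def)
    then show ?thesis using b(1) by blast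
  next
    case False
    then obtain b where b: "b \<in> I'" "b \<notin> D" by blast
    then have "tangent_vec \<chi> b b \<noteq> 0" using I'(1) B_subset assms[of b] by (auto simp: tangent_vec_def)
    moreover have "tangent_vec \<chi> j b = 0" if "j \<in> I'" "j \<noteq> b" for j
      using that b I'(1) B_eq_if_Cut_eq[of b j] by (auto simp: tangent_vec_def)
    ultimately show ?thesis using b(1) by blast
  qed
qed

lemma card_B_le_dim_tangent:
  assumes "modular_mult L \<chi>" "\<And>\<alpha>. \<alpha> \<in> L \<Longrightarrow> \<chi> \<alpha> \<noteq> 0"
  shows "card B \<le> fun_space.dim (orbit_tangent (orbit_pt \<chi>))"
proof (rule fun_space_dim_ge[OF fin _ finite_B indep_tangent_vec[OF assms(2)]])
  show "tangent_vec \<chi> ` B \<subseteq> orbit_tangent (orbit_pt \<chi>)"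
    using tangent_vec_in_tangent[OF assms(1)] by blast
qed (auto simp: orbit_tangent_def affine_space_def)

lemma subspace_orbit_tangent: "fun_space.subspace (orbit_tangent P)"
  unfolding fun_space.subspace_def
proof (intro conjI ballI allI)
  have outside: "v a = 0" if "v \<in> orbit_tangent P" "a \<notin> L" for v a
    using that by (simp add: orbit_tangent_def affine_space_def)
  show "0 \<in> orbit_tangent P" by (simp add: orbit_tangent_def affine_space_def)
  fix v assume v: "v \<in> orbit_tangent P"
  show "v + w \<in> orbit_tangent P" if w: "w \<in> orbit_tangent P" for w
    unfolding orbit_tangent_def
  proof (intro CollectI conjI ballI)
    fix a b assume ab: "a \<in> L" "b \<in> L"
    show "P a * (v + w) b + (v + w) a * P b = P (sup a b) * (v + w) (inf a b) + (v + w) (sup a b) * P (inf a b)"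
      using arg_cong2[OF orbit_tangentD[OF v ab] orbit_tangentD[OF w ab], of "(+)"] by (simp add: algebra_simps)
  qed (simp add: affine_space_def outside v w)
  fix c
  show "(\<lambda>a. c * v a) \<in> orbit_tangent P"
    unfolding orbit_tangent_def
  proof (intro CollectI conjI ballI)
    fix a b assume ab: "a \<in> L" "b \<in> L"
    show "P a * (c * v b) + c * v a * P b = P (sup a b) * (c * v (inf a b)) + c * v (sup a b) * P (inf a b)"
      using arg_cong[OF orbit_tangentD[OF v ab], of "(*) c"] by (simp add: algebra_simps)
  qed (simp add: affine_space_def outside v)
qed

end

section \<open>Comparison of \<open>B\<close> with \<open>J\<close>\<close>

lemma sum_list_fun_apply: "(\<Sum>x\<leftarrow>xs. f x) a = (\<Sum>x\<leftarrow>xs. f x a)"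
  by (induction xs) auto

lemma fun_space_span_sum_list:
  "(\<And>x. x \<in> set xs \<Longrightarrow> f x \<in> fun_space.span S) \<Longrightarrow> (\<Sum>x\<leftarrow>xs. f x) \<in> fun_space.span S"
  by (induction xs) (auto intro: fun_space.span_add fun_space.span_zero)

lemma Dual_0_mult [simp]: "Dual 0 0 * x = Dual 0 0"
  by (cases x) simp

lemma prod_list_Dual_0: "x \<in> set xs \<Longrightarrow> g x = Dual 0 0 \<Longrightarrow> prod_list (map g xs) = Dual 0 0"
  by (induction xs) (auto simp: mult.commute[of _ "Dual 0 0"])

lemma re_prod_list: "re (prod_list (map g xs)) = prod_list (map (\<lambda>x. re (g x)) xs)"
  by (induction xs) (auto simp: times_dual_def one_dual_def)

context closed_face
begin

text \<open>Additivity is asked only for relations with a single \<open>\<beta>\<close> on one side,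
  the kind by which elements decompose into irreducible ones. This leaves room for functions that
  violate a relation with two elements on each side.\<close>

definition additive_weight :: "('a \<Rightarrow> 'k::field) \<Rightarrow> bool" where
  "additive_weight h \<longleftrightarrow> (\<forall>\<beta>\<in>L. \<forall>xs. set xs \<subseteq> L \<longrightarrow>
     (\<forall>e\<in>E. list_cut xs e = of_bool (cut \<beta> e)) \<longrightarrow> h \<beta> = (\<Sum>x\<leftarrow>xs. h x))"

text \<open>The coordinate \<open>None\<close> carries an additional additive function \<open>h\<close>. If \<open>h\<close> is not a linear
  function of \<open>f\<^bsub>I\<^sub>\<beta>\<^esub>\<close>, then the vectors \<open>aug_vec h \<beta>\<close>, and hence \<open>B\<close>, span a space of dimension
  more than \<open>card J\<close>.\<close>

definition aug_vec :: "('a \<Rightarrow> 'k::field) \<Rightarrow> 'a \<Rightarrow> 'a option \<Rightarrow> 'k" where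
  "aug_vec h \<beta> t = (case t of None \<Rightarrow> h \<beta> | Some z \<Rightarrow> of_bool (z \<in> J \<and> z \<le> \<beta>))"

lemma aug_vec_simps [simp]:
  "aug_vec h \<beta> None = h \<beta>" "aug_vec h \<beta> (Some z) = of_bool (z \<in> J \<and> z \<le> \<beta>)"
  by (auto simp: aug_vec_def)

abbreviation aug_span :: "('a \<Rightarrow> 'k::field) \<Rightarrow> ('a option \<Rightarrow> 'k) set" where
  "aug_span h \<equiv> fun_space.span (aug_vec h ` B)"

lemma sum_list_aug_vec:
  "(\<Sum>x\<leftarrow>xs. aug_vec h x) (Some z) = (if z \<in> J then of_nat (list_char xs z) else 0)"
  by (induction xs) auto

lemma additive_weight_D: "additive_weight h \<Longrightarrow> \<delta> \<in> D \<Longrightarrow> h \<delta> = 0"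
  unfolding additive_weight_def using D_subset
  by (auto dest!: bspec[of _ _ \<delta>] spec[of _ "[]"] simp: D_def)

lemma sum_list_weight_D: "additive_weight h \<Longrightarrow> set us \<subseteq> D \<Longrightarrow> (\<Sum>x\<leftarrow>us. h x) = 0"
  by (induction us) (auto simp: additive_weight_D)

lemma aug_vec_D_in_span:
  assumes h: "additive_weight h" and "\<delta> \<in> D"
  shows "aug_vec h \<delta> \<in> aug_span h"
  using assms(2)
proof (induction \<delta> rule: D.join_induct)
  case (irreducible z)
  then show ?case by (intro fun_space.span_base imageI) (auto simp: B_def)
next
  case (join a b)
  have lt: "a < sup a b" "b < sup a b" using join(3,4) by (simp_all add: less_le)
  then have "inf a b < sup a b" by (metis inf.cobounded1 order.strict_trans1)
  then have "aug_vec h (inf a b) \<in> aug_span h"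
    using join D.infL by blast
  moreover have "aug_vec h a \<in> aug_span h" "aug_vec h b \<in> aug_span h"
    using join lt by blast+
  moreover have "aug_vec h (sup a b) = aug_vec h a + aug_vec h b - aug_vec h (inf a b)"
  proof
    fix t show "aug_vec h (sup a b) t = (aug_vec h a + aug_vec h b - aug_vec h (inf a b)) t"
    proof (cases t)
      case None
      then show ?thesis using join D.supL D.infL additive_weight_D[OF h] by simp
    next
      case (Some z)
      have "a \<in> L" "b \<in> L" using join D_subset by auto
      then show ?thesis using Some J_prime[of z a b] by auto
    qed
  qed
  ultimately show ?case by (simp only: fun_space.span_add fun_space.span_diff)
qed

text \<open>Equal cuts give equal vectors only up to elements of \<open>D\<close>. The correction
  comes from \<open>balance\<close>; \<open>h\<close> vanishes on it and its vectors are already in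
  the span.\<close>

lemma aug_vec_decompose:
  assumes h: "additive_weight h" and \<beta>: "\<beta> \<in> L" and xs: "set xs \<subseteq> L"
    and cut: "\<forall>e\<in>E. list_cut xs e = of_bool (cut \<beta> e)"
    and span: "\<And>x. x \<in> set xs \<Longrightarrow> aug_vec h x \<in> aug_span h"
  shows "aug_vec h \<beta> \<in> aug_span h"
proof -
  obtain us vs where us: "set us \<subseteq> D" and vs: "set vs \<subseteq> D"
    and char: "\<forall>z\<in>J. list_char ([\<beta>] @ us) z = list_char (xs @ vs) z"
    using balance[of "[\<beta>]" xs] \<beta> xs cut by auto
  let ?v = "(\<Sum>x\<leftarrow>xs. aug_vec h x) + (\<Sum>x\<leftarrow>vs. aug_vec h x) - (\<Sum>x\<leftarrow>us. aug_vec h x)"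
  have "aug_vec h \<beta> = ?v"
  proof
    fix t show "aug_vec h \<beta> t = ?v t"
    proof (cases t)
      case None
      have "h \<beta> = (\<Sum>x\<leftarrow>xs. h x)" using h \<beta> xs cut unfolding additive_weight_def by blast
      then show ?thesis using None sum_list_weight_D[OF h us] sum_list_weight_D[OF h vs]
        by (simp add: sum_list_fun_apply)
    next
      case (Some z)
      show ?thesis
      proof (cases "z \<in> J")
        case True
        have "list_char [\<beta>] z + list_char us z = list_char xs z + list_char vs z"
          using char True by (metis list_char_simps(3))
        then have "(of_nat (list_char [\<beta>] z) :: 'b) + of_nat (list_char us z)
            = of_nat (list_char xs z) + of_nat (list_char vs z)"
          by (metis of_nat_add)
        then show ?thesis using Some True
          by (simp add: sum_list_aug_vec algebra_simps split: if_splits)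
      qed (simp add: Some sum_list_aug_vec)
    qed
  qed
  moreover have "?v \<in> aug_span h"
    by (intro fun_space.span_add fun_space.span_diff fun_space_span_sum_list span
        aug_vec_D_in_span[OF h]) (use us vs in auto)
  ultimately show ?thesis by (simp only:)
qed

lemma aug_vec_in_span:
  assumes h: "additive_weight h" and "\<beta> \<in> L"
  shows "aug_vec h \<beta> \<in> aug_span h"
  using assms(2)
proof (induction \<beta> rule: measure_induct_rule[of "\<lambda>\<beta>. card (Cut \<beta>)"])
  case (less \<beta>)
  show ?case
  proof (cases "irreducible_cut \<beta>")
    case True
    then have "rep (Cut \<beta>) \<in> B" using less.prems by (auto simp: B_def)
    then have "aug_vec h (rep (Cut \<beta>)) \<in> aug_span h"
      by (intro fun_space.span_base imageI)
    moreover have "\<forall>e\<in>E. list_cut [rep (Cut \<beta>)] e = of_bool (cut \<beta> e)"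
      using rep(2)[OF less.prems] unfolding Cut_def by auto
    ultimately show ?thesis
      by (intro aug_vec_decompose[OF h less.prems, of "[rep (Cut \<beta>)]"])
         (use rep(1)[OF less.prems] in auto)
  next
    case False
    then obtain xs where xs: "set xs \<subseteq> L" "\<forall>x\<in>set xs. Cut x \<subset> Cut \<beta>"
      "\<forall>e\<in>E. list_cut xs e = of_bool (cut \<beta> e)" unfolding irreducible_cut_def by blast
    show ?thesis
    proof (rule aug_vec_decompose[OF h less.prems xs(1,3)])
      fix x assume "x \<in> set xs"
      then show "aug_vec h x \<in> aug_span h"
        using less.IH[of x] xs psubset_card_mono[of "Cut \<beta>" "Cut x"] by auto
    qed
  qed
qed

text \<open>The ideal of \<open>z\<close> without \<open>z\<close> is empty or again the ideal of a
  lattice element. The difference of the two vectors is the unit vector at \<open>z\<close> up to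
  the coordinate \<open>None\<close>, which the last hypothesis controls.\<close>

lemma unit_Some_in_span:
  fixes h :: "'a \<Rightarrow> 'k::field"
  assumes h: "additive_weight h" and "z \<in> J"
    and None: "unit_fun None \<in> aug_span h \<or> h = (\<lambda>_. 0)"
  shows "unit_fun (Some z) \<in> aug_span h"
proof -
  have "\<exists>v\<in>aug_span h. (\<forall>y. v (Some y) = of_bool (y \<in> J \<and> y < z)) \<and> (h = (\<lambda>_. 0) \<longrightarrow> v None = 0)"
  proof (cases "z = bt")
    case True
    then show ?thesis using bt(2) J_in_L
      by (intro bexI[of _ 0]) (auto simp: fun_space.span_zero dest: leD)
  next
    case False
    then obtain \<alpha> where \<alpha>: "\<alpha> \<in> L" "below \<alpha> = {y\<in>J. y < z}" using lower_element assms(2) by blast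
    have "y \<in> J \<and> y \<le> \<alpha> \<longleftrightarrow> y \<in> J \<and> y < z" for y using \<alpha>(2) unfolding below_def by blast
    then show ?thesis using aug_vec_in_span[OF h \<alpha>(1)] by (intro bexI[of _ "aug_vec h \<alpha>"]) auto
  qed
  then obtain v where v: "v \<in> aug_span h"
    "\<And>y. v (Some y) = of_bool (y \<in> J \<and> y < z)" "h = (\<lambda>_. 0) \<Longrightarrow> v None = 0" by blast
  define c where "c = h z - v None"
  have "(\<lambda>x. c * unit_fun None x) \<in> aug_span h"
  proof (cases "h = (\<lambda>_. 0)")
    case True
    then have "(\<lambda>x. c * unit_fun None x) = (0 :: 'a option \<Rightarrow> 'k)" using v(3) by (auto simp: c_def)
    then show ?thesis by (simp only: fun_space.span_zero)
  qed (use None fun_space.span_scale in blast)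
  then have "aug_vec h z - v - (\<lambda>x. c * unit_fun None x) \<in> aug_span h"
    using aug_vec_in_span[OF h J_in_L[OF assms(2)]] v(1) by (intro fun_space.span_diff)
  moreover have "aug_vec h z - v - (\<lambda>x. c * unit_fun None x) = unit_fun (Some z)"
  proof
    fix t show "(aug_vec h z - v - (\<lambda>x. c * unit_fun None x)) t = unit_fun (Some z) t"
      using assms(2) by (cases t) (auto simp: c_def unit_fun_def v(2) le_less)
  qed
  ultimately show ?thesis by (simp only:)
qed

lemma card_J_le_card_B: "card J \<le> card B"
proof -
  \<comment> \<open>For \<open>h = 0\<close> the coordinate \<open>None\<close> is void and the
    vectors are those of the ideals alone.\<close>
  define h where "h = (\<lambda>_::'a. 0::rat)"
  have h: "additive_weight h" by (simp add: additive_weight_def h_def)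
  have "card (Some ` J) \<le> card (aug_vec h ` B)"
  proof (rule indep_family_card_le)
    show "indep_family (Some ` J) (unit_fun :: _ \<Rightarrow> _ \<Rightarrow> rat)" by (rule indep_family_unit_fun) simp
    show "unit_fun ` Some ` J \<subseteq> aug_span h"
      using unit_Some_in_span[OF h] by (auto simp: h_def)
  qed auto
  also have "\<dots> \<le> card B" by (rule card_image_le) simp
  finally show ?thesis by (simp add: card_image)
qed

text \<open>The square with corners \<open>a\<close>, \<open>b\<close>, \<open>c\<close>, \<open>d\<close> gives a linear relation
  \<open>f\<^sub>b + f\<^sub>c = f\<^bsub>b \<or> c\<^esub> + f\<^bsub>b \<and> c\<^esub>\<close>, which is violated by the additive function that counts the
  irreducible cuts through the edges from \<open>a\<close> to \<open>c\<close> and from \<open>b\<close> to \<open>d\<close>.\<close>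

lemma square_card_B:
  assumes E4: "(a, Some b) \<in> E" "(b, Some d) \<in> E" "(a, Some c) \<in> E" "(c, Some d) \<in> E"
    and bc: "\<not> b \<le> c" "\<not> c \<le> b"
  shows "Suc (card J) \<le> card B"
proof -
  have J4: "a \<in> J" "b \<in> J" "c \<in> J" "d \<in> J" and le4: "a < b" "b < d" "a < c" "c < d"
    using E4 E_edges by (auto simp: edges_def covers_in_def)
  define h where "h \<beta> = (of_bool (b \<le> \<beta> \<and> \<not> c \<le> \<beta>) :: rat)" for \<beta>
  \<comment> \<open>An entry above \<open>a\<close> but not above \<open>d\<close> cuts one edge on
    each of the two paths from \<open>a\<close> to \<open>d\<close>. The hypotheses allow at most
    one such entry, and \<open>p2\<close> and \<open>p3\<close> record whether it is counted by
    \<open>h\<close>.\<close>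
  have sum: "(\<Sum>x\<leftarrow>xs. h x) = of_bool (p2 \<and> p3)"
    if "list_cut xs (a, Some b) = of_bool p1" "list_cut xs (b, Some d) = of_bool p2"
       "list_cut xs (a, Some c) = of_bool p3" "list_cut xs (c, Some d) = of_bool p4"
       "\<not> (p1 \<and> p2)" "\<not> (p3 \<and> p4)" for xs p1 p2 p3 p4
    using that
  proof (induction xs arbitrary: p1 p2 p3 p4)
    case (Cons x xs)
    have ord: "b \<le> x \<Longrightarrow> a \<le> x" "d \<le> x \<Longrightarrow> b \<le> x" "c \<le> x \<Longrightarrow> a \<le> x" "d \<le> x \<Longrightarrow> c \<le> x"
      using le4 by (auto intro: order_trans less_imp_le)
    show ?case
    proof (cases "a \<le> x \<and> \<not> d \<le> x")
      case True
      have "list_cut xs e = of_bool False"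
        if "e \<in> {(a, Some b), (b, Some d), (a, Some c), (c, Some d)}" for e
        using that Cons.prems True by (cases p1; cases p2; cases p3; cases p4) (auto split: if_splits)
      then have "(\<Sum>x\<leftarrow>xs. h x) = 0" using Cons.IH[of False False False False] by simp
      then show ?thesis using Cons.prems True ord
        by (cases p1; cases p2; cases p3; cases p4) (auto simp: h_def split: if_splits)
    next
      case False
      then have "h x = 0" using ord by (auto simp: h_def)
      moreover have "(\<Sum>x\<leftarrow>xs. h x) = of_bool (p2 \<and> p3)"
      proof -
        have "\<not> cut x (a, Some b)" "\<not> cut x (b, Some d)" "\<not> cut x (a, Some c)" "\<not> cut x (c, Some d)"
          unfolding cut_simps using False ord by blast+
        then show ?thesis
          using Cons.prems by (intro Cons.IH[of p1 p2 p3 p4]) (simp_all only: list_cut_simps of_bool_eq add_0 not_False_eq_True)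
      qed
      ultimately show ?thesis by simp
    qed
  qed auto
  have h: "additive_weight h"
    unfolding additive_weight_def
  proof (intro ballI allI impI)
    fix \<beta> xs assume "\<beta> \<in> L" and *: "\<forall>e\<in>E. list_cut xs e = of_bool (cut \<beta> e)"
    have "(\<Sum>x\<leftarrow>xs. h x) = of_bool (cut \<beta> (b, Some d) \<and> cut \<beta> (a, Some c))"
      by (rule sum[of _ "cut \<beta> (a, Some b)" _ _ "cut \<beta> (c, Some d)"]) (use * E4 in auto)
    also have "\<dots> = h \<beta>"
      using le4 by (auto simp: h_def intro: order_trans less_imp_le)
    finally show "h \<beta> = (\<Sum>x\<leftarrow>xs. h x)" by simp
  qed
  have L2: "b \<in> L" "c \<in> L" using J4 J_in_L by auto
  have None: "unit_fun None \<in> aug_span h"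
  proof -
    have "aug_vec h b + aug_vec h c - aug_vec h (sup b c) - aug_vec h (inf b c) \<in> aug_span h"
      using aug_vec_in_span[OF h] L2 supL infL by (intro fun_space.span_add fun_space.span_diff) auto
    moreover have "aug_vec h b + aug_vec h c - aug_vec h (sup b c) - aug_vec h (inf b c) = unit_fun None"
    proof
      fix t show "(aug_vec h b + aug_vec h c - aug_vec h (sup b c) - aug_vec h (inf b c)) t = unit_fun None t"
        using bc J_prime[OF _ L2] by (cases t) (auto simp: h_def unit_fun_def)
    qed
    ultimately show ?thesis by (simp only:)
  qed
  have "card (insert None (Some ` J)) \<le> card (aug_vec h ` B)"
  proof (rule indep_family_card_le)
    show "indep_family (insert None (Some ` J)) (unit_fun :: _ \<Rightarrow> _ \<Rightarrow> rat)"
      by (rule indep_family_unit_fun) simp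
    show "unit_fun ` insert None (Some ` J) \<subseteq> aug_span h"
      using unit_Some_in_span[OF h] None by auto
  qed auto
  also have "\<dots> \<le> card B" by (rule card_image_le) simp
  finally show ?thesis by (simp add: card_image)
qed

text \<open>The join of \<open>S\<close> is described both by \<open>J\<close> and by the join
  irreducibles of \<open>D\<close>, which in general are not join irreducible in
  \<open>L\<close>.\<close>

lemma D_union_below:
  assumes "finite S" "S \<noteq> {}" "S \<subseteq> D"
  shows "\<exists>\<sigma>\<in>D. below \<sigma> = (\<Union>s\<in>S. below s) \<and> (\<forall>b\<in>join_irreducibles D. b \<le> \<sigma> \<longrightarrow> (\<exists>s\<in>S. b \<le> s))"
  using assms
proof (induction S rule: finite_ne_induct)
  case (insert s S)
  then obtain \<sigma> where \<sigma>: "\<sigma> \<in> D" "below \<sigma> = (\<Union>s\<in>S. below s)"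
    "\<forall>b\<in>join_irreducibles D. b \<le> \<sigma> \<longrightarrow> (\<exists>s\<in>S. b \<le> s)" by auto
  have "s \<in> D" using insert by auto
  then have "below (sup s \<sigma>) = (\<Union>s\<in>insert s S. below s)"
    using below_sup[of s \<sigma>] \<sigma> D_subset by auto
  moreover have "\<exists>s'\<in>insert s S. b \<le> s'" if "b \<in> join_irreducibles D" "b \<le> sup s \<sigma>" for b
    using that D.J_prime[OF that(1) \<open>s \<in> D\<close> \<sigma>(1)] \<sigma>(3) by blast
  ultimately show ?case using D.supL[OF \<open>s \<in> D\<close> \<sigma>(1)] by blast
qed auto

text \<open>If every edge can be cut alone, irreducible cuts are single edges. Then the ideal
  vectors of \<open>B\<close> are independent: pairing with its edge isolates each \<open>b\<close>
  outside \<open>D\<close>, and inside \<open>D\<close> maximal elements are split off one at a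
  time.\<close>

lemma card_B_le_card_J:
  assumes single: "\<And>e. e \<in> E \<Longrightarrow> \<exists>\<alpha>\<in>L. Cut \<alpha> = {e}"
  shows "card B \<le> card J"
proof -
  have Cut_B: "\<exists>e\<in>E. Cut b = {e}" if b: "b \<in> B" "b \<notin> D" for b
  proof (rule ccontr)
    assume no: "\<not> (\<exists>e\<in>E. Cut b = {e})"
    define \<alpha> where "\<alpha> e = (SOME \<alpha>. \<alpha> \<in> L \<and> Cut \<alpha> = {e})" for e
    have \<alpha>: "\<alpha> e \<in> L \<and> Cut (\<alpha> e) = {e}" if "e \<in> E" for e
      unfolding \<alpha>_def by (rule someI_ex) (use single[OF that] in blast)
    obtain es where es: "set es = Cut b" "distinct es" using finite_distinct_list[OF finite_Cut] by blast
    have CE: "Cut b \<subseteq> E" by (auto simp: Cut_def)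
    have "list_cut (map \<alpha> es) e = of_bool (cut b e)" if e: "e \<in> E" for e
    proof -
      have "cut (\<alpha> e') e \<longleftrightarrow> e = e'" if "e' \<in> set es" for e'
        using \<alpha>[of e'] that es(1) CE e by (auto simp: Cut_def)
      then have "list_cut (map \<alpha> es) e = length (filter ((=) e) es)"
        by (simp add: list_cut_def filter_map comp_def cong: filter_cong)
      also have "\<dots> = of_bool (e \<in> set es)"
        using es(2) by (induction es) auto
      finally show ?thesis using es(1) e by (simp add: Cut_def)
    qed
    moreover have "set (map \<alpha> es) \<subseteq> L" using \<alpha> es(1) CE by auto
    moreover have "\<forall>x\<in>set (map \<alpha> es). Cut x \<subset> Cut b"
    proof
      fix x assume "x \<in> set (map \<alpha> es)"
      then obtain e where e: "e \<in> Cut b" "x = \<alpha> e" using es(1) by auto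
      then have "e \<in> E" using CE by blast
      then have "Cut x = {e}" using \<alpha> e(2) by blast
      moreover have "Cut b \<noteq> {e}" using no \<open>e \<in> E\<close> by auto
      ultimately show "Cut x \<subset> Cut b" using e(1) by auto
    qed
    ultimately have "\<not> irreducible_cut b" unfolding irreducible_cut_def by blast
    then show False using B_not_D[OF b] by blast
  qed
  define f where "f b z = (of_bool (z \<in> J \<and> z \<le> b) :: rat)" for b z
  have indep: "indep_family B f"
    unfolding indep_family_def
  proof (intro allI impI)
    fix c assume zero: "\<forall>z. (\<Sum>b\<in>B. c b * f b z) = 0"
    have c0: "c b = 0" if b: "b \<in> B" "b \<notin> D" for b
    proof -
      obtain e where e: "e \<in> E" "Cut b = {e}" using Cut_B[OF b] by blast
      have "(\<Sum>b\<in>B. c b * of_bool (cut b e)) = 0"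
      proof -
        from e(1) E_edges have "e \<in> edges" by blast
        then show ?thesis
        proof (cases rule: edges_cases)
          case (top x)
          then show ?thesis using zero[THEN spec[of _ x]] by (simp add: f_def)
        next
          case (cover x y)
          have "of_bool (cut b e) = f b x - f b y" for b
            using cover by (auto simp: f_def)
          then show ?thesis using zero by (simp add: right_diff_distrib sum_subtractf)
        qed
      qed
      moreover have "(\<Sum>b'\<in>B. c b' * of_bool (cut b' e)) = (\<Sum>b'\<in>{b}. c b' * of_bool (cut b' e))"
      proof (rule sum.mono_neutral_right)
        show "\<forall>b'\<in>B - {b}. c b' * of_bool (cut b' e) = 0"
        proof
          fix b' assume b': "b' \<in> B - {b}"
          have "\<not> cut b' e"
          proof
            assume "cut b' e"
            then have "e \<in> Cut b'" "b' \<notin> D" using e(1) by (auto simp: Cut_def D_def)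
            then have "Cut b' = {e}" using Cut_B[of b'] b' by auto
            then show False using B_eq_if_Cut_eq[of b b'] b b' \<open>b' \<notin> D\<close> e(2) by auto
          qed
          then show "c b' * of_bool (cut b' e) = 0" by simp
        qed
      qed (use b in auto)
      moreover have "cut b e" using e(2) by (auto simp: Cut_def)
      ultimately show ?thesis by simp
    qed
    have "indep_family (B \<inter> D) f"
    proof (rule indep_family_triangular)
      fix I' assume I': "I' \<subseteq> B \<inter> D" "I' \<noteq> {}"
      obtain b where b: "b \<in> I'" "\<forall>j\<in>I'. b \<le> j \<longrightarrow> b = j"
        using finite_has_maximal[OF finite_subset[OF I'(1)] I'(2)] by auto
      have bD: "b \<in> D" "b \<in> join_irreducibles D" using b(1) I'(1) B_D by auto
      \<comment> \<open>Otherwise \<open>b\<close> would lie below the join of the other elements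
        and, being prime in \<open>D\<close>, below one of them.\<close>
      have "\<not> below b \<subseteq> (\<Union>s\<in>I' - {b}. below s)"
      proof
        assume sub: "below b \<subseteq> (\<Union>s\<in>I' - {b}. below s)"
        have ne: "I' - {b} \<noteq> {}" using sub bt_below[of b] bD(1) D_subset by auto
        have "finite (I' - {b})" "I' - {b} \<subseteq> D"
          using I'(1) finite_subset[OF I'(1)] by auto
        from D_union_below[OF this(1) ne this(2)]
        obtain \<sigma> where \<sigma>: "\<sigma> \<in> D" "below \<sigma> = (\<Union>s\<in>I' - {b}. below s)"
          "\<forall>c\<in>join_irreducibles D. c \<le> \<sigma> \<longrightarrow> (\<exists>s\<in>I' - {b}. c \<le> s)"
          by auto
        have "b \<le> \<sigma>" using le_iff_below[of b \<sigma>] bD(1) \<sigma>(1,2) sub D_subset by blast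
        then obtain s where "s \<in> I' - {b}" "b \<le> s" using \<sigma>(3) bD(2) by blast
        then show False using b(2) by blast
      qed
      then obtain z where z: "z \<in> below b" "\<And>s. s \<in> I' \<Longrightarrow> s \<noteq> b \<Longrightarrow> z \<notin> below s" by blast
      have "f b z \<noteq> 0 \<and> (\<forall>j\<in>I'. j \<noteq> b \<longrightarrow> f j z = 0)"
        using z by (auto simp: f_def below_def)
      then show "\<exists>i\<in>I'. \<exists>x. f i x \<noteq> 0 \<and> (\<forall>j\<in>I'. j \<noteq> i \<longrightarrow> f j x = 0)" using b(1) by blast
    qed simp
    moreover have "(\<Sum>b\<in>B \<inter> D. c b * f b z) = 0" for z
    proof -
      have "(\<Sum>b\<in>B \<inter> D. c b * f b z) = (\<Sum>b\<in>B. c b * f b z)"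
        by (rule sum.mono_neutral_left) (use c0 in auto)
      then show ?thesis using zero by simp
    qed
    ultimately have "\<forall>b\<in>B \<inter> D. c b = 0" unfolding indep_family_def by blast
    then show "\<forall>b\<in>B. c b = 0" using c0 by blast
  qed
  have "f ` B \<subseteq> fun_space.span (unit_fun ` J)"
    by (auto simp: f_def intro!: finite_support_span_unit_fun)
  from indep_family_card_le[OF finite_B indep this]
  have "card B \<le> card (unit_fun ` J :: ('a \<Rightarrow> rat) set)" by simp
  also have "\<dots> \<le> card J" by (rule card_image_le) simp
  finally show ?thesis .
qed

text \<open>Within \<open>D\<close> the modular relations can be solved because \<open>P\<close>
  does not vanish there. Off \<open>D\<close>, straightening over the dual numbers equates the value
  at \<open>\<beta>\<close> times a unit with a product that has a zero factor.\<close>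

lemma tangent_determined_by_B:
  assumes \<chi>: "modular_mult L \<chi>" "\<And>\<alpha>. \<alpha> \<in> L \<Longrightarrow> \<chi> \<alpha> \<noteq> 0"
    and v: "v \<in> orbit_tangent (orbit_pt \<chi>)" "\<And>b. b \<in> B \<Longrightarrow> v b = 0"
  shows "v = 0"
proof -
  define P where "P = orbit_pt \<chi>"
  have P: "P \<delta> \<noteq> 0" if "\<delta> \<in> D" for \<delta> using that \<chi>(2) D_subset by (auto simp: P_def orbit_pt_def)
  have vP: "v \<in> orbit_tangent P" using v(1) by (simp add: P_def)
  have vD: "v \<delta> = 0" if "\<delta> \<in> D" for \<delta>
    using that
  proof (induction \<delta> rule: D.join_induct)
    case (irreducible z)
    then show ?case using v(2) by (auto simp: B_def)
  next
    case (join a b)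
    have lt: "a < sup a b" "b < sup a b" using join(3,4) by (simp_all add: less_le)
    then have "inf a b < sup a b" by (metis inf.cobounded1 order.strict_trans1)
    then have "v a = 0" "v b = 0" "v (inf a b) = 0" using join lt D.infL by blast+
    moreover have "a \<in> L" "b \<in> L" using join D_subset by auto
    ultimately have "v (sup a b) * P (inf a b) = 0" using orbit_tangentD[OF vP, of a b] by simp
    then show ?case using P[of "inf a b"] D.infL[OF join(1,2)] by simp
  qed
  have modular: "modular_mult L (dual_pt P v)"
    by (rule modular_mult_dual_pt) (simp_all only: P_def modular_orbit_pt[OF \<chi>(1)] orbit_tangentD[OF v(1)])
  have "v \<beta> = 0" if "\<beta> \<in> L" for \<beta>
    using that
  proof (induction \<beta> rule: measure_induct_rule[of "\<lambda>\<beta>. card (Cut \<beta>)"])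
    case (less \<beta>)
    show ?case
    proof (cases "\<beta> \<in> D")
      case False
      then have ne: "Cut \<beta> \<noteq> {}" using in_D_iff less.prems by blast
      \<comment> \<open>Irreducible cuts are represented in \<open>B\<close>, all others decompose
        into smaller cuts. In both cases some entry outside \<open>D\<close> has
        \<open>v x = 0\<close>, and its dual value is zero.\<close>
      have "\<exists>xs. set xs \<subseteq> L \<and> (\<forall>e\<in>E. list_cut xs e = of_bool (cut \<beta> e)) \<and> (\<exists>x\<in>set xs. x \<notin> D \<and> v x = 0)"
      proof (cases "irreducible_cut \<beta>")
        case True
        have r: "rep (Cut \<beta>) \<in> L" "Cut (rep (Cut \<beta>)) = Cut \<beta>" using rep less.prems by auto
        have "rep (Cut \<beta>) \<in> B" using True less.prems by (auto simp: B_def)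
        then have "v (rep (Cut \<beta>)) = 0" by (rule v(2))
        moreover have "rep (Cut \<beta>) \<notin> D" using in_D_iff r ne by auto
        moreover have "\<forall>e\<in>E. list_cut [rep (Cut \<beta>)] e = of_bool (cut \<beta> e)"
          using r(2) unfolding Cut_def by auto
        ultimately show ?thesis using r(1) by (intro exI[of _ "[rep (Cut \<beta>)]"]) auto
      next
        case False
        then obtain xs where xs: "set xs \<subseteq> L" "\<forall>x\<in>set xs. Cut x \<subset> Cut \<beta>"
          "\<forall>e\<in>E. list_cut xs e = of_bool (cut \<beta> e)" unfolding irreducible_cut_def by blast
        obtain e where e: "e \<in> E" "cut \<beta> e" using ne unfolding Cut_def by blast
        then have "list_cut xs e \<noteq> 0" using xs(3) by auto
        then obtain x where x: "x \<in> set xs" "cut x e" by (auto simp: list_cut_def filter_empty_conv)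
        have "v x = 0"
          using less.IH[of x] x(1) xs(1,2) psubset_card_mono[of "Cut \<beta>" "Cut x"] by auto
        moreover have "x \<notin> D" using x(2) e(1) by (auto simp: D_def)
        ultimately show ?thesis using xs x(1) by blast
      qed
      then obtain xs x where xs: "set xs \<subseteq> L" "\<forall>e\<in>E. list_cut xs e = of_bool (cut \<beta> e)"
        and x: "x \<in> set xs" "x \<notin> D" "v x = 0" by blast
      obtain us vs where us: "set us \<subseteq> D" and vs: "set vs \<subseteq> D"
        and char: "\<forall>z\<in>J. list_char ([\<beta>] @ us) z = list_char (xs @ vs) z"
        using balance[of "[\<beta>]" xs] less.prems xs by auto
      have "prod_list (map (dual_pt P v) ([\<beta>] @ us)) = prod_list (map (dual_pt P v) (xs @ vs))"
        by (rule straightening[OF modular]) (use less.prems us vs xs(1) D_subset char in auto)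
      also have "\<dots> = Dual 0 0"
        by (rule prod_list_Dual_0[of x]) (use x in \<open>auto simp: dual_pt_def P_def orbit_pt_def\<close>)
      finally have "dual_pt P v \<beta> * prod_list (map (dual_pt P v) us) = Dual 0 0" by simp
      moreover have "P \<beta> = 0" using False by (simp add: P_def orbit_pt_def)
      ultimately have "v \<beta> * re (prod_list (map (dual_pt P v) us)) = 0"
        by (simp add: times_dual_def dual_pt_def)
      moreover have "re (prod_list (map (dual_pt P v) us)) \<noteq> 0"
        using us P by (auto simp: re_prod_list dual_pt_def prod_list_zero_iff)
      ultimately show ?thesis by simp
    qed (rule vD)
  qed
  moreover have "v \<beta> = 0" if "\<beta> \<notin> L" for \<beta>
    using that v(1) unfolding orbit_tangent_def affine_space_def by blast
  ultimately show "v = 0" by (auto simp: fun_eq_iff)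
qed

theorem dim_orbit_tangent:
  assumes "modular_mult L \<chi>" "\<And>\<alpha>. \<alpha> \<in> L \<Longrightarrow> \<chi> \<alpha> \<noteq> 0"
  shows "fun_space.dim (orbit_tangent (orbit_pt \<chi>)) = card B"
proof (rule antisym)
  show "fun_space.dim (orbit_tangent (orbit_pt \<chi>)) \<le> card B"
    by (rule fun_space_dim_le[OF subspace_orbit_tangent finite_B])
       (use tangent_determined_by_B[OF assms] in blast)
qed (rule card_B_le_dim_tangent[OF assms])

end

section \<open>Faces and orbits\<close>

definition edge_vec :: "'a edge \<Rightarrow> 'a \<Rightarrow> real" where
  "edge_vec e = unit_vec (fst e) - (case snd e of None \<Rightarrow> 0 | Some y \<Rightarrow> unit_vec y)"

context closed_face
begin

text \<open>Outside the component of \<open>e\<close> in the graph \<open>E\<close>, the ideal of \<open>\<kappa>\<close> is replaced by all or nothing,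
  so that no other edge of \<open>E\<close> is cut.\<close>

lemma single_cut:
  assumes e: "e \<in> E" "cut \<kappa> e"
    and unique: "\<And>e'. e' \<in> E \<Longrightarrow> cut \<kappa> e' \<Longrightarrow> (\<And>\<delta>. \<delta> \<in> D \<Longrightarrow> fst e \<le> \<delta> \<longleftrightarrow> fst e' \<le> \<delta>) \<Longrightarrow> e' = e"
  shows "\<exists>\<alpha>\<in>L. Cut \<alpha> = {e}"
proof -
  define x where "x = fst e"
  \<comment> \<open>The component is recognised through \<open>D\<close>: \<open>z\<close> is put in
    if some \<open>\<delta>\<close> contains it without \<open>x\<close>; failing that, it is left
    out if some \<open>\<delta>\<close> contains \<open>x\<close> without it; otherwise
    \<open>\<kappa>\<close> decides.\<close>
  define S where "S = {z\<in>J. (\<exists>\<delta>\<in>D. \<not> x \<le> \<delta> \<and> z \<le> \<delta>) \<or> (z \<le> \<kappa> \<and> (\<forall>\<delta>\<in>D. x \<le> \<delta> \<longrightarrow> z \<le> \<delta>))}"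
  have EJ: "fst e' \<in> J" "\<And>y. snd e' = Some y \<Longrightarrow> y \<in> J \<and> fst e' < y" if "e' \<in> E" for e'
    using that E_edges by (auto simp: edges_def covers_in_def)
  have cut_iff: "cut \<alpha> e' \<longleftrightarrow> fst e' \<le> \<alpha> \<and> (\<forall>y. snd e' = Some y \<longrightarrow> \<not> y \<le> \<alpha>)" for \<alpha> e'
    by (simp add: cut_def split: option.split)
  have uncut: "\<exists>y. snd e' = Some y \<and> y \<le> \<delta>" if "e' \<in> E" "\<delta> \<in> D" "fst e' \<le> \<delta>" for e' \<delta>
    using that unfolding D_def cut_iff by blast
  have xS: "x \<in> S" using EJ(1)[OF e(1)] e(2) by (auto simp: S_def x_def cut_iff)
  have "\<exists>\<alpha>\<in>L. below \<alpha> = S"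
  proof (rule ideal_realized)
    show "S \<subseteq> J" by (auto simp: S_def)
    show "S \<noteq> {}" using xS by blast
    fix y z assume "z \<in> S" "y \<in> J" "y \<le> z"
    then show "y \<in> S" unfolding S_def using order_trans by blast
  qed
  then obtain \<alpha> where \<alpha>: "\<alpha> \<in> L" "below \<alpha> = S" by blast
  have le: "z \<le> \<alpha> \<longleftrightarrow> z \<in> S" if "z \<in> J" for z using \<alpha>(2) that unfolding below_def by blast
  have "y \<notin> S" if "snd e = Some y" for y
    using e(2) that EJ(2)[OF e(1) that] unfolding S_def cut_iff x_def
    by (auto intro: order_trans less_imp_le)
  then have cut_e: "cut \<alpha> e" using xS le EJ[OF e(1)] by (auto simp: cut_iff x_def)
  have only: "e' = e" if e': "e' \<in> E" "cut \<alpha> e'" for e'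
  proof -
    have x': "fst e' \<in> S" using e' le EJ(1)[OF e'(1)] by (simp add: cut_iff)
    have t': "y \<notin> S" if "snd e' = Some y" for y using that e' le EJ(2)[OF e'(1) that] by (auto simp: cut_iff)
    have up: "x \<le> \<delta>" if \<delta>: "\<delta> \<in> D" "fst e' \<le> \<delta>" for \<delta>
    proof (rule ccontr)
      assume "\<not> x \<le> \<delta>"
      obtain y where y: "snd e' = Some y" "y \<le> \<delta>" using uncut[OF e'(1) \<delta>] by blast
      then have "y \<in> S" using EJ(2)[OF e'(1)] \<open>\<not> x \<le> \<delta>\<close> \<delta>(1) unfolding S_def by blast
      then show False using t' y(1) by blast
    qed
    then have x'\<kappa>: "fst e' \<le> \<kappa>" "\<And>\<delta>. \<delta> \<in> D \<Longrightarrow> x \<le> \<delta> \<Longrightarrow> fst e' \<le> \<delta>"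
      using x' unfolding S_def by blast+
    have "\<not> y \<le> \<kappa>" if y: "snd e' = Some y" for y
    proof
      assume "y \<le> \<kappa>"
      moreover have "y \<le> \<delta>" if "\<delta> \<in> D" "x \<le> \<delta>" for \<delta>
        using uncut[OF e'(1) that(1) x'\<kappa>(2)[OF that]] y by simp
      ultimately have "y \<in> S" using EJ(2)[OF e'(1) y] unfolding S_def by blast
      then show False using t' y by blast
    qed
    then have "cut \<kappa> e'" using x'\<kappa>(1) by (simp add: cut_iff)
    then show ?thesis by (rule unique[OF e'(1)]) (use up x'\<kappa>(2) in \<open>auto simp: x_def\<close>)
  qed
  have "Cut \<alpha> = {e}" using only e(1) cut_e unfolding Cut_def by blast
  then show ?thesis using \<alpha>(1) by blast
qed

end

section \<open>Faces of the cone, their edges and their sublattices\<close>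

context hibi
begin

lemma edge_vec_simps [simp]:
  "edge_vec (x, None) = unit_vec x" "edge_vec (x, Some y) = unit_vec x - unit_vec y"
  by (auto simp: edge_vec_def)

lemma cone_generators_eq: "cone_generators L = edge_vec ` edges"
proof -
  have "edge_vec ` {(z, None) | z. P z} = {edge_vec (z, None) | z. P z}"
    "edge_vec ` {(x, Some y) | x y. Q x y} = {edge_vec (x, Some y) | y x. Q x y}" for P Q :: "'a \<Rightarrow> _"
    by blast+
  then show ?thesis unfolding cone_generators_def edges_def Let_def image_Un by simp
qed

lemma finite_cone_generators [simp]: "finite (cone_generators L)"
  by (simp add: cone_generators_eq)

lemma pairing_edge_vec: "e \<in> edges \<Longrightarrow> pairing L u (edge_vec e) = ediff u e"
proof -
  have *: "(\<Sum>z\<in>J. u z * unit_vec x z) = u x" if "x \<in> J" for x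
  proof -
    have "(\<Sum>z\<in>J. u z * unit_vec x z) = (\<Sum>z\<in>J. if z = x then u z else 0)"
      by (intro sum.cong) (auto simp: unit_vec_def)
    then show ?thesis using that by simp
  qed
  assume "e \<in> edges"
  then show ?thesis
    by (cases rule: edges_cases) (auto simp: pairing_def right_diff_distrib sum_subtractf *)
qed

lemma pairing_combination:
  "pairing L u (\<lambda>z. \<Sum>g\<in>G. c g * g z) = (\<Sum>g\<in>G. c g * pairing L u g)"
proof -
  have "pairing L u (\<lambda>z. \<Sum>g\<in>G. c g * g z) = (\<Sum>z\<in>J. \<Sum>g\<in>G. u z * (c g * g z))"
    by (simp add: pairing_def sum_distrib_left)
  also have "\<dots> = (\<Sum>g\<in>G. \<Sum>z\<in>J. u z * (c g * g z))" by (rule sum.swap)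
  finally show ?thesis by (simp add: pairing_def sum_distrib_left mult_ac)
qed

lemma hibi_coneE:
  assumes "v \<in> hibi_cone L"
  obtains c where "\<And>g. g \<in> cone_generators L \<Longrightarrow> 0 \<le> c g"
    and "\<And>u. pairing L u v = (\<Sum>g\<in>cone_generators L. c g * pairing L u g)"
  using assms pairing_combination unfolding hibi_cone_def by blast

lemma edge_vec_in_cone: "e \<in> edges \<Longrightarrow> edge_vec e \<in> hibi_cone L"
proof -
  assume e: "e \<in> edges"
  define c where "c g = (of_bool (g = edge_vec e) :: real)" for g
  have "edge_vec e = (\<lambda>z. \<Sum>g\<in>cone_generators L. c g * g z)"
  proof
    fix z
    have "(\<Sum>g\<in>cone_generators L. c g * g z) = (\<Sum>g\<in>cone_generators L. if g = edge_vec e then g z else 0)"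
      by (intro sum.cong) (auto simp: c_def)
    then show "edge_vec e z = (\<Sum>g\<in>cone_generators L. c g * g z)"
      using e by (simp add: cone_generators_eq)
  qed
  moreover have "\<forall>g\<in>cone_generators L. 0 \<le> c g" by (simp add: c_def)
  ultimately show ?thesis unfolding hibi_cone_def mem_Collect_eq by (intro exI[of _ c] conjI)
qed

lemma hibi_cone_add: "v \<in> hibi_cone L \<Longrightarrow> w \<in> hibi_cone L \<Longrightarrow> v + w \<in> hibi_cone L"
proof -
  assume "v \<in> hibi_cone L" "w \<in> hibi_cone L"
  then obtain c c' where "\<forall>g\<in>cone_generators L. 0 \<le> c g" "v = (\<lambda>z. \<Sum>g\<in>cone_generators L. c g * g z)"
    "\<forall>g\<in>cone_generators L. 0 \<le> c' g" "w = (\<lambda>z. \<Sum>g\<in>cone_generators L. c' g * g z)"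
    unfolding hibi_cone_def by blast
  then have "\<forall>g\<in>cone_generators L. 0 \<le> c g + c' g"
    "v + w = (\<lambda>z. \<Sum>g\<in>cone_generators L. (c g + c' g) * g z)"
    by (auto simp: sum.distrib distrib_right fun_eq_iff)
  then show ?thesis unfolding hibi_cone_def mem_Collect_eq by (intro exI[of _ "\<lambda>g. c g + c' g"] conjI)
qed

definition ideal_real :: "'a \<Rightarrow> 'a \<Rightarrow> real" where
  "ideal_real \<alpha> z = of_int (ideal_vec L \<alpha> z)"

lemma ediff_ideal_real: "e \<in> edges \<Longrightarrow> ediff (ideal_real \<alpha>) e = of_bool (cut \<alpha> e)"
  by (cases rule: edges_cases) (auto simp: ideal_real_def ideal_vec_def)

lemma pairing_ideal_nonneg: "v \<in> hibi_cone L \<Longrightarrow> 0 \<le> pairing L (ideal_real \<alpha>) v"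
  by (elim hibi_coneE)
     (auto simp: cone_generators_eq pairing_edge_vec ediff_ideal_real intro!: sum_nonneg)

definition face_edges :: "('a \<Rightarrow> real) set \<Rightarrow> 'a edge set" where
  "face_edges \<tau> = {e\<in>edges. edge_vec e \<in> \<tau>}"

definition face_lattice :: "('a \<Rightarrow> real) set \<Rightarrow> 'a set" where
  "face_lattice \<tau> = {\<alpha>\<in>L. \<forall>v\<in>\<tau>. pairing L (ideal_real \<alpha>) v = 0}"

lemma ideal_vec_perp_iff: "ideal_vec L \<alpha> \<in> perp L \<tau> \<longleftrightarrow> (\<forall>v\<in>\<tau>. pairing L (ideal_real \<alpha>) v = 0)"
  by (auto simp: perp_def ideal_vec_def ideal_real_def[abs_def])

lemma face_point_eq: "face_point L \<tau> \<alpha> = of_bool (\<alpha> \<in> face_lattice \<tau>)"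
  by (simp add: face_point_def face_lattice_def ideal_vec_perp_iff)

lemma face_sublattice_eq: "face_sublattice K L \<tau> = face_lattice \<tau>"
  by (auto simp: face_sublattice_def face_point_eq face_lattice_def)

context
  fixes \<tau> u
  assumes u: "u \<in> dual_cone L" and \<tau>: "\<tau> = {v\<in>hibi_cone L. pairing L u v = 0}"
begin

lemma ediff_u_nonneg: "e \<in> edges \<Longrightarrow> 0 \<le> ediff u e"
  using u edge_vec_in_cone pairing_edge_vec unfolding dual_cone_def by fastforce

lemma face_edges_iff: "e \<in> edges \<Longrightarrow> e \<in> face_edges \<tau> \<longleftrightarrow> ediff u e = 0"
  using edge_vec_in_cone by (simp add: face_edges_def \<tau> pairing_edge_vec)

lemma face_edges_uncut_lattice:
  "face_lattice \<tau> = {\<alpha>\<in>L. \<forall>e\<in>face_edges \<tau>. \<not> cut \<alpha> e}"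
proof (intro equalityI subsetI)
  fix \<alpha> assume \<alpha>: "\<alpha> \<in> face_lattice \<tau>"
  have "\<not> cut \<alpha> e" if e: "e \<in> face_edges \<tau>" for e
  proof -
    have "e \<in> edges" "edge_vec e \<in> \<tau>" using e by (auto simp: face_edges_def)
    then have "ediff (ideal_real \<alpha>) e = 0" using \<alpha> by (auto simp: face_lattice_def simp flip: pairing_edge_vec)
    then show ?thesis using ediff_ideal_real[OF \<open>e \<in> edges\<close>, of \<alpha>] by simp
  qed
  then show "\<alpha> \<in> {\<alpha>\<in>L. \<forall>e\<in>face_edges \<tau>. \<not> cut \<alpha> e}" using \<alpha> by (simp add: face_lattice_def)
next
  fix \<alpha> assume \<alpha>: "\<alpha> \<in> {\<alpha>\<in>L. \<forall>e\<in>face_edges \<tau>. \<not> cut \<alpha> e}"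
  have "pairing L (ideal_real \<alpha>) v = 0" if v: "v \<in> \<tau>" for v
  proof -
    have "v \<in> hibi_cone L" using v by (simp add: \<tau>)
    then obtain c where c: "\<And>g. g \<in> cone_generators L \<Longrightarrow> 0 \<le> c g"
      "\<And>u. pairing L u v = (\<Sum>g\<in>cone_generators L. c g * pairing L u g)" by (rule hibi_coneE) blast
    have "(\<Sum>g\<in>cone_generators L. c g * pairing L u g) = 0" using v c(2)[of u] by (simp add: \<tau>)
    then have zero: "\<forall>g\<in>cone_generators L. c g * pairing L u g = 0"
      by (subst (asm) sum_nonneg_eq_0_iff)
         (use c(1) ediff_u_nonneg in \<open>auto simp: cone_generators_eq pairing_edge_vec\<close>)
    have "c g * pairing L (ideal_real \<alpha>) g = 0" if g: "g \<in> cone_generators L" for g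
    proof -
      obtain e where e: "e \<in> edges" "g = edge_vec e" using g by (auto simp: cone_generators_eq)
      show ?thesis
      proof (cases "e \<in> face_edges \<tau>")
        case True
        then show ?thesis using \<alpha> e by (simp add: pairing_edge_vec ediff_ideal_real)
      next
        case False
        then have "pairing L u g \<noteq> 0" using e face_edges_iff by (simp add: pairing_edge_vec)
        then show ?thesis using bspec[OF zero g] by simp
      qed
    qed
    then show ?thesis unfolding c(2) by (rule sum.neutral[OF ballI])
  qed
  then show "\<alpha> \<in> face_lattice \<tau>" using \<alpha> by (simp add: face_lattice_def)
qed

text \<open>The upper level set of \<open>u\<close> at height \<open>u (fst e)\<close> is an ideal.
  It cuts \<open>e\<close>, where \<open>u\<close> drops, and no edge of the face: there
  \<open>u\<close> is constant, or \<open>0\<close> below the positive height if the edge ends in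
  \<open>None\<close>.\<close>

lemma face_lattice_cuts:
  assumes e: "e \<in> edges" "e \<notin> face_edges \<tau>"
  shows "\<exists>\<delta>\<in>face_lattice \<tau>. cut \<delta> e"
proof -
  have pos: "0 < ediff u e" using ediff_u_nonneg[OF e(1)] e face_edges_iff by fastforce
  have xJ: "fst e \<in> J" using e(1) by (auto simp: edges_def covers_in_def)
  have u_pos: "0 < u (fst e)"
    using e(1)
  proof (cases rule: edges_cases)
    case (cover x y)
    then show ?thesis using pos nonneg_on_J[of u y] ediff_u_nonneg by fastforce
  qed (use pos in auto)
  have "\<exists>\<alpha>\<in>L. below \<alpha> = {z\<in>J. u (fst e) \<le> u z}"
  proof (rule ideal_realized)
    fix y z assume "z \<in> {z \<in> J. u (fst e) \<le> u z}" "y \<in> J" "y \<le> z"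
    then show "y \<in> {z \<in> J. u (fst e) \<le> u z}" using antitone_on_J[of u y z] ediff_u_nonneg by force
  next
    show "{z\<in>J. u (fst e) \<le> u z} \<noteq> {}" using xJ by blast
  qed auto
  then obtain \<delta> where \<delta>: "\<delta> \<in> L" "below \<delta> = {z\<in>J. u (fst e) \<le> u z}" by blast
  have le: "z \<le> \<delta> \<longleftrightarrow> u (fst e) \<le> u z" if "z \<in> J" for z using \<delta>(2) that unfolding below_def by blast
  have "cut \<delta> e" using e(1) pos by (cases rule: edges_cases) (auto simp: le)
  moreover have "\<not> cut \<delta> e'" if e': "e' \<in> face_edges \<tau>" for e'
  proof -
    have edge: "e' \<in> edges" using e' by (simp add: face_edges_def)
    then have "ediff u e' = 0" using face_edges_iff e' by blast
    with edge show ?thesis using u_pos by (cases rule: edges_cases) (auto simp: le)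
  qed
  ultimately show ?thesis using \<delta>(1) face_edges_uncut_lattice by blast
qed

lemma closed_face_face: "closed_face L (face_edges \<tau>) (face_lattice \<tau>)"
proof
  show "face_edges \<tau> = {e\<in>edges. \<forall>\<delta>\<in>face_lattice \<tau>. \<not> cut \<delta> e}"
  proof (intro equalityI subsetI)
    fix e assume "e \<in> face_edges \<tau>"
    then show "e \<in> {e\<in>edges. \<forall>\<delta>\<in>face_lattice \<tau>. \<not> cut \<delta> e}"
      using face_edges_uncut_lattice unfolding face_edges_def by blast
  qed (use face_lattice_cuts in blast)
qed (rule face_edges_uncut_lattice)

text \<open>A face is recovered from its sublattice: every generator off the face is cut by some
  \<open>\<delta>\<close>, so its coefficient in \<open>v\<close> must vanish. This yields the
  uniqueness behind \<open>sigma_ij\<close> and the inclusion test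
  \<open>subface_iff\<close>.\<close>

lemma face_eq_lattice_perp:
  "\<tau> = {v\<in>hibi_cone L. \<forall>\<alpha>\<in>face_lattice \<tau>. pairing L (ideal_real \<alpha>) v = 0}"
proof (intro equalityI subsetI)
  fix v assume v: "v \<in> {v\<in>hibi_cone L. \<forall>\<alpha>\<in>face_lattice \<tau>. pairing L (ideal_real \<alpha>) v = 0}"
  then have "v \<in> hibi_cone L" by simp
  then obtain c where c: "\<And>g. g \<in> cone_generators L \<Longrightarrow> 0 \<le> c g"
    "\<And>u. pairing L u v = (\<Sum>g\<in>cone_generators L. c g * pairing L u g)" by (rule hibi_coneE) blast
  have "c g * pairing L u g = 0" if g: "g \<in> cone_generators L" for g
  proof -
    obtain e where e: "e \<in> edges" "g = edge_vec e" using g by (auto simp: cone_generators_eq)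
    show ?thesis
    proof (cases "e \<in> face_edges \<tau>")
      case True
      then show ?thesis using face_edges_iff e by (simp add: pairing_edge_vec)
    next
      case False
      then obtain \<delta> where \<delta>: "\<delta> \<in> face_lattice \<tau>" "cut \<delta> e" using face_lattice_cuts e by blast
      have "(\<Sum>g\<in>cone_generators L. c g * pairing L (ideal_real \<delta>) g) = 0"
        using v \<delta>(1) c(2)[of "ideal_real \<delta>"] by simp
      then have "\<forall>g\<in>cone_generators L. c g * pairing L (ideal_real \<delta>) g = 0"
        by (subst (asm) sum_nonneg_eq_0_iff)
           (use c(1) in \<open>auto simp: cone_generators_eq pairing_edge_vec ediff_ideal_real\<close>)
      then have "c g * of_bool (cut \<delta> e) = 0" using g e by (auto simp: pairing_edge_vec ediff_ideal_real)
      then show ?thesis using \<delta>(2) by simp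
    qed
  qed
  then have "pairing L u v = 0" unfolding c(2) by (rule sum.neutral[OF ballI])
  then show "v \<in> \<tau>" using v by (simp add: \<tau>)
qed (auto simp: \<tau> face_lattice_def)

end

lemma closed_face_cone_face: "cone_face L \<tau> \<Longrightarrow> closed_face L (face_edges \<tau>) (face_lattice \<tau>)"
  unfolding cone_face_def using closed_face_face by blast

lemma cone_face_eq:
  "cone_face L \<tau> \<Longrightarrow> \<tau> = {v\<in>hibi_cone L. \<forall>\<alpha>\<in>face_lattice \<tau>. pairing L (ideal_real \<alpha>) v = 0}"
  unfolding cone_face_def by (elim bexE) (rule face_eq_lattice_perp)

text \<open>The supporting functional is the sum of the ideal vectors of \<open>D\<close>. All
  summands are nonnegative on the cone, so the sum vanishes only where each of them does.\<close>

lemma ex_cone_face: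
  assumes D: "D \<subseteq> L"
    and sep: "\<And>\<beta>. \<beta> \<in> L \<Longrightarrow> \<beta> \<notin> D \<Longrightarrow> \<exists>v\<in>hibi_cone L.
      (\<forall>\<alpha>\<in>D. pairing L (ideal_real \<alpha>) v = 0) \<and> pairing L (ideal_real \<beta>) v \<noteq> 0"
  shows "\<exists>\<tau>. cone_face L \<tau> \<and> face_lattice \<tau> = D"
proof -
  have fD: "finite D" using D fin finite_subset by blast
  define u where "u z = (\<Sum>\<alpha>\<in>D. ideal_real \<alpha> z)" for z
  define \<tau> where "\<tau> = {v\<in>hibi_cone L. pairing L u v = 0}"
  have u: "pairing L u v = (\<Sum>\<alpha>\<in>D. pairing L (ideal_real \<alpha>) v)" for v
    unfolding pairing_def u_def sum_distrib_right by (rule sum.swap)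
  have zero: "(\<forall>\<alpha>\<in>D. pairing L (ideal_real \<alpha>) v = 0) \<longleftrightarrow> pairing L u v = 0" if "v \<in> hibi_cone L" for v
    unfolding u by (subst sum_nonneg_eq_0_iff[OF fD]) (use pairing_ideal_nonneg[OF that] in auto)
  have "u z = 0" if "z \<notin> J" for z using that by (simp add: u_def ideal_real_def ideal_vec_def)
  then have "u \<in> dual_cone L"
    unfolding dual_cone_def using pairing_ideal_nonneg by (auto simp: u intro!: sum_nonneg)
  then have "cone_face L \<tau>" unfolding cone_face_def \<tau>_def by blast
  moreover have "face_lattice \<tau> = D"
  proof (intro equalityI subsetI)
    fix \<beta> assume \<beta>: "\<beta> \<in> face_lattice \<tau>"
    show "\<beta> \<in> D"
    proof (rule ccontr)
      assume "\<beta> \<notin> D"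
      then obtain v where v: "v \<in> hibi_cone L" "\<forall>\<alpha>\<in>D. pairing L (ideal_real \<alpha>) v = 0"
        "pairing L (ideal_real \<beta>) v \<noteq> 0" using sep[of \<beta>] \<beta> by (auto simp: face_lattice_def)
      then have "v \<in> \<tau>" using zero unfolding \<tau>_def by blast
      then show False using \<beta> v(3) by (auto simp: face_lattice_def)
    qed
  next
    fix \<alpha> assume "\<alpha> \<in> D"
    then show "\<alpha> \<in> face_lattice \<tau>" using D zero unfolding \<tau>_def face_lattice_def by blast
  qed
  ultimately show ?thesis by blast
qed

lemma subface_iff:
  assumes "cone_face L \<sigma>" "cone_face L \<tau>"
  shows "\<sigma> \<subseteq> \<tau> \<longleftrightarrow> face_lattice \<tau> \<subseteq> face_lattice \<sigma>"
proof
  assume "\<sigma> \<subseteq> \<tau>"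
  then show "face_lattice \<tau> \<subseteq> face_lattice \<sigma>" unfolding face_lattice_def by blast
next
  assume *: "face_lattice \<tau> \<subseteq> face_lattice \<sigma>"
  show "\<sigma> \<subseteq> \<tau>"
    by (subst cone_face_eq[OF assms(1)], subst cone_face_eq[OF assms(2)]) (use * in blast)
qed

section \<open>Smoothness at the points of an orbit\<close>

lemma torus_char_ideal_vec: "torus_char L (ideal_vec L \<alpha>) t = (\<Prod>z\<in>below \<alpha>. t z)"
proof -
  have "torus_char L (ideal_vec L \<alpha>) t = (\<Prod>z\<in>J. if z \<le> \<alpha> then t z else 1)"
    unfolding torus_char_def by (intro prod.cong) (auto simp: ideal_vec_def)
  then show ?thesis by (simp add: below_def prod.inter_filter)
qed

lemma face_orbit_ne: "face_orbit L \<tau> \<noteq> {}"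
proof -
  have "(\<lambda>_. 1) \<in> torus L" by (simp add: torus_def)
  then show ?thesis unfolding face_orbit_def by blast
qed

lemma smooth_at_iff:
  fixes P :: "'a \<Rightarrow> 'k::alg_closed_field"
  assumes F: "closed_face L (face_edges \<tau>) (face_lattice \<tau>)" and P: "P \<in> face_orbit L \<tau>"
  shows "smooth_at L (hibi_variety L) P \<longleftrightarrow> card (closed_face.B L (face_edges \<tau>) (face_lattice \<tau>)) = card J"
proof -
  interpret F: closed_face L "face_edges \<tau>" "face_lattice \<tau>" by (rule F)
  obtain t where t: "t \<in> torus L" "P = torus_act L t (face_point L \<tau>)"
    using P unfolding face_orbit_def by blast
  have tnz: "t z \<noteq> 0" if "z \<in> J" for z using t(1) that by (auto simp: torus_def)
  define \<chi> where "\<chi> \<alpha> = (\<Prod>z\<in>below \<alpha>. t z)" for \<alpha>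
  have \<chi>: "modular_mult L \<chi>" unfolding \<chi>_def by (rule modular_mult_prod_below)
  have \<chi>nz: "\<chi> \<alpha> \<noteq> 0" for \<alpha> using tnz by (auto simp: \<chi>_def below_def)
  have P_eq: "P = F.orbit_pt \<chi>"
    by (auto simp: t(2) torus_act_def torus_char_ideal_vec face_point_eq F.orbit_pt_def \<chi>_def fun_eq_iff)
  have PX: "P \<in> hibi_variety L"
    unfolding hibi_variety_iff P_eq
    using F.modular_orbit_pt[OF \<chi>] F.D_subset by (auto simp: affine_space_def F.orbit_pt_def)
  have "tangent_space L (hibi_variety L) P = F.orbit_tangent P"
    by (simp add: tangent_space_hibi_variety[OF infinite_alg_closed_field PX] F.orbit_tangent_def)
  then have dim: "fun_space.dim (tangent_space L (hibi_variety L) P) = card F.B"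
    using F.dim_orbit_tangent[OF \<chi> \<chi>nz] by (simp add: P_eq)
  have "\<exists>w s0. modular_weight w \<and> (\<exists>\<alpha>\<in>L. w \<alpha> \<noteq> 0) \<and> P = weighted_pt w s0 t"
  proof (cases "face_lattice \<tau> = L")
    case True
    \<comment> \<open>In the open orbit no element is missing from \<open>D\<close>, so counting
      cuts would give the zero weight; simultaneous scaling of all coordinates is used
      instead.\<close>
    have "P = weighted_pt (\<lambda>_. 1) 1 t"
      unfolding fun_eq_iff P_eq F.orbit_pt_def weighted_pt_def \<chi>_def unfolding True by simp
    moreover have "modular_weight (\<lambda>_. 1)" by (simp add: modular_weight_def)
    ultimately show ?thesis using nonempty by (intro exI[of _ "\<lambda>_. 1"] exI[of _ 1]) auto
  next
    case False
    \<comment> \<open>A modular weight that vanishes exactly on \<open>D\<close>, so that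
      \<open>s = 0\<close> gives the point \<open>P\<close>.\<close>
    define w where "w \<alpha> = card (F.Cut \<alpha>)" for \<alpha>
    have "modular_weight w"
      unfolding modular_weight_def w_def
      using card_Un_Int[OF F.finite_Cut F.finite_Cut] F.Cut_modular by metis
    moreover obtain \<alpha> where "\<alpha> \<in> L" "\<alpha> \<notin> face_lattice \<tau>" using False F.D_subset by blast
    then have "w \<alpha> \<noteq> 0" using F.in_D_iff[of \<alpha>] by (simp add: w_def)
    moreover have "P = weighted_pt w 0 t"
    proof
      fix \<beta> show "P \<beta> = weighted_pt w 0 t \<beta>"
        using F.in_D_iff[of \<beta>] F.D_subset
        by (cases "\<beta> \<in> L") (auto simp: P_eq F.orbit_pt_def weighted_pt_def \<chi>_def w_def zero_power card_gt_0_iff)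
    qed
    ultimately show ?thesis using \<open>\<alpha> \<in> L\<close> by blast
  qed
  then obtain w s0 where "modular_weight w" "\<exists>\<alpha>\<in>L. w \<alpha> \<noteq> 0" "P = weighted_pt w s0 t" by blast
  then have "enat (card J) \<le> local_dim L (hibi_variety L) P"
    using local_dim_hibi_variety_ge[OF infinite_alg_closed_field, of w t s0] tnz by simp
  then have "local_dim L (hibi_variety L) P = enat (card J)"
    using local_dim_hibi_variety_le antisym by blast
  then show ?thesis using PX dim by (simp add: smooth_at_def)
qed

lemma smooth_along_iff:
  assumes "closed_face L (face_edges \<tau>) (face_lattice \<tau>)"
  shows "smooth_along L (hibi_variety L) (face_orbit L \<tau> :: ('a \<Rightarrow> 'k::alg_closed_field) set)
    \<longleftrightarrow> card (closed_face.B L (face_edges \<tau>) (face_lattice \<tau>)) = card J"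
  using smooth_at_iff[OF assms] face_orbit_ne unfolding smooth_along_def by blast

end

section \<open>The Grassmann lattice\<close>

lemma (in finite_sublattice) J_le_upper_bound:
  assumes "z \<in> J" "finite S" "S \<noteq> {}" "S \<subseteq> L"
  shows "\<exists>\<sigma>\<in>L. (\<forall>s\<in>S. s \<le> \<sigma>) \<and> (z \<le> \<sigma> \<longrightarrow> (\<exists>s\<in>S. z \<le> s))"
  using assms(2-4)
proof (induction S rule: finite_ne_induct)
  case (insert s S)
  then obtain \<sigma> where \<sigma>: "\<sigma> \<in> L" "\<forall>s\<in>S. s \<le> \<sigma>" "z \<le> \<sigma> \<longrightarrow> (\<exists>s\<in>S. z \<le> s)" by auto
  have "s \<in> L" using insert by auto
  then show ?case
    using \<sigma> supL[of s \<sigma>] J_prime[OF assms(1), of s \<sigma>] by (intro bexI[of _ "sup s \<sigma>"]) (auto intro: le_supI2)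
qed auto

section \<open>The join irreducibles of the Grassmann lattice as a grid\<close>

locale grassmann =
  fixes d n :: nat
  assumes d_pos: "1 \<le> d" and d_le_n: "d \<le> n"
begin

abbreviation G where "G \<equiv> grassmann_lattice d n"

lemma G_gap:
  assumes "\<alpha> \<in> G" "1 \<le> k" "k + m \<le> d"
  shows "\<alpha> k + m \<le> \<alpha> (k + m)"
  using assms(3)
proof (induction m)
  case (Suc m)
  have "strict_mono_on {1..d} \<alpha>" using assms(1) by (simp add: grassmann_lattice_def)
  then have "\<alpha> (k + m) < \<alpha> (k + Suc m)"
    by (rule strict_mono_onD) (use assms Suc.prems in auto)
  then show ?case using Suc by simp
qed simp

lemma G_gap': "\<alpha> \<in> G \<Longrightarrow> 1 \<le> k \<Longrightarrow> k \<le> l \<Longrightarrow> l \<le> d \<Longrightarrow> \<alpha> k + (l - k) \<le> \<alpha> l"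
  using G_gap[of \<alpha> k "l - k"] by simp

lemma G_range: "\<alpha> \<in> G \<Longrightarrow> 1 \<le> k \<Longrightarrow> k \<le> d \<Longrightarrow> 1 \<le> \<alpha> k \<and> \<alpha> k \<le> n"
  by (auto simp: grassmann_lattice_def image_subset_iff)

lemma G_outside: "\<alpha> \<in> G \<Longrightarrow> k \<notin> {1..d} \<Longrightarrow> \<alpha> k = 0"
  by (simp add: grassmann_lattice_def)

lemma G_lower: "\<alpha> \<in> G \<Longrightarrow> 1 \<le> k \<Longrightarrow> k \<le> d \<Longrightarrow> k \<le> \<alpha> k"
  using G_gap'[of \<alpha> 1 k] G_range[of \<alpha> 1] d_pos by force

lemma G_upper: "\<alpha> \<in> G \<Longrightarrow> 1 \<le> k \<Longrightarrow> k \<le> d \<Longrightarrow> \<alpha> k \<le> n - d + k"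
  using G_gap'[of \<alpha> k d] G_range[of \<alpha> d] d_pos by force

lemma mu_in_G: "i \<le> n - d \<Longrightarrow> j < d \<Longrightarrow> mu d i j \<in> G"
  using d_le_n by (auto simp: grassmann_lattice_def mu_def strict_mono_on_def)

text \<open>\<open>mu d i j\<close> is the least tuple whose entry at \<open>j + 1\<close> is at
  least \<open>i + j + 1\<close>: strict monotonicity forces the later entries, and the earlier ones
  are minimal.\<close>

lemma mu_le_iff:
  assumes "\<alpha> \<in> G" "j < d"
  shows "mu d i j \<le> \<alpha> \<longleftrightarrow> i + j + 1 \<le> \<alpha> (j + 1)"
proof
  assume "mu d i j \<le> \<alpha>"
  then have "mu d i j (j + 1) \<le> \<alpha> (j + 1)" by (simp add: le_fun_def)
  then show "i + j + 1 \<le> \<alpha> (j + 1)" using assms(2) by (simp add: mu_def)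
next
  assume *: "i + j + 1 \<le> \<alpha> (j + 1)"
  have "mu d i j k \<le> \<alpha> k" for k
  proof -
    consider "k \<in> {1..j}" | "k \<in> {j+1..d}" | "k \<notin> {1..d}" by force
    then show ?thesis
    proof cases
      case 1
      then show ?thesis using G_lower[OF assms(1), of k] assms(2) by (simp add: mu_def)
    next
      case 2
      then show ?thesis using G_gap'[OF assms(1), of "j + 1" k] * by (simp add: mu_def)
    qed (use assms(2) in \<open>auto simp: mu_def\<close>)
  qed
  then show "mu d i j \<le> \<alpha>" by (simp add: le_fun_def)
qed

text \<open>The order of the grid, reversed in \<open>j\<close>. It starts at \<open>i = 1\<close>,
  because all \<open>mu d 0 j\<close> coincide with the least element.\<close>

lemma mu_le_mu:
  assumes "i \<ge> 1" "i' \<le> n - d" "j < d" "j' < d"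
  shows "mu d i j \<le> mu d i' j' \<longleftrightarrow> i \<le> i' \<and> j' \<le> j"
  using mu_le_iff[OF mu_in_G[OF assms(2,4)] assms(3), of i] assms by (auto simp: mu_def)

lemma mu_inject:
  assumes "mu d i j = mu d i' j'" "i \<ge> 1" "i \<le> n - d" "i' \<le> n - d" "j < d" "j' < d"
  shows "i = i' \<and> j = j'"
proof -
  have "i \<le> i'" "j' \<le> j" using mu_le_mu[of i i' j j'] assms by auto
  moreover have "i' \<le> i" "j \<le> j'" using mu_le_mu[of i' i j' j] assms \<open>i \<le> i'\<close> by auto
  ultimately show ?thesis by simp
qed

lemma mu_less:
  assumes "1 \<le> i" "i \<le> i'" "i' \<le> n - d" "j' \<le> j" "j < d" "(i, j) \<noteq> (i', j')"
  shows "mu d i j < mu d i' j'"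
proof -
  have "mu d i j \<le> mu d i' j'" using assms by (simp add: mu_le_mu)
  moreover have "mu d i j \<noteq> mu d i' j'" using mu_inject[of i j i' j'] assms by auto
  ultimately show ?thesis by simp
qed

lemma mu_0: "j < d \<Longrightarrow> mu d 0 j = mu d 0 0"
  by (auto simp: mu_def fun_eq_iff)

sublocale hibi "grassmann_lattice d n"
proof
  have "G \<subseteq> {f. \<forall>k. (k \<in> {1..d} \<longrightarrow> f k \<in> {0..n}) \<and> (k \<notin> {1..d} \<longrightarrow> f k = 0)}"
    using G_range G_outside by fastforce
  then show "finite G" by (rule finite_subset) (rule finite_set_of_finite_funs, auto)
  show "G \<noteq> {}" using mu_in_G[of 0 0] d_pos by auto
  fix a b assume ab: "a \<in> G" "b \<in> G"
  have mono: "a k < a l" "b k < b l" if "k \<in> {1..d}" "l \<in> {1..d}" "k < l" for k l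
    using ab that strict_mono_onD unfolding grassmann_lattice_def by blast+
  have "strict_mono_on {1..d} (sup a b)" "strict_mono_on {1..d} (inf a b)"
    unfolding strict_mono_on_def sup_apply inf_apply sup_nat_def inf_nat_def
    using mono by (metis max.strict_coboundedI1 max.strict_coboundedI2 max_less_iff_conj
        min.strict_coboundedI1 min.strict_coboundedI2 min_less_iff_conj)+
  then show "sup a b \<in> G" "inf a b \<in> G"
    using ab by (auto simp: grassmann_lattice_def sup_nat_def inf_nat_def max_def min_def image_subset_iff)
qed

text \<open>Every tuple is the join of the elements \<open>mu d (z k - k) (k - 1)\<close>, so an
  irreducible one is among them. Conversely, comparison with \<open>mu d i j\<close> concerns one
  entry, and a maximum reaches a bound only if one of its arguments does.\<close>

lemma J_eq: "J = {mu d i j | i j. i \<le> n - d \<and> j < d}"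
proof (intro equalityI subsetI)
  fix z assume z: "z \<in> J"
  then have zG: "z \<in> G" by (rule J_in_L)
  define S where "S = (\<lambda>k. mu d (z k - k) (k - 1)) ` {1..d}"
  have bound: "z k - k \<le> n - d" if "k \<in> {1..d}" for k using G_upper[OF zG, of k] that by auto
  have "S \<noteq> {}" "finite S" "S \<subseteq> G" using d_pos mu_in_G bound by (auto simp: S_def)
  then obtain \<sigma> where \<sigma>: "\<sigma> \<in> G" "\<forall>s\<in>S. s \<le> \<sigma>" "z \<le> \<sigma> \<longrightarrow> (\<exists>s\<in>S. z \<le> s)"
    using J_le_upper_bound[OF z, of S] by blast
  have "z k \<le> \<sigma> k" for k
  proof (cases "k \<in> {1..d}")
    case True
    then have "k - 1 < d" "mu d (z k - k) (k - 1) \<le> \<sigma>" using \<sigma>(2) by (auto simp: S_def)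
    then show ?thesis using mu_le_iff[OF \<sigma>(1), of "k - 1" "z k - k"] True G_lower[OF zG, of k] by simp
  qed (use G_outside[OF zG] in simp)
  then obtain s where s: "s \<in> S" "z \<le> s" using \<sigma>(3) by (auto simp: le_fun_def)
  then obtain k where k: "k \<in> {1..d}" "s = mu d (z k - k) (k - 1)" by (auto simp: S_def)
  have k1: "k - 1 < d" using k(1) by auto
  then have "s \<le> z" using mu_le_iff[OF zG, of "k - 1" "z k - k"] k G_lower[OF zG, of k] by simp
  then have "z = mu d (z k - k) (k - 1)" using s(2) k(2) by simp
  moreover note k1
  ultimately show "z \<in> {mu d i j | i j. i \<le> n - d \<and> j < d}" using bound[OF k(1)] by blast
next
  fix z assume "z \<in> {mu d i j | i j. i \<le> n - d \<and> j < d}"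
  then obtain i j where ij: "z = mu d i j" "i \<le> n - d" "j < d" by blast
  have zG: "z \<in> G" using ij mu_in_G by simp
  have "z = x \<or> z = y" if xy: "x \<in> G" "y \<in> G" "z = sup x y" for x y
  proof -
    have "mu d i j \<le> sup x y" using ij(1) xy(3) by simp
    then have "i + j + 1 \<le> max (x (j + 1)) (y (j + 1))"
      using mu_le_iff[OF supL[OF xy(1,2)] ij(3), of i] by (simp add: sup_nat_def)
    then have "z \<le> x \<or> z \<le> y"
      using mu_le_iff[OF xy(1) ij(3), of i] mu_le_iff[OF xy(2) ij(3), of i] ij(1) by auto
    then show ?thesis using xy(3) by (metis order_antisym sup.cobounded1 sup.cobounded2)
  qed
  then show "z \<in> J" using zG unfolding join_irreducibles_def by blast
qed

lemma mu_in_J: "i \<le> n - d \<Longrightarrow> j < d \<Longrightarrow> mu d i j \<in> J"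
  using J_eq by blast

abbreviation bot where "bot \<equiv> mu d 0 0"

lemma bot_le: "\<alpha> \<in> G \<Longrightarrow> bot \<le> \<alpha>"
  using mu_le_iff[of \<alpha> 0 0] G_lower[of \<alpha> 1] d_pos by simp

lemma J_cases [consumes 1, case_names bot mu]:
  assumes "z \<in> J"
  obtains "z = bot" | i j where "z = mu d i j" "1 \<le> i" "i \<le> n - d" "j < d" "z \<noteq> bot"
proof -
  obtain i j where ij: "z = mu d i j" "i \<le> n - d" "j < d" using assms J_eq by blast
  show ?thesis
  proof (cases "i = 0")
    case True
    then show ?thesis using that(1) ij mu_0[of j] by auto
  next
    case False
    then have "z \<noteq> bot" using mu_inject[of i j 0 0] ij d_pos by auto
    then show ?thesis using that(2)[of i j] ij False by simp
  qed
qed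

lemma J_le_top: "z \<in> J \<Longrightarrow> z \<le> mu d (n - d) 0"
proof (induction rule: J_cases)
  case bot
  then show ?case using bot_le mu_in_G[of "n - d" 0] d_pos by simp
qed (use d_pos in \<open>simp add: mu_le_mu\<close>)

lemma edge_None: "(z, None) \<in> edges \<Longrightarrow> z = mu d (n - d) 0"
  using J_le_top[of z] mu_in_J[of "n - d" 0] d_pos by (auto simp: edges_def le_less)

lemma edge_bot:
  assumes "(bot, Some y) \<in> edges"
  shows "y = mu d 1 (d - 1) \<and> 1 \<le> n - d"
proof -
  have y: "covers_in J y bot" using assms by (auto simp: edges_def)
  then have "y \<in> J" "bot < y" by (auto simp: covers_in_def)
  then obtain i j where ij: "y = mu d i j" "1 \<le> i" "i \<le> n - d" "j < d" by (auto elim: J_cases)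
  let ?w = "mu d 1 (d - 1)"
  have w: "?w \<in> J" using mu_in_J ij d_pos by simp
  have "?w \<noteq> bot" using mu_inject[of 1 "d - 1" 0 0] ij d_pos by auto
  then have "bot < ?w" using bot_le[OF J_in_L[OF w]] by simp
  moreover have "?w \<le> y" using ij d_pos by (simp add: mu_le_mu)
  ultimately have "?w = y" using y w unfolding covers_in_def by (auto simp: le_less)
  then show ?thesis using ij by simp
qed

lemma edge_mu:
  assumes "(mu d i j, Some y) \<in> edges" "1 \<le> i" "i \<le> n - d" "j < d"
  shows "(y = mu d (i + 1) j \<and> i + 1 \<le> n - d) \<or> (y = mu d i (j - 1) \<and> 1 \<le> j)"
proof -
  have y: "covers_in J y (mu d i j)" using assms by (auto simp: edges_def)
  then have yJ: "y \<in> J" "mu d i j < y" by (auto simp: covers_in_def)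
  have no: "w = y" if "w \<in> J" "mu d i j < w" "w \<le> y" for w
    using y that unfolding covers_in_def by (auto simp: le_less)
  have "y \<noteq> bot" using yJ(2) bot_le[OF mu_in_G[OF assms(3,4)]] by auto
  with yJ(1) obtain i' j' where ij: "y = mu d i' j'" "1 \<le> i'" "i' \<le> n - d" "j' < d" by (auto elim: J_cases)
  have le: "i \<le> i'" "j' \<le> j" using yJ(2) ij assms mu_le_mu[of i i' j j'] by auto
  show ?thesis
  proof (cases "i < i'")
    case True
    have "mu d i j < mu d (i + 1) j"
      by (rule mu_less) (use assms True ij(3) in auto)
    moreover have "mu d (i + 1) j \<le> y" using True le ij assms by (simp add: mu_le_mu)
    ultimately have "mu d (i + 1) j = y" using no[of "mu d (i + 1) j"] mu_in_J True ij(3) assms(4) by simp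
    then show ?thesis using True ij(3) by simp
  next
    case False
    then have "i = i'" using le by simp
    then have "j' < j" using yJ(2) ij(1) le(2) by (cases "j = j'") auto
    then have j: "j - 1 < d" "j - 1 \<le> j" "j - 1 \<noteq> j" "j' \<le> j - 1" using assms(4) by auto
    have "mu d i j < mu d i (j - 1)"
      by (rule mu_less) (use assms(2-4) j in auto)
    moreover have "mu d i (j - 1) \<le> y" using \<open>i = i'\<close> j ij by (simp add: mu_le_mu)
    ultimately have "mu d i (j - 1) = y" using no[of "mu d i (j - 1)"] mu_in_J[OF assms(3) j(1)] by simp
    then show ?thesis using \<open>j' < j\<close> by simp
  qed
qed

text \<open>The equation says that \<open>(i', j')\<close> arises from \<open>(i, j)\<close> by one
  unit step, up in \<open>i\<close> or down in \<open>j\<close>.\<close>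

lemma covers_between:
  assumes "1 \<le> i" "i \<le> i'" "i' \<le> n - d" "j' \<le> j" "j < d" "i' + j = i + j' + 1"
  shows "(mu d i j, Some (mu d i' j')) \<in> edges"
proof -
  have "mu d i j < mu d i' j'"
    by (rule mu_less) (use assms in auto)
  moreover have "\<not> (mu d i j < z \<and> z < mu d i' j')" if z: "z \<in> J" for z
  proof
    assume *: "mu d i j < z \<and> z < mu d i' j'"
    have "z \<noteq> bot" using * bot_le[OF mu_in_G, of i j] assms by auto
    with z obtain i1 j1 where ij: "z = mu d i1 j1" "1 \<le> i1" "i1 \<le> n - d" "j1 < d" by (auto elim: J_cases)
    have "i \<le> i1" "j1 \<le> j" "i1 \<le> i'" "j' \<le> j1"
      using * ij assms mu_le_mu[of i i1 j j1] mu_le_mu[of i1 i' j1 j'] by auto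
    then have "(i1 = i \<and> j1 = j) \<or> (i1 = i' \<and> j1 = j')" using assms(6) by linarith
    then show False using * ij(1) by auto
  qed
  ultimately show ?thesis using mu_in_J assms by (auto simp: edges_def covers_in_def)
qed

text \<open>Within the lattice \<open>lam d n i j\<close> restricts only the entry at
  \<open>j\<close>, and exceeding it there means lying above \<open>mu d (i + 1) (j - 1)\<close>,
  the corner of a grid square opposite to \<open>mu d i j\<close>.\<close>

lemma interval_iff:
  assumes "\<alpha> \<in> G" "1 \<le> j" "j < d"
  shows "\<alpha> \<in> {mu d i j..lam d n i j} \<longleftrightarrow> mu d i j \<le> \<alpha> \<and> \<not> mu d (i + 1) (j - 1) \<le> \<alpha>"
proof -
  have "\<alpha> \<le> lam d n i j \<longleftrightarrow> \<alpha> j \<le> i + j"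
  proof
    assume "\<alpha> \<le> lam d n i j"
    then have "\<alpha> j \<le> lam d n i j j" by (simp add: le_fun_def)
    then show "\<alpha> j \<le> i + j" using assms by (simp add: lam_def)
  next
    assume *: "\<alpha> j \<le> i + j"
    have "\<alpha> k \<le> lam d n i j k" for k
    proof -
      consider "k \<in> {1..j}" | "k \<in> {j+1..d}" | "k \<notin> {1..d}" by force
      then show ?thesis
      proof cases
        case 1
        then show ?thesis using G_gap'[OF assms(1), of k j] * assms(3) by (simp add: lam_def)
      next
        case 2
        then show ?thesis using G_upper[OF assms(1), of k] d_le_n by (simp add: lam_def)
      next
        case 3
        then show ?thesis using G_outside[OF assms(1)] by simp
      qed
    qed
    then show "\<alpha> \<le> lam d n i j" by (simp add: le_fun_def)
  qed
  moreover have "mu d (i + 1) (j - 1) \<le> \<alpha> \<longleftrightarrow> \<not> \<alpha> j \<le> i + j"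
    using mu_le_iff[OF assms(1), of "j - 1" "i + 1"] assms(2,3) by auto
  ultimately show ?thesis by auto
qed

lemma sigma_ij_props:
  assumes "1 \<le> i" "i + 1 \<le> n - d" "1 \<le> j" "j < d"
  shows "cone_face G (sigma_ij K d n i j) \<and> face_lattice (sigma_ij K d n i j) = sublattice_ij d n i j"
proof -
  define a b c where "a = mu d i j" and "b = mu d (i + 1) j" and "c = mu d (i + 1) (j - 1)"
  have e: "(a, Some b) \<in> edges" "(b, Some c) \<in> edges"
    unfolding a_def b_def c_def by (rule covers_between; use assms in simp)+
  then have le: "a \<le> b" "b \<le> c" by (auto simp: edges_def covers_in_def)
  \<comment> \<open>The sum of the generators along one path through the square pairs with ideal
    vectors as the indicator of the removed interval.\<close>
  define v where "v = edge_vec (a, Some b) + edge_vec (b, Some c)"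
  have v: "v \<in> hibi_cone G" unfolding v_def by (intro hibi_cone_add edge_vec_in_cone e)
  have pv: "pairing G (ideal_real \<alpha>) v = of_bool (a \<le> \<alpha> \<and> \<not> c \<le> \<alpha>)" for \<alpha>
  proof -
    have "pairing G (ideal_real \<alpha>) v = pairing G (ideal_real \<alpha>) (edge_vec (a, Some b))
        + pairing G (ideal_real \<alpha>) (edge_vec (b, Some c))"
      by (simp add: pairing_def v_def algebra_simps flip: sum.distrib)
    also have "\<dots> = of_bool (cut \<alpha> (a, Some b)) + of_bool (cut \<alpha> (b, Some c))"
      by (simp only: pairing_edge_vec[OF e(1)] pairing_edge_vec[OF e(2)] ediff_ideal_real[OF e(1)] ediff_ideal_real[OF e(2)])
    also have "\<dots> = of_bool (a \<le> \<alpha> \<and> \<not> c \<le> \<alpha>)" using le order_trans by auto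
    finally show ?thesis .
  qed
  have sub: "\<alpha> \<in> sublattice_ij d n i j \<longleftrightarrow> \<alpha> \<in> G \<and> \<not> (a \<le> \<alpha> \<and> \<not> c \<le> \<alpha>)" for \<alpha>
    using interval_iff[of \<alpha> j i] assms(3,4) unfolding sublattice_ij_def a_def c_def by blast
  have "\<exists>\<tau>. cone_face G \<tau> \<and> face_lattice \<tau> = sublattice_ij d n i j"
  proof (rule ex_cone_face)
    show "sublattice_ij d n i j \<subseteq> G" using sub by blast
    fix \<beta> assume "\<beta> \<in> G" "\<beta> \<notin> sublattice_ij d n i j"
    then show "\<exists>v\<in>hibi_cone G. (\<forall>\<alpha>\<in>sublattice_ij d n i j. pairing G (ideal_real \<alpha>) v = 0) \<and>
        pairing G (ideal_real \<beta>) v \<noteq> 0"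
      using sub pv by (intro bexI[OF _ v]) auto
  qed
  moreover have "\<tau> = \<tau>'"
    if "cone_face G \<tau>" "face_lattice \<tau> = face_lattice \<tau>'" "cone_face G \<tau>'" for \<tau> \<tau>'
    using cone_face_eq[OF that(1)] cone_face_eq[OF that(3)] that(2) by simp
  ultimately have "\<exists>!\<tau>. cone_face G \<tau> \<and> face_lattice \<tau> = sublattice_ij d n i j" by metis
  then show ?thesis unfolding sigma_ij_def face_sublattice_eq by (rule theI')
qed

lemma sigma_ij_subset_iff:
  assumes "cone_face G \<tau>" "1 \<le> i" "i + 1 \<le> n - d" "1 \<le> j" "j < d"
  shows "sigma_ij K d n i j \<subseteq> \<tau> \<longleftrightarrow>
    (\<forall>\<delta>\<in>face_lattice \<tau>. mu d i j \<le> \<delta> \<longrightarrow> mu d (i + 1) (j - 1) \<le> \<delta>)"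
proof -
  have "sigma_ij K d n i j \<subseteq> \<tau> \<longleftrightarrow> face_lattice \<tau> \<subseteq> sublattice_ij d n i j"
    using sigma_ij_props[of i j K] assms subface_iff[of "sigma_ij K d n i j" \<tau>] by simp
  moreover have "\<delta> \<in> sublattice_ij d n i j \<longleftrightarrow> (mu d i j \<le> \<delta> \<longrightarrow> mu d (i + 1) (j - 1) \<le> \<delta>)"
    if "\<delta> \<in> face_lattice \<tau>" for \<delta>
  proof -
    have "\<delta> \<in> G" using that by (simp add: face_lattice_def)
    then show ?thesis using interval_iff[of \<delta> j i] assms(4,5) by (auto simp: sublattice_ij_def)
  qed
  ultimately show ?thesis by blast
qed

section \<open>Squares and single cuts in a face\<close>

context
  fixes \<tau> :: "((nat \<Rightarrow> nat) \<Rightarrow> real) set"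
  assumes \<tau>: "closed_face G (face_edges \<tau>) (face_lattice \<tau>)"
begin

abbreviation (input) "E \<equiv> face_edges \<tau>"
abbreviation (input) "D \<equiv> face_lattice \<tau>"

interpretation F: closed_face G E D by (rule \<tau>)

lemma square_imp_card_less:
  assumes "1 \<le> i" "i + 1 \<le> n - d" "1 \<le> j" "j < d"
    and sq: "\<forall>\<delta>\<in>D. mu d i j \<le> \<delta> \<longrightarrow> mu d (i + 1) (j - 1) \<le> \<delta>"
  shows "card J < card F.B"
proof -
  define a b c e where "a = mu d i j" and "b = mu d (i + 1) j" and "c = mu d i (j - 1)"
    and "e = mu d (i + 1) (j - 1)"
  have edges: "(a, Some b) \<in> edges" "(b, Some e) \<in> edges" "(a, Some c) \<in> edges" "(c, Some e) \<in> edges"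
    unfolding a_def b_def c_def e_def by (rule covers_between; use assms(1-4) in simp)+
  then have le: "a \<le> b" "b \<le> e" "a \<le> c" "c \<le> e" by (auto simp: edges_def covers_in_def)
  have "e \<le> \<delta>" if "\<delta> \<in> D" "a \<le> \<delta>" for \<delta>
    using sq that by (simp add: a_def e_def)
  then have uncut: "\<not> cut \<delta> (a, Some b)" "\<not> cut \<delta> (b, Some e)" "\<not> cut \<delta> (a, Some c)" "\<not> cut \<delta> (c, Some e)"
    if "\<delta> \<in> D" for \<delta>
    using that le unfolding cut_simps by (meson order_trans)+
  have "(a, Some b) \<in> E" "(b, Some e) \<in> E" "(a, Some c) \<in> E"
    "(c, Some e) \<in> E"
    using edges uncut F.E_def by blast+
  moreover have "\<not> b \<le> c" "\<not> c \<le> b"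
    using assms(1-4) by (auto simp: b_def c_def mu_le_mu)
  ultimately show ?thesis using F.square_card_B[of a b e c] by simp
qed

text \<open>In \<open>single_cut\<close>, \<open>\<kappa>\<close> is \<open>mu d i 0\<close> for a
  step in \<open>i\<close> and \<open>mu d (n - d) j\<close> for a step in \<open>j\<close>; among
  the edges it cuts, those of the grid are parallel to the given one. An edge from the least element
  is cut by \<open>bot\<close>, the edge at the top by the greatest irreducible.\<close>

lemma no_square_imp_single_cut:
  assumes no: "\<And>i j. 1 \<le> i \<Longrightarrow> i + 1 \<le> n - d \<Longrightarrow> 1 \<le> j \<Longrightarrow> j < d \<Longrightarrow>
      \<exists>\<delta>\<in>D. mu d i j \<le> \<delta> \<and> \<not> mu d (i + 1) (j - 1) \<le> \<delta>"
    and e: "(x, t) \<in> E"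
  shows "\<exists>\<alpha>\<in>G. F.Cut \<alpha> = {(x, t)}"
proof -
  have uncut: "y' \<le> \<delta>" if "(x', Some y') \<in> E" "\<delta> \<in> D" "x' \<le> \<delta>" for x' y' \<delta>
    using that F.E_def by fastforce
  have edge: "e \<in> edges" if "e \<in> E" for e using that F.E_edges by blast
  have xJ: "x \<in> J" if "(x, t) \<in> E" for x t
    using edge[OF that] by (auto simp: edges_def covers_in_def)
  \<comment> \<open>For \<open>n = d\<close> the least irreducible is also the greatest one and has
    only the edge to \<open>None\<close>.\<close>
  have from_bot: "t = (if n = d then None else Some (mu d 1 (d - 1)))" if "(bot, t) \<in> E" for t
  proof (cases t)
    case None
    then have "bot = mu d (n - d) 0" using edge_None edge[OF that] by blast
    then have "\<not> 1 \<le> n - d" using mu_inject[of "n - d" 0 0 0] d_pos by auto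
    then show ?thesis using None d_le_n by simp
  next
    case (Some y)
    then show ?thesis using edge_bot[of y] edge[OF that] by auto
  qed
  from xJ[OF e] show ?thesis
  proof (cases rule: J_cases)
    case bot
    have above_bot: "\<not> y \<le> bot" if "t = Some y" for y
      using that edge[OF e] bot by (auto simp: edges_def covers_in_def)
    show ?thesis
    proof (rule F.single_cut[OF e, of bot])
      show "cut bot (x, t)" using bot above_bot by (cases t) auto
      fix e' assume e': "e' \<in> E" "cut bot e'"
      obtain x' t' where e'_eq: "e' = (x', t')" by fastforce
      then have "x' \<in> J" "x' \<le> bot" using xJ e' by (auto simp: cut_def)
      then have "x' = bot" using bot_le[OF J_in_L] by (simp add: order_antisym)
      then show "e' = (x, t)" using from_bot[of t] from_bot[of t'] e e' bot e'_eq by auto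
    qed
  next
    case (mu i j)
    have nd: "n \<noteq> d" using mu(2,3) by auto
    show ?thesis
    proof (cases t)
      case None
      show ?thesis
      proof (rule F.single_cut[OF e, of "mu d (n - d) 0"])
        show "cut (mu d (n - d) 0) (x, t)" using None J_le_top[OF xJ[OF e]] by simp
        fix e' assume e': "e' \<in> E" "cut (mu d (n - d) 0) e'"
        obtain x' t' where e'_eq: "e' = (x', t')" by fastforce
        have "t' = None"
          using e' e'_eq J_le_top edge[OF e'(1)] by (cases t') (auto simp: edges_def covers_in_def)
        then show "e' = (x, t)"
          using edge_None[of x] edge_None[of x'] edge[OF e] edge[OF e'(1)] None e'_eq by simp
      qed
    next
      case (Some y)
      then have "(mu d i j, Some y) \<in> edges" using edge[OF e] mu(1) by simp
      from edge_mu[OF this mu(2-4)] show ?thesis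
      proof (elim disjE conjE)
        assume y: "y = mu d (i + 1) j" and i: "i + 1 \<le> n - d"
        have \<kappa>: "mu d i' j' \<le> mu d i 0 \<longleftrightarrow> i' \<le> i" if "1 \<le> i'" "j' < d" for i' j'
          using that mu(3) d_pos by (simp add: mu_le_mu)
        show ?thesis
        proof (rule F.single_cut[OF e, of "mu d i 0"])
          show "cut (mu d i 0) (x, t)" using \<kappa> mu y Some by simp
          fix e' assume e': "e' \<in> E" "cut (mu d i 0) e'"
            and same: "\<And>\<delta>. \<delta> \<in> D \<Longrightarrow> fst (x, t) \<le> \<delta> \<longleftrightarrow> fst e' \<le> \<delta>"
          obtain x' t' where e'_eq: "e' = (x', t')" by fastforce
          have "x' \<in> J" using xJ e'(1) e'_eq by simp
          then show "e' = (x, t)"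
          proof (cases rule: J_cases)
            case bot
            then show ?thesis using from_bot[of t'] e' e'_eq nd \<kappa>[of 1 "d - 1"] mu d_pos by simp
          next
            case m: (mu i' j')
            have "i' \<le> i" using e' e'_eq m \<kappa> by (auto simp: cut_def)
            show ?thesis
            proof (cases t')
              case None
              then have "mu d i' j' = mu d (n - d) 0" using edge_None edge[OF e'(1)] m(1) e'_eq by simp
              then have "i' = n - d" using mu_inject[of i' j' "n - d" 0] m d_pos by simp
              then show ?thesis using \<open>i' \<le> i\<close> i by simp
            next
              case S: (Some y')
              have y'\<kappa>: "\<not> y' \<le> mu d i 0" using e' e'_eq S by simp
              have "(mu d i' j', Some y') \<in> edges" using edge[OF e'(1)] e'_eq m(1) S by simp
              from edge_mu[OF this m(2-4)] y'\<kappa> \<kappa>[of i' "j' - 1"] m \<open>i' \<le> i\<close>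
              have y': "y' = mu d (i' + 1) j'" by auto
              then have "i' = i" using y'\<kappa> \<kappa>[of "i' + 1" j'] m \<open>i' \<le> i\<close> by simp
              \<comment> \<open>The square is taken at the lower of two parallel edges. A
                \<open>\<delta>\<close> above its least corner lies above the start of the other
                edge, hence above the end of that edge, which lies above the opposite
                corner.\<close>
              have "j' = j"
              proof (rule ccontr)
                assume "j' \<noteq> j"
                then consider "j < j'" | "j' < j" by linarith
                then show False
                proof cases
                  case 1
                  then obtain \<delta> where \<delta>: "\<delta> \<in> D" "x' \<le> \<delta>" "\<not> mu d (i + 1) (j' - 1) \<le> \<delta>"
                    using no[of i j'] mu(2) i m(1,4) \<open>i' = i\<close> by auto
                  then have "mu d (i + 1) j \<le> \<delta>"
                    using uncut[of x y \<delta>] e Some y same[OF \<delta>(1)] e'_eq by simp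
                  moreover have "mu d (i + 1) (j' - 1) \<le> mu d (i + 1) j"
                    using 1 i m(4) by (simp add: mu_le_mu)
                  ultimately show False using \<delta>(3) order_trans by blast
                next
                  case 2
                  then obtain \<delta> where \<delta>: "\<delta> \<in> D" "x \<le> \<delta>" "\<not> mu d (i + 1) (j - 1) \<le> \<delta>"
                    using no[of i j] mu(1,2,4) i by auto
                  then have "mu d (i + 1) j' \<le> \<delta>"
                    using uncut[of x' y' \<delta>] e' S y' same[OF \<delta>(1)] e'_eq \<open>i' = i\<close> by simp
                  moreover have "mu d (i + 1) (j - 1) \<le> mu d (i + 1) j'"
                    using 2 i mu(4) by (simp add: mu_le_mu)
                  ultimately show False using \<delta>(3) order_trans by blast
                qed
              qed
              then show ?thesis using m(1) mu(1) \<open>i' = i\<close> y' y S Some e'_eq by simp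
            qed
          qed
        qed
      next
        assume y: "y = mu d i (j - 1)" and j: "1 \<le> j"
        have \<kappa>: "mu d i' j' \<le> mu d (n - d) j \<longleftrightarrow> j \<le> j'" if "1 \<le> i'" "i' \<le> n - d" "j' < d" for i' j'
          using that mu(4) by (simp add: mu_le_mu)
        show ?thesis
        proof (rule F.single_cut[OF e, of "mu d (n - d) j"])
          show "cut (mu d (n - d) j) (x, t)" using \<kappa>[of i j] \<kappa>[of i "j - 1"] mu y j Some by simp
          fix e' assume e': "e' \<in> E" "cut (mu d (n - d) j) e'"
            and same: "\<And>\<delta>. \<delta> \<in> D \<Longrightarrow> fst (x, t) \<le> \<delta> \<longleftrightarrow> fst e' \<le> \<delta>"
          obtain x' t' where e'_eq: "e' = (x', t')" by fastforce
          have "x' \<in> J" using xJ e'(1) e'_eq by simp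
          then show "e' = (x, t)"
          proof (cases rule: J_cases)
            case bot
            have "j \<le> d - 1" using mu(4) by linarith
            then show ?thesis using bot from_bot[of t'] e' e'_eq nd \<kappa>[of 1 "d - 1"] mu d_pos by simp
          next
            case m: (mu i' j')
            have "j \<le> j'" using e' e'_eq m \<kappa> by (auto simp: cut_def)
            show ?thesis
            proof (cases t')
              case None
              then have "mu d i' j' = mu d (n - d) 0" using edge_None edge[OF e'(1)] m(1) e'_eq by simp
              then have "j' = 0" using mu_inject[of i' j' "n - d" 0] m d_pos by simp
              then show ?thesis using \<open>j \<le> j'\<close> j by simp
            next
              case S: (Some y')
              have y'\<kappa>: "\<not> y' \<le> mu d (n - d) j" using e' e'_eq S by simp
              have "(mu d i' j', Some y') \<in> edges" using edge[OF e'(1)] e'_eq m(1) S by simp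
              from edge_mu[OF this m(2-4)] y'\<kappa> \<kappa>[of "i' + 1" j'] m \<open>j \<le> j'\<close>
              have y': "y' = mu d i' (j' - 1)" by auto
              have "j' - 1 < d" using m(4) by linarith
              then have "\<not> j \<le> j' - 1" using y'\<kappa> y' \<kappa>[of i' "j' - 1"] m(2,3) by simp
              then have "j' = j" using \<open>j \<le> j'\<close> by linarith
              \<comment> \<open>The same argument with rows and columns exchanged.\<close>
              have "i' = i"
              proof (rule ccontr)
                assume "i' \<noteq> i"
                then consider "i < i'" | "i' < i" by linarith
                then show False
                proof cases
                  case 1
                  then obtain \<delta> where \<delta>: "\<delta> \<in> D" "x \<le> \<delta>" "\<not> mu d (i + 1) (j - 1) \<le> \<delta>"
                    using no[of i j] mu(1,2,4) m(3) j by auto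
                  then have "mu d i' (j - 1) \<le> \<delta>"
                    using uncut[of x' y' \<delta>] e' S y' same[OF \<delta>(1)] e'_eq \<open>j' = j\<close> by simp
                  moreover have "mu d (i + 1) (j - 1) \<le> mu d i' (j - 1)"
                    using 1 m(3) mu(4) by (simp add: mu_le_mu)
                  ultimately show False using \<delta>(3) order_trans by blast
                next
                  case 2
                  then obtain \<delta> where \<delta>: "\<delta> \<in> D" "x' \<le> \<delta>" "\<not> mu d (i' + 1) (j - 1) \<le> \<delta>"
                    using no[of i' j] m(1,2) mu(3,4) j \<open>j' = j\<close> by auto
                  then have "mu d i (j - 1) \<le> \<delta>"
                    using uncut[of x y \<delta>] e Some y same[OF \<delta>(1)] e'_eq by simp
                  moreover have "mu d (i' + 1) (j - 1) \<le> mu d i (j - 1)"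
                    using 2 mu(3,4) by (simp add: mu_le_mu)
                  ultimately show False using \<delta>(3) order_trans by blast
                qed
              qed
              then show ?thesis using m(1) mu(1) \<open>j' = j\<close> y' y S Some e'_eq by simp
            qed
          qed
        qed
      qed
    qed
  qed
qed

lemma card_B_eq_iff:
  "card F.B = card J \<longleftrightarrow> (\<forall>i j. 1 \<le> i \<and> i + 1 \<le> n - d \<and> 1 \<le> j \<and> j < d \<longrightarrow>
      (\<exists>\<delta>\<in>D. mu d i j \<le> \<delta> \<and> \<not> mu d (i + 1) (j - 1) \<le> \<delta>))" (is "_ \<longleftrightarrow> ?R")
proof
  assume "card F.B = card J"
  then show ?R using square_imp_card_less by fastforce
next
  assume R: ?R
  have "card F.B \<le> card J"
  proof (rule F.card_B_le_card_J)
    fix e assume "e \<in> E"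
    then show "\<exists>\<alpha>\<in>G. F.Cut \<alpha> = {e}"
      using no_square_imp_single_cut[of "fst e" "snd e"] R by simp
  qed
  then show "card F.B = card J" using F.card_J_le_card_B by simp
qed

end

end

theorem corollary6p18:
  fixes d n :: nat and \<tau> :: "((nat \<Rightarrow> nat) \<Rightarrow> real) set"
  assumes "1 \<le> d" and "d \<le> n"
    and "cone_face (grassmann_lattice d n) \<tau>"
  shows "smooth_along (grassmann_lattice d n)
           (hibi_variety (grassmann_lattice d n) :: ((nat \<Rightarrow> nat) \<Rightarrow> 'k::alg_closed_field) set)
           (face_orbit (grassmann_lattice d n) \<tau>)
         \<longleftrightarrow> \<not> (\<exists>i\<in>{1..n - d - 1}. \<exists>j\<in>{1..d - 1}. sigma_ij TYPE('k) d n i j \<subseteq> \<tau>)"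
proof -
  interpret grassmann d n using assms(1,2) by unfold_locales
  have F: "closed_face G (face_edges \<tau>) (face_lattice \<tau>)"
    by (rule closed_face_cone_face[OF assms(3)])
  have "(\<exists>i\<in>{1..n - d - 1}. \<exists>j\<in>{1..d - 1}. sigma_ij TYPE('k) d n i j \<subseteq> \<tau>) \<longleftrightarrow>
      (\<exists>i j. 1 \<le> i \<and> i + 1 \<le> n - d \<and> 1 \<le> j \<and> j < d \<and> sigma_ij TYPE('k) d n i j \<subseteq> \<tau>)"
  proof -
    \<comment> \<open>Truncated subtraction is harmless: where it truncates, both the interval and
      the inequalities are void.\<close>
    have "i \<in> {1..n - d - 1} \<longleftrightarrow> 1 \<le> i \<and> i + 1 \<le> n - d" "j \<in> {1..d - 1} \<longleftrightarrow> 1 \<le> j \<and> j < d" for i j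
      by auto
    then show ?thesis by blast
  qed
  also have "\<dots> \<longleftrightarrow> (\<exists>i j. 1 \<le> i \<and> i + 1 \<le> n - d \<and> 1 \<le> j \<and> j < d \<and>
      (\<forall>\<delta>\<in>face_lattice \<tau>. mu d i j \<le> \<delta> \<longrightarrow> mu d (i + 1) (j - 1) \<le> \<delta>))"
    using sigma_ij_subset_iff[OF assms(3)] by blast
  finally show ?thesis
    unfolding smooth_along_iff[OF F] card_B_eq_iff[OF F] by blast
qed

end
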